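(* Let $\Omega$ be a measurable subset of $\mathbb{R}^d$ with $|\Omega|<\infty$. Then the following are equivalent. (i) The only tight frame measure for $L^2(\Omega)$ is the Lebesgue measure on $\mathbb{R}^d$, up to a positive constant multiple. (ii) $|\Omega\cap(\Omega+x)|>0$ for all $x\in\mathbb{R}^d\setminus\{0\}$.
   Context: $|\cdot|$ denotes Lebesgue measure. A (positive) locally finite Borel measure $\mu$ on $\mathbb{R}^d$ is called a tight frame measure for $L^2(\Omega)$ if there is a constant $A>0$ such that $$\int_{\mathbb{R}^d}|\widehat f(\lambda)|^2\,d\mu(\lambda)=A\int_\Omega|f(x)|^2dx\quad\text{for all }f\in L^2(\Omega),$$ where $\widehat f(\lambda)=\int_\Omega f(x)e^{-2\pi i\langle\lambda,x\rangle}dx$ (well defined for every $\lambda$ since $|\Omega|<\infty$). *)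

theory Defs
  imports "HOL-Analysis.Analysis"
begin

text \<open>
  Elements of \<open>L\<^sup>2(\<Omega>)\<close> are represented by functions on the whole space; only their
  restriction to \<open>\<Omega>\<close> is constrained, and functions equal almost everywhere on \<open>\<Omega>\<close>
  are not identified.
\<close>

definition L2_space :: "(real^'d) set \<Rightarrow> (real^'d \<Rightarrow> complex) set" where
  "L2_space \<Omega> = {f. f \<in> borel_measurable (lebesgue_on \<Omega>) \<and>
                     integrable (lebesgue_on \<Omega>) (\<lambda>x. (norm (f x))\<^sup>2)}"

definition fourier_on :: "(real^'d) set \<Rightarrow> (real^'d \<Rightarrow> complex) \<Rightarrow> real^'d \<Rightarrow> complex" where
  "fourier_on \<Omega> f \<xi> =
     (LINT x|lebesgue_on \<Omega>. f x * exp (- (2 * complex_of_real pi * \<i> * complex_of_real (\<xi> \<bullet> x))))"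

definition locally_finite_measure :: "(real^'d) measure \<Rightarrow> bool" where
  "locally_finite_measure \<mu> \<longleftrightarrow> (\<forall>x. \<exists>U. open U \<and> x \<in> U \<and> emeasure \<mu> U < \<infinity>)"

text \<open>
  The frame identity is stated with nonnegative integrals in \<open>[0,\<infinity>]\<close>, so that an infinite
  left-hand side counts as a failure of the identity rather than as the value \<open>0\<close> that the
  Bochner integral assigns to a non-integrable function.
\<close>

definition tight_frame_measure :: "(real^'d) set \<Rightarrow> (real^'d) measure \<Rightarrow> bool" where
  "tight_frame_measure \<Omega> \<mu> \<longleftrightarrow>
     sets \<mu> = sets borel \<and> locally_finite_measure \<mu> \<and>
     (\<exists>A>0::real. \<forall>f\<in>L2_space \<Omega>.
        (\<integral>\<^sup>+ \<xi>. ennreal ((norm (fourier_on \<Omega> f \<xi>))\<^sup>2) \<partial>\<mu>)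
          = ennreal A * (\<integral>\<^sup>+ x. ennreal ((norm (f x))\<^sup>2) \<partial>lebesgue_on \<Omega>))"

end

theory Submission
  imports Defs "HOL-Probability.Probability"
begin

text \<open>
  The overlap condition forces uniqueness as follows. Let \<open>\<mu>\<close> be tight with constant \<open>A\<close>, and let
  \<open>h\<close> live on the union \<open>X\<close> of two small balls around \<open>p\<close> and \<open>q\<close>. Since
  \<open>(\<Omega> - p) \<inter> (\<Omega> - q)\<close> has positive measure, averaging over shifts \<open>s\<close> in this set yields one for which
  the translate of \<open>h\<close> by \<open>s\<close> has all but a small fraction of its \<open>L\<^sup>2\<close> mass in \<open>\<Omega>\<close>. A shift only changes
  the phase of the Fourier transform, so the frame identity holds for the main part of \<open>h\<close>, and the defect
  \<open>\<integral>|h^|\<^sup>2 d\<mu> - A \<parallel>h\<parallel>\<^sup>2\<close>, a bounded quadratic form on \<open>L\<^sup>2(X)\<close>, is bounded by half of its own bound. Hence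
  it vanishes. The radius of the balls can be chosen uniformly for \<open>p\<close>, \<open>q\<close> in a compact set, and a quadratic
  form is determined by its values on pairs, so the identity extends to all \<open>h\<close> of bounded support. Testing it on
  an indicator function plus a translate of it determines the characteristic function of \<open>|g^|\<^sup>2 \<mu>\<close>, and therefore
  \<open>\<mu>\<close>. Conversely, if \<open>\<Omega> \<inter> (\<Omega> + x)\<close> is null, then a function on \<open>\<Omega>\<close> is orthogonal to its translate by \<open>x\<close>, and by Plancherel
  \<open>|1 + exp (- 2 \<pi> i \<langle>\<xi>, x\<rangle>)|\<^sup>2 d\<xi>\<close> is tight.
\<close>

section \<open>Translations of Lebesgue measure\<close>

text \<open>The shift depends on \<open>h\<close>, so no identity is simply carried over from one
  fixed set; the argument has to contract a bound that holds on all of \<open>L^2(X)\<close> at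
  once, and such a bound must exist beforehand. Local finiteness of \<open>\<mu>\<close> controls
  only bounded sets of frequencies. Hence \<open>\<mu>\<close> is first cut to a ball, where
  Cauchy-Schwarz gives some finite bound, and the shifting argument itself improves that bound to
  \<open>4 * A\<close>, whatever the ball. Only then is the defect a finite real number for every
  \<open>h\<close>, to be contracted in turn.

  Two balls are needed rather than one: a function on one small ball could be moved mostly into
  \<open>\<Omega>\<close> as soon as \<open>\<Omega>\<close> has positive measure. What one ball
  does not see is the interaction of distant pieces of \<open>h\<close>, and here the overlap for
  the shift \<open>q - p\<close> enters. Two are enough, as a square has no interactions of three
  pieces.

  The cross term of the defect between the good and the bad part of \<open>h\<close> is never
  estimated as a bilinear form; it is read off from values of the defect along the line through both
  parts. The fraction 1/128 leaves ample room for this.\<close>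

lemma nn_integral_lborel_translate:
  fixes f :: "'a::euclidean_space \<Rightarrow> ennreal"
  assumes [measurable]: "f \<in> borel_measurable borel"
  shows "(\<integral>\<^sup>+x. f (x + s) \<partial>lborel) = (\<integral>\<^sup>+x. f x \<partial>lborel)"
  by (subst (2) lborel_distr_plus[of s, symmetric]) (simp add: nn_integral_distr add.commute)

lemma integrable_lborel_translate:
  fixes f :: "'a::euclidean_space \<Rightarrow> 'b::{banach, second_countable_topology}"
  assumes "integrable lborel f"
  shows "integrable lborel (\<lambda>x. f (x + s))"
proof -
  have [measurable]: "f \<in> borel_measurable borel"
    using assms borel_measurable_integrable by force
  show ?thesis
    using assms unfolding integrable_iff_bounded
    by (auto simp: nn_integral_lborel_translate[where f="\<lambda>x. ennreal (norm (f x))"])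
qed

lemma integral_lborel_translate:
  fixes f :: "'a::euclidean_space \<Rightarrow> 'b::{banach, second_countable_topology}"
  assumes [measurable]: "f \<in> borel_measurable borel"
  shows "(\<integral>x. f (x + s) \<partial>lborel) = (\<integral>x. f x \<partial>lborel)"
  by (subst (2) lborel_distr_plus[of s, symmetric]) (simp add: integral_distr add.commute)

lemma emeasure_lborel_translate:
  fixes E :: "'a::euclidean_space set"
  assumes [measurable]: "E \<in> sets borel"
  shows "emeasure lborel {x. x + s \<in> E} = emeasure lborel E"
proof -
  have "{x. x + s \<in> E} \<in> sets lborel" by measurable
  then have "emeasure lborel {x. x + s \<in> E} = (\<integral>\<^sup>+x. indicator {x. x + s \<in> E} x \<partial>lborel)"
    by simp
  also have "\<dots> = (\<integral>\<^sup>+x. indicator E (x + s) \<partial>lborel)"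
    by (intro nn_integral_cong) (simp add: indicator_def)
  finally have "emeasure lborel {x. x + s \<in> E} = (\<integral>\<^sup>+x. indicator E (x + s) \<partial>lborel)" .
  then show ?thesis
    using nn_integral_lborel_translate[of "indicator E" s] by simp
qed


section \<open>Continuity of translation in the L^1 norm\<close>

lemma compact_approx_lborel:
  fixes A :: "'a::euclidean_space set"
  assumes A[measurable]: "A \<in> sets borel" and fin: "emeasure lborel A < \<infinity>" and "e > (0::real)"
  obtains K where "K \<subseteq> A" "compact K" "emeasure lborel (A - K) < e"
proof -
  \<comment> \<open>\<open>inner_regular\<close> speaks of measures of finite total mass, so
    Lebesgue measure is first cut down to \<open>A\<close>.\<close>
  define M where "M = density lborel (indicator A)"
  have M: "emeasure M B = emeasure lborel (A \<inter> B)" if [measurable]: "B \<in> sets borel" for B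
    unfolding M_def by (auto simp: emeasure_density indicator_inter_arith[symmetric] 
         intro!: nn_integral_cong)
  have SUP: "emeasure M A = (SUP K \<in> {K. K \<subseteq> A \<and> compact K}. emeasure M K)"
    by (rule inner_regular) (use M[of UNIV] fin in \<open>auto simp: M_def\<close>)
  show ?thesis
  \<comment> \<open>For a null set the strict inequality
    \<open>emeasure lborel A - ennreal e < emeasure lborel A\<close> fails, but the empty compact
    set works.\<close>
  proof (cases "emeasure lborel A = 0")
    case True
    then show ?thesis using that[of "{}"] \<open>e > 0\<close> by simp
  next
    case False
    then have "emeasure lborel A - ennreal e < emeasure lborel A"
      using fin \<open>e > 0\<close> by (intro ennreal_between) (auto simp: zero_less_iff_neq_zero)
    then have "emeasure lborel A - ennreal e < (SUP K \<in> {K. K \<subseteq> A \<and> compact K}. emeasure M K)"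
      using SUP M[OF A] by simp
    then obtain K where K: "K \<subseteq> A" "compact K" "emeasure lborel A - ennreal e < emeasure M K"
      unfolding less_SUP_iff by auto
    from K have [measurable]: "K \<in> sets borel" by (simp add: compact_imp_closed)
    have MK: "emeasure M K = emeasure lborel K" using M[of K] K by (simp add: Int_absorb1)
    have finK: "emeasure lborel K < \<infinity>" using emeasure_mono[OF K(1), of lborel] fin
      by (auto elim: le_less_trans)
    have "emeasure lborel (A - K) = emeasure lborel A - emeasure lborel K"
      by (rule emeasure_Diff) (use finK K in auto)
    also have "\<dots> < ennreal e"
    proof -
      obtain a k where ak: "emeasure lborel A = ennreal a" "emeasure lborel K = ennreal k" "0 \<le> a" "0 \<le> k"
        using fin finK by (metis ennreal_enn2real enn2real_nonneg infinity_ennreal_def)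
      have "ennreal (a - e) < ennreal k" using K(3) MK ak \<open>e > 0\<close> by (simp add: ennreal_minus)
      then have "a - e < k"
        using ennreal_leI[of k "a - e"] by (meson leD le_less_linear)
      then have "a - k < e" by simp
      then show ?thesis using ak \<open>e > 0\<close> by (simp add: ennreal_minus ennreal_lessI)
    qed
    finally show ?thesis using that K by blast
  qed
qed

text \<open>Induction over integrable functions. Sums and dominated limits are soft; the content is
  the indicator of a set \<open>A\<close>, compared with a compact \<open>K\<close> inside
  \<open>A\<close> and an open \<open>U\<close> around \<open>K\<close> (not around
  \<open>A\<close>) such that \<open>A - K\<close> and \<open>U - K\<close> are small. Short shifts
  keep \<open>K\<close> inside \<open>U\<close>.\<close>

lemma L1_translation_continuous:
  fixes f :: "'a::euclidean_space \<Rightarrow> 'b::{banach, second_countable_topology}"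
  assumes "integrable lborel f"
  shows "((\<lambda>s. \<integral>x. norm (f (x + s) - f x) \<partial>lborel) \<longlongrightarrow> 0) (at 0)"
  using assms
proof (induction f rule: integrable_induct)
  case (base A c)
  then have A[measurable]: "A \<in> sets borel" and fin: "emeasure lborel A < \<infinity>" by auto
  have bnd: "\<exists>d>0. \<forall>s. norm s < d \<longrightarrow> (\<integral>x. norm (indicator A (x + s) *\<^sub>R c - indicator A x *\<^sub>R c) \<partial>lborel) \<le> 4 * e * norm c"
    if "e > 0" for e :: real
  proof -
    obtain K where K: "K \<subseteq> A" "compact K" "emeasure lborel (A - K) < e"
      using compact_approx_lborel[OF A fin \<open>e > 0\<close>] by blast
    have Km[measurable]: "K \<in> sets borel" using K by (simp add: compact_imp_closed)
    obtain U where U: "open U" "K \<subseteq> U" "emeasure lborel (U - K) < e"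
      using outer_regular_lborel[OF Km \<open>e > 0\<close>] by blast
    have Um[measurable]: "U \<in> sets borel" using U by simp
    obtain d where d: "d > 0" "(\<Union>x\<in>K. ball x d) \<subseteq> U"
      using compact_subset_open_imp_ball_epsilon_subset[OF K(2) U(1,2)] by auto
    \<comment> \<open>Majorant for the change of the indicator: a point can enter or leave
      \<open>A\<close> under a short shift only if it or its shift lies in \<open>A - K\<close> or
      \<open>U - K\<close>.\<close>
    define w where "w x = indicator (A - K) x + (indicator (U - K) x :: real)" for x :: 'a
    have w0: "w x \<ge> 0" for x by (simp add: w_def)
    have fin': "emeasure lborel (A - K) < \<infinity>" "emeasure lborel (U - K) < \<infinity>"
      using K(3) U(3) by (auto elim: order.strict_trans)
    have iw: "integrable lborel w" unfolding w_def
      using fin' by (intro Bochner_Integration.integrable_add integrable_real_indicator) auto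
    then have [measurable]: "w \<in> borel_measurable borel"
      using borel_measurable_integrable by force
    have "(\<integral>x. w x \<partial>lborel) = measure lborel (A - K) + measure lborel (U - K)"
      unfolding w_def using fin' by (subst Bochner_Integration.integral_add) auto
    also have "\<dots> \<le> e + e"
      using K(3) U(3) that by (intro add_mono) (auto simp: measure_def intro!: enn2real_leI)
    finally have intw: "(\<integral>x. w x \<partial>lborel) \<le> 2 * e" by simp
    have "(\<integral>x. norm (indicator A (x + s) *\<^sub>R c - indicator A x *\<^sub>R c) \<partial>lborel) \<le> 4 * e * norm c"
      if s: "norm s < d" for s
    proof -
      have 1: "x \<in> U" if "x + s \<in> K" for x
        using d(2) that s by (force simp: dist_norm subset_iff)
      have 2: "x + s \<in> U" if "x \<in> K" for x
      proof -
        have "x + s \<in> ball x d" using s by (simp add: dist_norm)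
        then show ?thesis using d(2) that by blast
      qed
      have pw: "norm (indicator A (x + s) *\<^sub>R c - indicator A x *\<^sub>R c) \<le> (w (x + s) + w x) * norm c" for x
      proof (cases "x \<in> A \<longleftrightarrow> x + s \<in> A")
        case True
        then show ?thesis by (auto simp: w_def indicator_def)
      next
        case False
        \<comment> \<open>If the end of the shift that lies in \<open>A\<close> even lies in
          \<open>K\<close>, the other end lies in \<open>U\<close> but not in \<open>A\<close>,
          hence in \<open>U - K\<close>.\<close>
        then have "x \<in> A - K \<or> x \<in> U - K \<or> x + s \<in> A - K \<or> x + s \<in> U - K"
          using 1[of x] 2[of x] K(1) by blast
        then have "1 \<le> w (x + s) + w x"
          by (auto simp: w_def indicator_def)
        then have "1 * norm c \<le> (w (x + s) + w x) * norm c"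
          by (rule mult_right_mono) simp
        then show ?thesis using False by (auto simp: indicator_def)
      qed
      have "(\<integral>x. norm (indicator A (x + s) *\<^sub>R c - indicator A x *\<^sub>R c) \<partial>lborel)
          \<le> (\<integral>x. (w (x + s) + w x) * norm c \<partial>lborel)"
        by (rule integral_mono') (use pw iw integrable_lborel_translate[OF iw] w0 in auto)
      also have "\<dots> = 2 * (\<integral>x. w x \<partial>lborel) * norm c"
        using iw integrable_lborel_translate[OF iw, of s] integral_lborel_translate[of w s] by simp
      also have "\<dots> \<le> 4 * e * norm c" using intw by (intro mult_right_mono) auto
      finally show ?thesis .
    qed
    with d(1) show ?thesis by auto
  qed
  show ?case
  proof (rule LIM_I)
    fix r :: real assume "r > 0"
    \<comment> \<open>Chosen to push \<open>4 * e * norm c\<close> below \<open>r\<close>; the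
      summand 1 covers \<open>c = 0\<close>.\<close>
    define e where "e = r / (8 * (1 + norm c))"
    have e: "e > 0" using \<open>r > 0\<close> by (simp add: e_def add_pos_nonneg)
    have p: "0 < 1 + norm c" by (simp add: add_pos_nonneg)
    have "4 * e * norm c = r * (norm c / (2 * (1 + norm c)))"
      using p by (simp add: e_def field_simps)
    also have "\<dots> < r * 1"
    proof (rule mult_strict_left_mono)
      have "norm c < 2 * (1 + norm c)" using p by (simp add: distrib_left)
      then show "norm c / (2 * (1 + norm c)) < 1" using p by (subst divide_less_eq_1_pos) auto
    qed fact
    finally have lt: "4 * e * norm c < r" by simp
    obtain d where d: "d > 0" "\<And>s. norm s < d \<Longrightarrow>
        (\<integral>x. norm (indicat_real A (x + s) *\<^sub>R c - indicator A x *\<^sub>R c) \<partial>lborel) \<le> 4 * e * norm c"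
      using bnd[OF e] by blast
    show "\<exists>s>0. \<forall>x. x \<noteq> 0 \<and> norm (x - 0) < s \<longrightarrow>
       norm ((\<integral>y. norm (indicat_real A (y + x) *\<^sub>R c - indicat_real A y *\<^sub>R c) \<partial>lborel) - 0) < r"
    proof (intro exI[of _ d] conjI allI impI)
      fix x :: 'a assume "x \<noteq> 0 \<and> norm (x - 0) < d"
      then have "(\<integral>y. norm (indicat_real A (y + x) *\<^sub>R c - indicat_real A y *\<^sub>R c) \<partial>lborel) < r"
        using d(2)[of x] lt by simp
      then show "norm ((\<integral>y. norm (indicat_real A (y + x) *\<^sub>R c - indicat_real A y *\<^sub>R c) \<partial>lborel) - 0) < r"
        by simp
    qed fact
  qed
next
  case (add f g)
  have [measurable]: "f \<in> borel_measurable borel" "g \<in> borel_measurable borel"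
    using add.hyps[THEN borel_measurable_integrable] by simp_all
  note [intro] = add.hyps integrable_lborel_translate[OF add.hyps(1)] integrable_lborel_translate[OF add.hyps(2)]
  have "((\<lambda>s. (\<integral>x. norm (f (x + s) - f x) \<partial>lborel) + (\<integral>x. norm (g (x + s) - g x) \<partial>lborel)) \<longlongrightarrow> 0) (at 0)"
    using tendsto_add[OF add.IH] by simp
  then show ?case
  proof (rule Lim_null_comparison[rotated], intro always_eventually allI)
    fix s
    have "(\<integral>x. norm (f (x + s) + g (x + s) - (f x + g x)) \<partial>lborel)
       \<le> (\<integral>x. norm (f (x + s) - f x) + norm (g (x + s) - g x) \<partial>lborel)"
      by (intro integral_mono') (auto intro!: norm_diff_triangle_ineq Bochner_Integration.integrable_add integrable_norm Bochner_Integration.integrable_diff)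
    also have "\<dots> = (\<integral>x. norm (f (x + s) - f x) \<partial>lborel) + (\<integral>x. norm (g (x + s) - g x) \<partial>lborel)"
      by (intro Bochner_Integration.integral_add integrable_norm Bochner_Integration.integrable_diff; blast)
    finally show "norm (\<integral>x. norm (f (x + s) + g (x + s) - (f x + g x)) \<partial>lborel)
       \<le> (\<integral>x. norm (f (x + s) - f x) \<partial>lborel) + (\<integral>x. norm (g (x + s) - g x) \<partial>lborel)"
      by simp
  qed
next
  case (lim f s)
  have [measurable]: "f \<in> borel_measurable borel" "\<And>i. s i \<in> borel_measurable borel"
    using lim.hyps(1,4)[THEN borel_measurable_integrable] by simp_all
  have "(\<lambda>i. \<integral>x. norm (s i x - f x) \<partial>lborel) \<longlonglongrightarrow> (\<integral>x. 0 \<partial>(lborel :: 'a measure))"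
  proof (rule integral_dominated_convergence[where w="\<lambda>x. 3 * norm (f x)"])
    show "AE x in lborel. (\<lambda>i. norm (s i x - f x)) \<longlonglongrightarrow> 0"
      using lim.hyps(2) by (auto intro!: always_eventually tendsto_norm_zero simp: LIM_zero_iff)
    show "AE x in lborel. norm (norm (s i x - f x)) \<le> 3 * norm (f x)" for i
      using lim.hyps(3)[of _ i] by (auto intro!: always_eventually order_trans[OF norm_triangle_ineq4])
  qed (use lim.hyps in auto)
  then have conv: "(\<lambda>i. \<integral>x. norm (s i x - f x) \<partial>lborel) \<longlonglongrightarrow> 0" by simp
  show ?case
  proof (rule LIM_I)
    fix r :: real assume "r > 0"
    \<comment> \<open>Budget r/4 + r/2 + r/4: the error of the approximation \<open>s i\<close>
      enters twice, the second time shifted, which does not change its integral.\<close>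
    then obtain i where i: "(\<integral>x. norm (s i x - f x) \<partial>lborel) < r / 4"
      using order_tendstoD(2)[OF conv, of "r / 4"] by (auto simp: eventually_sequentially)
    obtain d where d: "d > 0" "\<And>x. x \<noteq> 0 \<Longrightarrow> norm x < d \<Longrightarrow> (\<integral>y. norm (s i (y + x) - s i y) \<partial>lborel) < r / 2"
      using LIM_D[OF lim.IH[of i], of "r / 2"] \<open>r > 0\<close> by auto
    have "(\<integral>y. norm (f (y + x) - f y) \<partial>lborel) < r" if x: "x \<noteq> 0" "norm x < d" for x
    proof -
      note [intro] = lim.hyps(1)[of i] lim.hyps(4) integrable_lborel_translate[OF lim.hyps(1)] integrable_lborel_translate[OF lim.hyps(4)]
      have I: "integrable lborel (\<lambda>y. norm (s i y - f y))"
        and I1: "integrable lborel (\<lambda>y. norm (s i (y + x) - f (y + x)))"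
        and I2: "integrable lborel (\<lambda>y. norm (s i (y + x) - s i y))"
        by (intro integrable_norm Bochner_Integration.integrable_diff; blast)+
      have "(\<integral>y. norm (f (y + x) - f y) \<partial>lborel) \<le>
        (\<integral>y. norm (s i (y + x) - f (y + x)) + norm (s i (y + x) - s i y) + norm (s i y - f y) \<partial>lborel)"
      proof (rule integral_mono')
        fix y
        have "f (y + x) - f y = - (s i (y + x) - f (y + x)) + (s i (y + x) - s i y) + (s i y - f y)" by simp
        then show "norm (f (y + x) - f y) \<le> norm (s i (y + x) - f (y + x)) + norm (s i (y + x) - s i y) + norm (s i y - f y)"
          by (metis norm_minus_cancel norm_triangle_le norm_triangle_mono order_refl)
      qed (simp_all add: I I1 I2)
      also have "\<dots> = (\<integral>y. norm (s i (y + x) - f (y + x)) \<partial>lborel) + (\<integral>y. norm (s i (y + x) - s i y) \<partial>lborel)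
          + (\<integral>y. norm (s i y - f y) \<partial>lborel)"
        by (simp add: I I1 I2)
      also have "(\<integral>y. norm (s i (y + x) - f (y + x)) \<partial>lborel) = (\<integral>y. norm (s i y - f y) \<partial>lborel)"
        by (rule integral_lborel_translate[where f="\<lambda>y. norm (s i y - f y)"]) simp
      finally show ?thesis using i d(2)[OF x] by simp
    qed
    then show "\<exists>d>0. \<forall>x. x \<noteq> 0 \<and> norm (x - 0) < d \<longrightarrow>
       norm ((\<integral>y. norm (f (y + x) - f y) \<partial>lborel) - 0) < r"
      using d(1) by auto
  qed
qed

section \<open>The Gaussian and its Fourier transform\<close>

text \<open>Normalised with \<open>pi\<close> so that the total mass is 1 and the function is its
  own Fourier transform for the kernel with \<open>2 * pi\<close>.\<close>

definition gauss :: "'a::euclidean_space \<Rightarrow> real" where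
  "gauss x = exp (- pi * (norm x)\<^sup>2)"

lemma gauss_pos [simp]: "gauss x > 0" and gauss_nonneg [simp]: "gauss x \<ge> 0"
  and gauss_0 [simp]: "gauss 0 = 1" and gauss_le_1 [simp]: "gauss x \<le> 1"
  and gauss_minus [simp]: "gauss (- x) = gauss x"
  by (auto simp: gauss_def)

lemma continuous_on_gauss: "continuous_on A gauss"
  unfolding gauss_def by (intro continuous_intros)

lemma borel_measurable_gauss [measurable]: "gauss \<in> borel_measurable borel"
  by (intro borel_measurable_continuous_onI continuous_on_gauss)

lemma cis_measurable [measurable]: "cis \<in> borel_measurable borel"
  by (intro borel_measurable_continuous_onI continuous_intros)

lemma cnj_measurable [measurable]: "cnj \<in> borel_measurable borel"
  by (intro borel_measurable_continuous_onI continuous_intros)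

text \<open>The characteristic function of the standard normal distribution after the substitution
  \<open>y = sqrt (2 * pi) * x\<close>.\<close>

lemma gauss_transform_real:
  fixes t :: real
  shows "integrable lborel (\<lambda>x. complex_of_real (exp (- pi * x\<^sup>2)) * cis (2 * pi * (t * x)))"
    and "(\<integral>x. complex_of_real (exp (- pi * x\<^sup>2)) * cis (2 * pi * (t * x)) \<partial>lborel) = exp (- pi * t\<^sup>2)"
proof -
  define s where "s = sqrt (2 * pi)"
  have s: "s > 0" "s\<^sup>2 = 2 * pi" by (simp_all add: s_def)
  define F where "F y = std_normal_density y *\<^sub>R iexp (s * t * y)" for y
  interpret prob_space std_normal_distribution
    by (rule real_dist_normal_dist[THEN real_distribution.axioms(1)])
  have F: "integrable lborel F"
    unfolding F_def
    by (rule Bochner_Integration.integrable_bound[of _ std_normal_density]) (auto simp: integrable_normal_density)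
  have eq: "complex_of_real (exp (- pi * x\<^sup>2)) * cis (2 * pi * (t * x)) = s *\<^sub>R F (0 + s * x)" for x
  proof -
    have "std_normal_density (s * x) = exp (- pi * x\<^sup>2) / s"
      using s by (simp add: std_normal_density_def power_mult_distrib s_def)
    moreover have "iexp (s * t * (s * x)) = cis (2 * pi * (t * x))"
    proof -
      have "s * t * (s * x) = s\<^sup>2 * (t * x)" by (simp add: power2_eq_square mult_ac)
      then show ?thesis by (simp only: cis_conv_exp s(2))
    qed
    ultimately show ?thesis using s by (simp add: F_def scaleR_conv_of_real)
  qed
  show "integrable lborel (\<lambda>x. complex_of_real (exp (- pi * x\<^sup>2)) * cis (2 * pi * (t * x)))"
    unfolding eq using lborel_integrable_real_affine[OF F, of s 0] s by (intro integrable_scaleR_right) auto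
  have "(\<integral>x. complex_of_real (exp (- pi * x\<^sup>2)) * cis (2 * pi * (t * x)) \<partial>lborel) = (\<integral>x. F x \<partial>lborel)"
    unfolding eq using s lborel_integral_real_affine[of s F 0] by simp
  also have "\<dots> = char std_normal_distribution (s * t)"
    unfolding char_def F_def by (subst integral_density) auto
  also have "\<dots> = exp (- pi * t\<^sup>2)"
    using s by (simp add: char_std_normal_distribution power_mult_distrib)
  finally show "(\<integral>x. complex_of_real (exp (- pi * x\<^sup>2)) * cis (2 * pi * (t * x)) \<partial>lborel) = exp (- pi * t\<^sup>2)" .
qed

lemma cis_sum: "finite I \<Longrightarrow> cis (\<Sum>i\<in>I. f i) = (\<Prod>i\<in>I. cis (f i))"
  by (induction I rule: finite_induct) (auto simp: cis_mult[symmetric])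

text \<open>Gaussian and phase both split into factors over the coordinates, and
  \<open>lborel\<close> is the image of a product measure, so the one-dimensional case is multiplied
  up.\<close>

lemma gauss_transform:
  fixes t :: "'a::euclidean_space"
  shows "integrable lborel (\<lambda>x. gauss x * cis (2 * pi * (t \<bullet> x)))"
    and "(\<integral>x. gauss x * cis (2 * pi * (t \<bullet> x)) \<partial>lborel) = gauss t"
proof -
  interpret product_sigma_finite "\<lambda>_::'a. lborel :: real measure" ..
  define F :: "'a \<Rightarrow> complex" where "F x = gauss x * cis (2 * pi * (t \<bullet> x))" for x
  define h where "h b x = complex_of_real (exp (- pi * x\<^sup>2)) * cis (2 * pi * ((t \<bullet> b) * x))" for b :: 'a and x
  have [measurable]: "F \<in> borel_measurable borel" unfolding F_def by measurable
  have hi: "integrable lborel (h b)" and hint: "(\<integral>x. h b x \<partial>lborel) = exp (- pi * (t \<bullet> b)\<^sup>2)" for b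
    unfolding h_def by (rule gauss_transform_real)+
  have nrm: "(norm x)\<^sup>2 = (\<Sum>b\<in>Basis. (x \<bullet> b)\<^sup>2)" for x :: 'a
    by (subst power2_norm_eq_inner, subst euclidean_inner) (simp add: power2_eq_square)
  have Fprod: "F (\<Sum>b\<in>Basis. f b *\<^sub>R b) = (\<Prod>b\<in>Basis. h b (f b))" for f
  proof -
    have "t \<bullet> (\<Sum>b\<in>Basis. f b *\<^sub>R b) = (\<Sum>b\<in>Basis. (t \<bullet> b) * f b)"
      by (simp add: inner_sum_right mult.commute)
    moreover have "gauss (\<Sum>b\<in>Basis. f b *\<^sub>R b) = (\<Prod>b\<in>Basis. exp (- pi * (f b)\<^sup>2))"
      by (simp add: gauss_def nrm sum_distrib_left sum_negf[symmetric] exp_sum)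
    ultimately show ?thesis
      by (simp add: F_def h_def prod.distrib sum_distrib_left cis_sum)
  qed
  have gt: "complex_of_real (gauss t) = (\<Prod>b\<in>Basis. complex_of_real (exp (- pi * (t \<bullet> b)\<^sup>2)))"
    by (simp add: gauss_def nrm sum_distrib_left sum_negf[symmetric] exp_sum)
  have m: "(\<lambda>f. \<Sum>b\<in>Basis. f b *\<^sub>R b) \<in> borel_measurable (\<Pi>\<^sub>M b\<in>(Basis::'a set). lborel)"
    by measurable
  have "integrable (\<Pi>\<^sub>M b\<in>(Basis::'a set). lborel) (\<lambda>f. F (\<Sum>b\<in>Basis. f b *\<^sub>R b))"
    unfolding Fprod by (intro product_integrable_prod hi) auto
  then have "integrable lborel F"
    unfolding lborel_eq[where 'a='a] by (subst integrable_distr_eq[OF m]) auto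
  then show "integrable lborel (\<lambda>x. gauss x * cis (2 * pi * (t \<bullet> x)))"
    unfolding F_def .
  have "(\<integral>x. F x \<partial>lborel) = (\<integral>f. F (\<Sum>b\<in>Basis. f b *\<^sub>R b) \<partial>(\<Pi>\<^sub>M b\<in>(Basis::'a set). lborel))"
    unfolding lborel_eq[where 'a='a] by (rule integral_distr[OF m]) measurable
  also have "\<dots> = (\<Prod>b\<in>Basis. \<integral>x. h b x \<partial>lborel)"
    unfolding Fprod by (intro product_integral_prod hi) auto
  also have "\<dots> = gauss t"
    by (simp only: hint gt)
  finally show "(\<integral>x. gauss x * cis (2 * pi * (t \<bullet> x)) \<partial>lborel) = gauss t"
    unfolding F_def .
qed

lemma
  shows integrable_gauss: "integrable lborel (gauss :: 'a::euclidean_space \<Rightarrow> real)"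
    and integral_gauss: "(\<integral>x. gauss (x::'a) \<partial>lborel) = 1"
  using gauss_transform[of "0::'a"] by (auto simp: complex_of_real_integrable_eq)

lemma integral_lborel_scale:
  fixes f :: "'a::euclidean_space \<Rightarrow> 'b::{banach, second_countable_topology}"
  assumes [measurable]: "f \<in> borel_measurable borel" and "c > 0"
  shows "(\<integral>x. f x \<partial>lborel) = c ^ DIM('a) *\<^sub>R (\<integral>x. f (a + c *\<^sub>R x) \<partial>lborel)"
  using \<open>c > 0\<close> by (subst lborel_affine[of c a]) (auto simp: integral_density integral_distr)

lemma integral_lborel_uminus:
  fixes f :: "'a::euclidean_space \<Rightarrow> 'b::{banach, second_countable_topology}"
  assumes [measurable]: "f \<in> borel_measurable borel"
  shows "(\<integral>x. f (- x) \<partial>lborel) = (\<integral>x. f x \<partial>lborel)"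
  by (subst (2) lborel_affine[of "-1" 0]) (auto simp: density_1 integral_distr)

lemma integrable_lborel_scale:
  fixes f :: "'a::euclidean_space \<Rightarrow> 'b::{banach, second_countable_topology}"
  assumes f: "integrable lborel f" and "c > 0"
  shows "integrable lborel (\<lambda>x. f (a + c *\<^sub>R x))"
proof -
  have [measurable]: "f \<in> borel_measurable borel"
    using assms borel_measurable_integrable by force
  have "integrable lborel f \<longleftrightarrow> integrable lborel (\<lambda>x. c ^ DIM('a) *\<^sub>R f (a + c *\<^sub>R x))"
    using \<open>c > 0\<close> by (subst lborel_affine[of c a])
      (auto simp: integrable_density integrable_distr_eq)
  then show ?thesis
    using f \<open>c > 0\<close> integrable_scaleR_right[of "inverse (c ^ DIM('a))" lborel "\<lambda>x. c ^ DIM('a) *\<^sub>R f (a + c *\<^sub>R x)"]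
    by simp
qed

section \<open>Uniqueness of characteristic functions\<close>

text \<open>Fubini for Bochner integrals asks for joint integrability. Every exchange of such
  integrals below has an integrand dominated by a product of two integrable functions, one in each
  variable.\<close>

lemma (in pair_sigma_finite) integrable_product_bound:
  fixes f :: "'a \<Rightarrow> 'b \<Rightarrow> 'c::{banach, second_countable_topology}"
  assumes [measurable]: "case_prod f \<in> borel_measurable (M1 \<Otimes>\<^sub>M M2)"
    and u: "integrable M1 u" and v: "integrable M2 v"
    and bnd: "\<And>x y. norm (f x y) \<le> u x * (v y :: real)"
  shows "integrable (M1 \<Otimes>\<^sub>M M2) (case_prod f)"
proof (rule Fubini_integrable)
  show "case_prod f \<in> borel_measurable (M1 \<Otimes>\<^sub>M M2)" by fact
  have [measurable]: "f x \<in> borel_measurable M2" if "x \<in> space M1" for x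
    using measurable_compose[OF measurable_Pair1'[OF that] assms(1)] by simp
  have vi: "integrable M2 (\<lambda>y. u x * v y)" for x using v by simp
  have int: "integrable M2 (f x)" if "x \<in> space M1" for x
    by (rule Bochner_Integration.integrable_bound[OF vi[of x]])
       (use that bnd in \<open>auto intro!: order_trans[OF bnd] always_eventually\<close>)
  show "AE x in M1. integrable M2 (\<lambda>y. case (x, y) of (x, y) \<Rightarrow> f x y)"
    using int by auto
  have le: "norm (\<integral>y. norm (f x y) \<partial>M2) \<le> norm (u x * (\<integral>y. v y \<partial>M2))" if "x \<in> space M1" for x
  proof -
    have "(\<integral>y. norm (f x y) \<partial>M2) \<le> (\<integral>y. u x * v y \<partial>M2)"
      by (intro integral_mono integrable_norm int that vi bnd)
    then show ?thesis by simp
  qed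
  show "integrable M1 (\<lambda>x. \<integral>y. norm (case (x, y) of (x, y) \<Rightarrow> f x y) \<partial>M2)"
  proof (rule Bochner_Integration.integrable_bound)
    show "integrable M1 (\<lambda>x. u x * (\<integral>y. v y \<partial>M2))" using u by simp
    show "AE x in M1. norm (\<integral>y. norm (case (x, y) of (x, y) \<Rightarrow> f x y) \<partial>M2)
        \<le> norm (u x * (\<integral>y. v y \<partial>M2))"
      using le by (intro AE_I2) simp
  qed simp
qed

text \<open>The Gaussian is written as its own transform and the integrals are exchanged. The
  right-hand side sees \<open>M\<close> only through its characteristic function, which therefore
  determines the Gaussian averages of \<open>M\<close> at all centres and scales.\<close>

lemma gauss_smoothing_char:
  fixes M :: "'a::euclidean_space measure"
  assumes M[measurable_cong]: "sets M = sets borel" and fin: "finite_measure M"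
  shows "complex_of_real (\<integral>x. gauss (c *\<^sub>R (x - a)) \<partial>M) =
    (\<integral>z. gauss z * cis (- (2 * pi * c * (a \<bullet> z))) * (\<integral>x. cis (2 * pi * ((c *\<^sub>R z) \<bullet> x)) \<partial>M) \<partial>lborel)"
proof -
  interpret finite_measure M by fact
  interpret P: pair_sigma_finite M "lborel :: 'a measure" ..
  let ?f = "\<lambda>x z :: 'a. complex_of_real (gauss z) * cis (2 * pi * ((c *\<^sub>R (x - a)) \<bullet> z))"
  have int: "integrable (M \<Otimes>\<^sub>M lborel) (case_prod ?f)"
    by (rule P.integrable_product_bound[where u="\<lambda>_. 1" and v=gauss])
       (auto simp: norm_mult integrable_gauss)
  have "complex_of_real (\<integral>x. gauss (c *\<^sub>R (x - a)) \<partial>M) = (\<integral>x. complex_of_real (gauss (c *\<^sub>R (x - a))) \<partial>M)"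
    by simp
  also have "\<dots> = (\<integral>x. (\<integral>z. ?f x z \<partial>lborel) \<partial>M)"
    by (simp only: gauss_transform)
  also have "\<dots> = (\<integral>z. (\<integral>x. ?f x z \<partial>M) \<partial>lborel)"
    by (rule P.Fubini_integral[OF int, symmetric])
  also have "\<dots> = (\<integral>z. gauss z * cis (- (2 * pi * c * (a \<bullet> z))) * (\<integral>x. cis (2 * pi * ((c *\<^sub>R z) \<bullet> x)) \<partial>M) \<partial>lborel)"
  proof (rule Bochner_Integration.integral_cong[OF refl])
    fix z :: 'a
    have "?f x z = gauss z * cis (- (2 * pi * c * (a \<bullet> z))) * cis (2 * pi * ((c *\<^sub>R z) \<bullet> x))" for x
      by (simp add: cis_mult algebra_simps inner_diff_left inner_commute[of x z])
    then show "(\<integral>x. ?f x z \<partial>M) = gauss z * cis (- (2 * pi * c * (a \<bullet> z))) * (\<integral>x. cis (2 * pi * ((c *\<^sub>R z) \<bullet> x)) \<partial>M)"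
      by (simp only: integral_mult_right_zero)
  qed
  finally show ?thesis .
qed

text \<open>Gaussians of width \<open>1 / Suc n\<close> form an approximate identity: integrating
  over \<open>a\<close> first and substituting \<open>a = x + z / Suc n\<close> leaves the average
  of \<open>\<phi>\<close> around \<open>x\<close>, which tends to \<open>\<phi> x\<close>. The
  power in front cancels the Jacobian; integrability of \<open>\<phi>\<close> pays for the
  exchange.\<close>

lemma gauss_mollify_tendsto:
  fixes M :: "'a::euclidean_space measure" and \<phi> :: "'a \<Rightarrow> real"
  assumes M[measurable_cong]: "sets M = sets borel" and fin: "finite_measure M"
    and cont: "continuous_on UNIV \<phi>" and bnd: "\<And>x. \<bar>\<phi> x\<bar> \<le> B" and int: "integrable lborel \<phi>"
  shows "(\<lambda>n. (real (Suc n)) ^ DIM('a) * (\<integral>a. \<phi> a * (\<integral>x. gauss (real (Suc n) *\<^sub>R (x - a)) \<partial>M) \<partial>lborel))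
    \<longlonglongrightarrow> (\<integral>x. \<phi> x \<partial>M)"
proof -
  interpret finite_measure M by fact
  interpret P: pair_sigma_finite M "lborel :: 'a measure" ..
  have [measurable]: "\<phi> \<in> borel_measurable borel"
    using cont by (rule borel_measurable_continuous_onI)
  have B: "B \<ge> 0" using bnd[of 0] by linarith
  have eq: "(real (Suc n)) ^ DIM('a) * (\<integral>a. \<phi> a * (\<integral>x. gauss (real (Suc n) *\<^sub>R (x - a)) \<partial>M) \<partial>lborel)
     = (\<integral>x. (\<integral>z. \<phi> (x + (1 / real (Suc n)) *\<^sub>R z) * gauss z \<partial>lborel) \<partial>M)" for n
  proof -
    let ?c = "real (Suc n)"
    have "(\<integral>a. \<phi> a * (\<integral>x. gauss (?c *\<^sub>R (x - a)) \<partial>M) \<partial>lborel)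
      = (\<integral>a. (\<integral>x. \<phi> a * gauss (?c *\<^sub>R (x - a)) \<partial>M) \<partial>lborel)" by simp
    also have "\<dots> = (\<integral>x. (\<integral>a. \<phi> a * gauss (?c *\<^sub>R (x - a)) \<partial>lborel) \<partial>M)"
    proof (rule P.Fubini_integral, rule P.integrable_product_bound[where u="\<lambda>_. 1" and v="\<lambda>a. \<bar>\<phi> a\<bar>"])
      show "norm (\<phi> a * gauss (?c *\<^sub>R (x - a))) \<le> 1 * \<bar>\<phi> a\<bar>" for x a
        by (simp add: abs_mult mult_left_le)
    qed (use int in auto)
    also have "\<dots> = (\<integral>x. (1 / ?c) ^ DIM('a) * (\<integral>z. \<phi> (x + (1 / ?c) *\<^sub>R z) * gauss z \<partial>lborel) \<partial>M)"
    proof (rule Bochner_Integration.integral_cong[OF refl])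
      fix x
      have "(\<integral>a. \<phi> a * gauss (?c *\<^sub>R (x - a)) \<partial>lborel) =
        (1 / ?c) ^ DIM('a) *\<^sub>R (\<integral>z. \<phi> (x + (1 / ?c) *\<^sub>R z) * gauss (?c *\<^sub>R (x - (x + (1 / ?c) *\<^sub>R z))) \<partial>lborel)"
        by (rule integral_lborel_scale) auto
      also have "\<dots> = (1 / ?c) ^ DIM('a) * (\<integral>z. \<phi> (x + (1 / ?c) *\<^sub>R z) * gauss z \<partial>lborel)"
      proof -
        have "?c *\<^sub>R (x - (x + (1 / ?c) *\<^sub>R z)) = - z" for z
          by (simp del: of_nat_Suc)
        then show ?thesis by (simp only: gauss_minus real_scaleR_def)
      qed
      finally show "(\<integral>a. \<phi> a * gauss (?c *\<^sub>R (x - a)) \<partial>lborel) =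
         (1 / ?c) ^ DIM('a) * (\<integral>z. \<phi> (x + (1 / ?c) *\<^sub>R z) * gauss z \<partial>lborel)" .
    qed
    also have "\<dots> = (1 / ?c) ^ DIM('a) * (\<integral>x. (\<integral>z. \<phi> (x + (1 / ?c) *\<^sub>R z) * gauss z \<partial>lborel) \<partial>M)"
      by simp
    finally show ?thesis by (simp add: power_divide)
  qed
  have shift: "(\<lambda>n. x + (1 / real (Suc n)) *\<^sub>R z) \<longlonglongrightarrow> x" for x z :: 'a
  proof -
    have "(\<lambda>n. x + (1 / real (Suc n)) *\<^sub>R z) \<longlonglongrightarrow> x + 0 *\<^sub>R z"
      by (intro tendsto_intros LIMSEQ_Suc[OF lim_1_over_n])
    then show ?thesis by simp
  qed
  have pbnd: "norm (\<phi> y * gauss z) \<le> B * gauss z" for y z :: 'a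
    using bnd[of y] by (simp add: abs_mult mult_right_mono)
  have pbnd': "norm (\<phi> y * gauss z) \<le> norm (B * gauss z)" for y z :: 'a
    by (rule order_trans[OF pbnd]) simp
  have ig: "integrable lborel (\<lambda>z::'a. B * gauss z)"
    using integrable_gauss[where 'a='a] by simp
  have inner: "(\<lambda>n. \<integral>z. \<phi> (x + (1 / real (Suc n)) *\<^sub>R z) * gauss z \<partial>lborel) \<longlonglongrightarrow> \<phi> x" for x
  proof -
    have "(\<lambda>n. \<integral>z. \<phi> (x + (1 / real (Suc n)) *\<^sub>R z) * gauss z \<partial>lborel) \<longlonglongrightarrow> (\<integral>z. \<phi> x * gauss z \<partial>(lborel :: 'a measure))"
    proof (rule integral_dominated_convergence[where w="\<lambda>z. B * gauss z"])
      show "AE z in lborel. (\<lambda>n. \<phi> (x + (1 / real (Suc n)) *\<^sub>R z) * gauss z) \<longlonglongrightarrow> \<phi> x * gauss z"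
        by (intro AE_I2 tendsto_mult tendsto_const continuous_on_tendsto_compose[OF cont shift]) auto
    qed (use ig pbnd in auto)
    then show ?thesis by (simp add: integral_gauss)
  qed
  have "(\<lambda>n. \<integral>x. (\<integral>z. \<phi> (x + (1 / real (Suc n)) *\<^sub>R z) * gauss z \<partial>lborel) \<partial>M) \<longlonglongrightarrow> (\<integral>x. \<phi> x \<partial>M)"
  proof (rule integral_dominated_convergence[where w="\<lambda>_. B"])
    show "AE x in M. (\<lambda>n. \<integral>z. \<phi> (x + (1 / real (Suc n)) *\<^sub>R z) * gauss z \<partial>lborel) \<longlonglongrightarrow> \<phi> x"
      using inner by simp
    show "AE x in M. norm (\<integral>z. \<phi> (x + (1 / real (Suc n)) *\<^sub>R z) * gauss z \<partial>lborel) \<le> B" for n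
    proof (rule AE_I2)
      fix x
      have "norm (\<integral>z. \<phi> (x + (1 / real (Suc n)) *\<^sub>R z) * gauss z \<partial>lborel) \<le> (\<integral>z. B * gauss z \<partial>(lborel :: 'a measure))"
        by (rule Bochner_Integration.integral_norm_bound_integral
              [OF Bochner_Integration.integrable_bound[OF ig _ AE_I2[OF pbnd']] ig pbnd]) measurable
      then show "norm (\<integral>z. \<phi> (x + (1 / real (Suc n)) *\<^sub>R z) * gauss z \<partial>lborel) \<le> B"
        by (simp add: integral_gauss)
    qed
  qed auto
  then show ?thesis by (simp only: eq)
qed

text \<open>Equal characteristic functions give equal Gaussian averages, hence equal integrals of
  bounded continuous integrable functions, hence equal measures of boxes, an intersection-stable
  generator of the Borel sets.\<close>

lemma finite_measure_eqI_char:
  fixes M N :: "'a::euclidean_space measure"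
  assumes M[measurable_cong]: "sets M = sets borel" and finM: "finite_measure M"
    and N[measurable_cong]: "sets N = sets borel" and finN: "finite_measure N"
    and char: "\<And>t. (\<integral>x. cis (2 * pi * (t \<bullet> x)) \<partial>M) = (\<integral>x. cis (2 * pi * (t \<bullet> x)) \<partial>N)"
  shows "M = N"
proof -
  interpret M: finite_measure M by fact
  interpret N: finite_measure N by fact
  have g: "(\<integral>x. gauss (c *\<^sub>R (x - a)) \<partial>M) = (\<integral>x. gauss (c *\<^sub>R (x - a)) \<partial>N)" for c and a :: 'a
  proof -
    have "complex_of_real (\<integral>x. gauss (c *\<^sub>R (x - a)) \<partial>M) = complex_of_real (\<integral>x. gauss (c *\<^sub>R (x - a)) \<partial>N)"
      unfolding gauss_smoothing_char[OF M finM] gauss_smoothing_char[OF N finN] char ..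
    then show ?thesis by (simp only: of_real_eq_iff)
  qed
  have phi: "(\<integral>x. \<phi> x \<partial>M) = (\<integral>x. \<phi> x \<partial>N)"
    if "continuous_on UNIV \<phi>" "\<And>x. \<bar>\<phi> x\<bar> \<le> B" "integrable lborel \<phi>" for \<phi> :: "'a \<Rightarrow> real" and B
    using gauss_mollify_tendsto[OF M finM that] gauss_mollify_tendsto[OF N finN that]
    unfolding g by (rule LIMSEQ_unique)
  have box: "emeasure M (box l u) = emeasure N (box l u)" for l u :: 'a
  proof (cases "box l u = {}")
    case False
    \<comment> \<open>Continuous, vanishing outside the box, and tending pointwise to its indicator,
      as the distance to the complement is positive inside the box.\<close>
    define \<phi> where "\<phi> n x = min 1 (real n * setdist {x} (- box l u))" for n and x :: 'a
    \<comment> \<open>\<open>setdist\<close> to the empty set is 0, so the complement of the box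
      must be nonempty.\<close>
    have ne: "- box l u \<noteq> {}" using bounded_box[of l u] not_bounded_UNIV[where 'a='a] by (metis compl_eq_compl_iff double_compl Compl_UNIV_eq)
    have cont: "continuous_on UNIV (\<phi> n)" for n
      unfolding \<phi>_def by (intro continuous_intros continuous_on_setdist)
    have mb[measurable]: "\<phi> n \<in> borel_measurable borel" for n
      using cont by (rule borel_measurable_continuous_onI)
    have b: "\<bar>\<phi> n x\<bar> \<le> indicator (box l u) x" for n x
    proof (cases "x \<in> box l u")
      case False
      then have "setdist {x} (- box l u) = 0" by (simp add: setdist_sing_in_set)
      then show ?thesis by (simp add: \<phi>_def)
    qed (auto simp: \<phi>_def setdist_pos_le)
    have int: "integrable lborel (\<phi> n)" for n
      by (rule Bochner_Integration.integrable_bound[of _ "indicat_real (box l u)"])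
         (use b in \<open>auto simp: emeasure_lborel_box_finite[unfolded infinity_ennreal_def]\<close>)
    have lim: "(\<lambda>n. \<phi> n x) \<longlonglongrightarrow> indicator (box l u) x" for x
    proof (cases "x \<in> box l u")
      case True
      have "setdist {x} (- box l u) > 0"
        using True setdist_pos_le[of "{x}" "- box l u"] setdist_eq_0_closed[of "- box l u" x] ne
        by (auto simp: closed_Compl open_box less_le)
      then have "filterlim (\<lambda>n. real n * setdist {x} (- box l u)) at_top sequentially"
        by (intro filterlim_at_top_mult_tendsto_pos[OF tendsto_const] filterlim_real_sequentially)
      then have "eventually (\<lambda>n. 1 \<le> real n * setdist {x} (- box l u)) sequentially"
        unfolding filterlim_at_top by blast
      then have "eventually (\<lambda>n. \<phi> n x = indicator (box l u) x) sequentially"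
        by eventually_elim (use True in \<open>auto simp: \<phi>_def\<close>)
      then show ?thesis by (rule tendsto_eventually)
    next
      case False
      then have "\<phi> n x = 0" for n using b[of n x] by simp
      then show ?thesis using False by simp
    qed
    have L: "(\<lambda>n. \<integral>x. \<phi> n x \<partial>K) \<longlonglongrightarrow> (\<integral>x. indicator (box l u) x \<partial>K)"
      if [measurable_cong]: "sets K = sets borel" and "finite_measure K" for K
    proof -
      interpret finite_measure K by fact
      show ?thesis
        by (rule integral_dominated_convergence[where w="\<lambda>_. 1"])
           (use lim b in \<open>auto intro!: AE_I2 order_trans[OF b] simp: indicator_le_1\<close>)
    qed
    have "(\<integral>x. \<phi> n x \<partial>M) = (\<integral>x. \<phi> n x \<partial>N)" for n
      by (rule phi[OF cont _ int, of _ 1]) (use b in \<open>auto intro!: order_trans[OF b] simp: indicator_le_1\<close>)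
    then have "(\<integral>x. indicat_real (box l u) x \<partial>M) = (\<integral>x. indicator (box l u) x \<partial>N)"
      using LIMSEQ_unique[OF L[OF M finM]] L[OF N finN] by simp
    then show ?thesis
      by (simp add: M.emeasure_eq_measure N.emeasure_eq_measure M N)
  qed simp
  show ?thesis
  proof (rule measure_eqI_generator_eq[where E="range (\<lambda>(a, b). box a b)" and \<Omega>=UNIV and A="\<lambda>n. box (- real n *\<^sub>R One) (real n *\<^sub>R One)"])
    show "Int_stable (range (\<lambda>(a, b). box a b :: 'a set))"
      by (auto simp: Int_stable_def box_Int_box)
    show "sets M = sigma_sets UNIV (range (\<lambda>(a, b). box a b))"
      using M by (simp add: borel_eq_box)
    show "sets N = sigma_sets UNIV (range (\<lambda>(a, b). box a b))"
      using N by (simp add: borel_eq_box)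
  qed (use box UN_box_eq_UNIV[where 'a='a] in auto)
qed

section \<open>The Plancherel theorem\<close>

text \<open>Written with \<open>lborel\<close> and \<open>cis\<close> for functions on the whole
  space; the transform of the statement, over \<open>lebesgue_on \<Omega>\<close>, is matched with
  it in \<open>fourier_on_eq_ft\<close>.\<close>

definition ft :: "('a::euclidean_space \<Rightarrow> complex) \<Rightarrow> 'a \<Rightarrow> complex" where
  "ft f \<xi> = (\<integral>x. f x * cis (- (2 * pi * (\<xi> \<bullet> x))) \<partial>lborel)"

lemma integrable_mult_cis:
  assumes "integrable M (f :: 'a::euclidean_space \<Rightarrow> complex)" and [measurable_cong]: "sets M = sets borel"
  shows "integrable M (\<lambda>x. f x * cis (r * (\<xi> \<bullet> x)))"
proof (rule Bochner_Integration.integrable_bound[OF assms(1)])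
  have [measurable]: "f \<in> borel_measurable M" using assms(1) by simp
  have "(\<lambda>x. cis (r * (\<xi> \<bullet> x))) \<in> borel_measurable M" by measurable
  then show "(\<lambda>x. f x * cis (r * (\<xi> \<bullet> x))) \<in> borel_measurable M" by measurable
qed (simp add: norm_mult)

lemma integrable_ft:
  assumes "integrable lborel f"
  shows "integrable lborel (\<lambda>x. f x * cis (- (2 * pi * (\<xi> \<bullet> x))))"
  using integrable_mult_cis[OF assms, of "- (2 * pi)"] by simp

lemma ft_measurable [measurable]:
  assumes [measurable]: "f \<in> borel_measurable borel"
  shows "ft f \<in> borel_measurable borel"
  unfolding ft_def by measurable

lemma norm_ft_le: "norm (ft f \<xi>) \<le> (\<integral>x. norm (f x) \<partial>lborel)"
  unfolding ft_def using integral_norm_bound[of lborel "\<lambda>x. f x * cis (- (2 * pi * (\<xi> \<bullet> x)))"]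
  by (simp add: norm_mult)

lemma ft_diff:
  assumes "integrable lborel f" "integrable lborel g"
  shows "ft (\<lambda>x. f x - g x) \<xi> = ft f \<xi> - ft g \<xi>"
  using integrable_ft[OF assms(1)] integrable_ft[OF assms(2)] by (simp add: ft_def left_diff_distrib)

lemma ft_add:
  assumes "integrable lborel f" "integrable lborel g"
  shows "ft (\<lambda>x. f x + g x) \<xi> = ft f \<xi> + ft g \<xi>"
  using integrable_ft[OF assms(1)] integrable_ft[OF assms(2)] by (simp add: ft_def distrib_right)

lemma ft_cmult: "ft (\<lambda>x. c * f x) \<xi> = c * ft f \<xi>"
  by (simp add: ft_def mult.assoc)

lemma ft_translate:
  assumes [measurable]: "f \<in> borel_measurable borel"
  shows "ft (\<lambda>x. f (x - s)) \<xi> = cis (- (2 * pi * (\<xi> \<bullet> s))) * ft f \<xi>"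
proof -
  have "ft (\<lambda>x. f (x - s)) \<xi> = (\<integral>x. f (x + s - s) * cis (- (2 * pi * (\<xi> \<bullet> (x + s)))) \<partial>lborel)"
    unfolding ft_def by (rule integral_lborel_translate[symmetric]) measurable
  also have "\<dots> = (\<integral>x. cis (- (2 * pi * (\<xi> \<bullet> s))) * (f x * cis (- (2 * pi * (\<xi> \<bullet> x)))) \<partial>lborel)"
    by (intro Bochner_Integration.integral_cong) (simp_all add: inner_add_right algebra_simps cis_mult)
  finally show ?thesis by (simp add: ft_def)
qed

lemma gauss_scaled_transform:
  fixes w :: "'a::euclidean_space"
  assumes "c > 0"
  shows "(\<integral>\<xi>. gauss (c *\<^sub>R \<xi>) * cis (- (2 * pi * (\<xi> \<bullet> w))) \<partial>lborel) = (1 / c) ^ DIM('a) * gauss ((1 / c) *\<^sub>R w)"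
proof -
  have "(\<integral>\<xi>. gauss (c *\<^sub>R \<xi>) * cis (- (2 * pi * (\<xi> \<bullet> w))) \<partial>lborel) =
    (1 / c) ^ DIM('a) *\<^sub>R (\<integral>\<xi>. gauss (c *\<^sub>R (0 + (1 / c) *\<^sub>R \<xi>)) * cis (- (2 * pi * ((0 + (1 / c) *\<^sub>R \<xi>) \<bullet> w))) \<partial>lborel)"
    by (rule integral_lborel_scale) (use assms in auto)
  also have "(\<lambda>\<xi>. gauss (c *\<^sub>R (0 + (1 / c) *\<^sub>R \<xi>)) * cis (- (2 * pi * ((0 + (1 / c) *\<^sub>R \<xi>) \<bullet> w))))
     = (\<lambda>\<xi>. gauss \<xi> * cis (2 * pi * (((- 1 / c) *\<^sub>R w) \<bullet> \<xi>)))"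
    using assms by (auto simp: inner_commute)
  also have "(\<integral>\<xi>. gauss \<xi> * cis (2 * pi * (((- 1 / c) *\<^sub>R w) \<bullet> \<xi>)) \<partial>lborel) = gauss ((- 1 / c) *\<^sub>R w)"
    by (rule gauss_transform)
  also have "gauss ((- 1 / c) *\<^sub>R w) = gauss ((1 / c) *\<^sub>R w)"
    using gauss_minus[of "(1 / c) *\<^sub>R w"] by simp
  finally show ?thesis by (simp add: scaleR_conv_of_real)
qed

lemma integrable_gauss_scaled: "c > 0 \<Longrightarrow> integrable lborel (\<lambda>x::'a::euclidean_space. gauss (c *\<^sub>R x))"
  using integrable_lborel_scale[OF integrable_gauss, of c 0] by simp

text \<open>The Gaussian weight makes the integral over the frequency and two space variables
  absolutely convergent. Transforming the Gaussian back leaves the autocorrelation of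
  \<open>f\<close>, averaged over shifts of size about \<open>c\<close>. Boundedness of
  \<open>f\<close> dominates the last exchange.\<close>

lemma plancherel_gauss:
  fixes f :: "'a::euclidean_space \<Rightarrow> complex"
  assumes f: "integrable lborel f" and bnd: "\<And>x. norm (f x) \<le> B" and c: "c > 0"
  shows "complex_of_real (\<integral>\<xi>. (norm (ft f \<xi>))\<^sup>2 * gauss (c *\<^sub>R \<xi>) \<partial>lborel) =
    (\<integral>z. gauss z * (\<integral>x. f x * cnj (f (x - c *\<^sub>R z)) \<partial>lborel) \<partial>lborel)"
proof -
  have [measurable]: "f \<in> borel_measurable borel" using f by auto
  define K where "K = (\<integral>x. norm (f x) \<partial>lborel)"
  have K: "norm (ft f \<xi>) \<le> K" for \<xi> unfolding K_def by (rule norm_ft_le)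
  note ig = integrable_gauss_scaled[OF c, where 'a='a]
  have B: "B \<ge> 0" using bnd[of 0] norm_ge_zero order_trans by blast
  \<comment> \<open>The damped transform turned back: \<open>cnj f\<close> averaged around
    \<open>x\<close>.\<close>
  have inner: "(\<integral>\<xi>. cnj (ft f \<xi>) * gauss (c *\<^sub>R \<xi>) * cis (- (2 * pi * (\<xi> \<bullet> x))) \<partial>lborel)
     = (\<integral>z. cnj (f (x - c *\<^sub>R z)) * gauss z \<partial>lborel)" for x
  proof -
    have "(\<integral>\<xi>. cnj (ft f \<xi>) * gauss (c *\<^sub>R \<xi>) * cis (- (2 * pi * (\<xi> \<bullet> x))) \<partial>lborel)
      = (\<integral>\<xi>. (\<integral>y. cnj (f y) * cis (2 * pi * (\<xi> \<bullet> y)) * gauss (c *\<^sub>R \<xi>) * cis (- (2 * pi * (\<xi> \<bullet> x))) \<partial>lborel) \<partial>lborel)"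
    proof (rule Bochner_Integration.integral_cong[OF refl])
      fix \<xi>
      have "cnj (ft f \<xi>) = (\<integral>y. cnj (f y) * cis (2 * pi * (\<xi> \<bullet> y)) \<partial>lborel)"
        unfolding ft_def by (subst Bochner_Integration.integral_cnj[symmetric]) (simp add: cis_cnj)
      then show "cnj (ft f \<xi>) * gauss (c *\<^sub>R \<xi>) * cis (- (2 * pi * (\<xi> \<bullet> x)))
        = (\<integral>y. cnj (f y) * cis (2 * pi * (\<xi> \<bullet> y)) * gauss (c *\<^sub>R \<xi>) * cis (- (2 * pi * (\<xi> \<bullet> x))) \<partial>lborel)"
        by simp
    qed
    also have "\<dots> = (\<integral>y. (\<integral>\<xi>. cnj (f y) * cis (2 * pi * (\<xi> \<bullet> y)) * gauss (c *\<^sub>R \<xi>) * cis (- (2 * pi * (\<xi> \<bullet> x))) \<partial>lborel) \<partial>lborel)"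
      by (rule lborel_pair.Fubini_integral[symmetric],
          rule lborel_pair.integrable_product_bound[where u="\<lambda>\<xi>. gauss (c *\<^sub>R \<xi>)" and v="\<lambda>y. norm (f y)"])
         (use ig f in \<open>auto simp: norm_mult\<close>)
    also have "\<dots> = (\<integral>y. cnj (f y) * ((1 / c) ^ DIM('a) * gauss ((1 / c) *\<^sub>R (x - y))) \<partial>lborel)"
    proof (rule Bochner_Integration.integral_cong[OF refl])
      fix y
      have "(\<lambda>\<xi>. cnj (f y) * cis (2 * pi * (\<xi> \<bullet> y)) * gauss (c *\<^sub>R \<xi>) * cis (- (2 * pi * (\<xi> \<bullet> x))))
        = (\<lambda>\<xi>. cnj (f y) * (gauss (c *\<^sub>R \<xi>) * cis (- (2 * pi * (\<xi> \<bullet> (x - y))))))"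
      proof
        fix \<xi>
        have "cis (2 * pi * (\<xi> \<bullet> y)) * cis (- (2 * pi * (\<xi> \<bullet> x))) = cis (- (2 * pi * (\<xi> \<bullet> (x - y))))"
          by (simp add: cis_mult inner_diff_right algebra_simps)
        then show "cnj (f y) * cis (2 * pi * (\<xi> \<bullet> y)) * gauss (c *\<^sub>R \<xi>) * cis (- (2 * pi * (\<xi> \<bullet> x)))
          = cnj (f y) * (gauss (c *\<^sub>R \<xi>) * cis (- (2 * pi * (\<xi> \<bullet> (x - y)))))"
          by (metis mult.assoc mult.commute)
      qed
      then show "(\<integral>\<xi>. cnj (f y) * cis (2 * pi * (\<xi> \<bullet> y)) * gauss (c *\<^sub>R \<xi>) * cis (- (2 * pi * (\<xi> \<bullet> x))) \<partial>lborel)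
         = cnj (f y) * ((1 / c) ^ DIM('a) * gauss ((1 / c) *\<^sub>R (x - y)))"
        by (simp only: integral_mult_right_zero gauss_scaled_transform[OF c])
    qed
    also have "\<dots> = (\<integral>y. cnj (f (x + c *\<^sub>R y)) * gauss ((1 / c) *\<^sub>R (x - (x + c *\<^sub>R y))) \<partial>lborel)"
    proof -
      let ?G = "\<lambda>y. cnj (f y) * gauss ((1 / c) *\<^sub>R (x - y))"
      have "(\<integral>y. cnj (f y) * ((1 / c) ^ DIM('a) * gauss ((1 / c) *\<^sub>R (x - y))) \<partial>lborel)
         = (\<integral>y. complex_of_real ((1 / c) ^ DIM('a)) * ?G y \<partial>lborel)"
        by (intro Bochner_Integration.integral_cong) simp_all
      also have "\<dots> = complex_of_real ((1 / c) ^ DIM('a)) * (\<integral>y. ?G y \<partial>lborel)"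
        by (rule integral_mult_right_zero)
      also have "(\<integral>y. ?G y \<partial>lborel) = c ^ DIM('a) *\<^sub>R (\<integral>y. ?G (x + c *\<^sub>R y) \<partial>lborel)"
        by (rule integral_lborel_scale[OF _ c]) measurable
      finally show ?thesis
        using c by (simp add: scaleR_conv_of_real power_divide)
    qed
    also have "\<dots> = (\<integral>y. cnj (f (x + c *\<^sub>R y)) * gauss y \<partial>lborel)"
      using c by simp
    also have "\<dots> = (\<integral>y. cnj (f (x - c *\<^sub>R y)) * gauss y \<partial>lborel)"
      using integral_lborel_uminus[of "\<lambda>y. cnj (f (x - c *\<^sub>R y)) * gauss y"] by simp
    finally show ?thesis .
  qed
  have i2: "integrable lborel (\<lambda>\<xi>::'a. K * gauss (c *\<^sub>R \<xi>))"
    using ig by simp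
  have "complex_of_real (\<integral>\<xi>. (norm (ft f \<xi>))\<^sup>2 * gauss (c *\<^sub>R \<xi>) \<partial>lborel) =
    (\<integral>\<xi>. complex_of_real ((norm (ft f \<xi>))\<^sup>2 * gauss (c *\<^sub>R \<xi>)) \<partial>lborel)"
    by (rule integral_complex_of_real[symmetric])
  also have "\<dots> = (\<integral>\<xi>. ft f \<xi> * (cnj (ft f \<xi>) * gauss (c *\<^sub>R \<xi>)) \<partial>lborel)"
    by (simp only: of_real_mult complex_norm_square mult.assoc)
  also have "\<dots> = (\<integral>\<xi>. (\<integral>x. f x * (cnj (ft f \<xi>) * gauss (c *\<^sub>R \<xi>) * cis (- (2 * pi * (\<xi> \<bullet> x)))) \<partial>lborel) \<partial>lborel)"
  proof (rule Bochner_Integration.integral_cong[OF refl])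
    fix \<xi>
    let ?W = "cnj (ft f \<xi>) * complex_of_real (gauss (c *\<^sub>R \<xi>))"
    have "(\<integral>x. f x * (?W * cis (- (2 * pi * (\<xi> \<bullet> x)))) \<partial>lborel)
      = (\<integral>x. ?W * (f x * cis (- (2 * pi * (\<xi> \<bullet> x)))) \<partial>lborel)"
      by (simp only: mult.left_commute)
    also have "\<dots> = ?W * ft f \<xi>"
      unfolding ft_def[of f \<xi>] by (rule integral_mult_right_zero)
    finally show "ft f \<xi> * ?W = (\<integral>x. f x * (?W * cis (- (2 * pi * (\<xi> \<bullet> x)))) \<partial>lborel)"
      by (simp only: mult.commute)
  qed
  also have "\<dots> = (\<integral>x. (\<integral>\<xi>. f x * (cnj (ft f \<xi>) * gauss (c *\<^sub>R \<xi>) * cis (- (2 * pi * (\<xi> \<bullet> x)))) \<partial>lborel) \<partial>lborel)"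
  proof (rule lborel_pair.Fubini_integral[symmetric],
      rule lborel_pair.integrable_product_bound[where u="\<lambda>\<xi>. K * gauss (c *\<^sub>R \<xi>)" and v="\<lambda>y. norm (f y)"])
    show "norm (f x * (cnj (ft f \<xi>) * gauss (c *\<^sub>R \<xi>) * cis (- (2 * pi * (\<xi> \<bullet> x))))) \<le> K * gauss (c *\<^sub>R \<xi>) * norm (f x)" for \<xi> x
      using K[of \<xi>] by (simp add: norm_mult mult.commute mult_right_mono mult_left_mono)
  qed (use i2 f in auto)
  also have "\<dots> = (\<integral>x. (\<integral>z. f x * (cnj (f (x - c *\<^sub>R z)) * gauss z) \<partial>lborel) \<partial>lborel)"
    by (simp only: integral_mult_right_zero inner)
  also have "\<dots> = (\<integral>z. (\<integral>x. f x * (cnj (f (x - c *\<^sub>R z)) * gauss z) \<partial>lborel) \<partial>lborel)"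
  proof (rule lborel_pair.Fubini_integral[symmetric],
      rule lborel_pair.integrable_product_bound[where u="\<lambda>x. B * norm (f x)" and v=gauss])
    show "norm (f x * (cnj (f (x - c *\<^sub>R z)) * gauss z)) \<le> B * norm (f x) * gauss z" for x z
      using mult_right_mono[OF mult_left_mono[OF bnd[of "x - c *\<^sub>R z"] norm_ge_zero[of "f x"]] gauss_nonneg[of z]]
      by (simp add: norm_mult mult_ac)
  qed (use f integrable_gauss in auto)
  also have "\<dots> = (\<integral>z. gauss z * (\<integral>x. f x * cnj (f (x - c *\<^sub>R z)) \<partial>lborel) \<partial>lborel)"
  proof (rule Bochner_Integration.integral_cong[OF refl])
    fix z
    have "(\<integral>x. f x * (cnj (f (x - c *\<^sub>R z)) * gauss z) \<partial>lborel)
      = (\<integral>x. gauss z * (f x * cnj (f (x - c *\<^sub>R z))) \<partial>lborel)"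
      by (intro Bochner_Integration.integral_cong) simp_all
    also have "\<dots> = gauss z * (\<integral>x. f x * cnj (f (x - c *\<^sub>R z)) \<partial>lborel)"
      by (rule integral_mult_right_zero)
    finally show "(\<integral>x. f x * (cnj (f (x - c *\<^sub>R z)) * gauss z) \<partial>lborel)
      = gauss z * (\<integral>x. f x * cnj (f (x - c *\<^sub>R z)) \<partial>lborel)" .
  qed
  finally show ?thesis .
qed

text \<open>The damping \<open>c\<close> in \<open>plancherel_gauss\<close> tends to 0. On the left
  the weights increase to 1 and monotone convergence applies; on the right the averaged
  autocorrelation tends to its value at shift 0, the squared norm of \<open>f\<close>.\<close>

lemma plancherel_bounded:
  fixes f :: "'a::euclidean_space \<Rightarrow> complex"
  assumes f: "integrable lborel f" and bnd: "\<And>x. norm (f x) \<le> B"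
  shows "(\<integral>\<^sup>+\<xi>. ennreal ((norm (ft f \<xi>))\<^sup>2) \<partial>lborel) = (\<integral>\<^sup>+x. ennreal ((norm (f x))\<^sup>2) \<partial>lborel)"
proof -
  have [measurable]: "f \<in> borel_measurable borel" using f by auto
  have B: "B \<ge> 0" using bnd[of 0] norm_ge_zero order_trans by blast
  define K where "K = (\<integral>x. norm (f x) \<partial>lborel)"
  have K: "norm (ft f \<xi>) \<le> K" for \<xi> unfolding K_def by (rule norm_ft_le)
  define c where "c n = 1 / real (Suc n)" for n
  have c: "c n > 0" for n by (simp add: c_def)
  have c0: "c \<longlonglongrightarrow> 0" unfolding c_def using LIMSEQ_Suc[OF lim_1_over_n] by simp
  have cdec: "c (Suc n) \<le> c n" for n by (simp add: c_def frac_le)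
  define A where "A s = (\<integral>x. f x * cnj (f (x - s)) \<partial>lborel)" for s
  have prodbnd: "norm (f x * cnj (f (x - s))) \<le> norm (B * norm (f x))" for x s
    using mult_left_mono[OF bnd[of "x - s"] norm_ge_zero[of "f x"]] B by (simp add: norm_mult mult.commute)
  have iA: "integrable lborel (\<lambda>x. f x * cnj (f (x - s)))" for s
  proof (rule Bochner_Integration.integrable_bound[OF _ _ AE_I2[OF prodbnd]])
    show "(\<lambda>x. f x * cnj (f (x - s))) \<in> borel_measurable lborel" by measurable
  qed (use f in auto)
  have Am[measurable]: "A \<in> borel_measurable borel"
    unfolding A_def by measurable
  have Abnd: "norm (A s) \<le> B * K" for s
  proof -
    have "norm (A s) \<le> (\<integral>x. B * norm (f x) \<partial>lborel)"
      unfolding A_def by (rule Bochner_Integration.integral_norm_bound_integral[OF iA]) (use f prodbnd B in auto)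
    then show ?thesis by (simp add: K_def)
  qed
  \<comment> \<open>Since \<open>f\<close> is bounded, continuity of the autocorrelation at 0
    reduces to continuity of translation in L^1.\<close>
  have Alim: "(A \<longlongrightarrow> A 0) (at 0)"
  proof -
    have t: "((\<lambda>s. B * (\<integral>x. norm (f (x + (- s)) - f x) \<partial>lborel)) \<longlongrightarrow> B * 0) (at 0)"
    proof (rule tendsto_mult[OF tendsto_const])
      have "filterlim (\<lambda>s::'a. - s) (at 0) (at 0)"
        by (rule filterlim_atI) (auto intro!: tendsto_eq_intros simp: eventually_at_filter)
      from filterlim_compose[OF L1_translation_continuous[OF f] this]
      show "((\<lambda>s. \<integral>x. norm (f (x + (- s)) - f x) \<partial>lborel) \<longlongrightarrow> 0) (at 0)" .
    qed
    have "((\<lambda>s. A s - A 0) \<longlongrightarrow> 0) (at 0)"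
    proof (rule Lim_null_comparison[OF always_eventually])
      show "((\<lambda>s. B * (\<integral>x. norm (f (x + (- s)) - f x) \<partial>lborel)) \<longlongrightarrow> 0) (at 0)" using t by simp
      show "\<forall>s. norm (A s - A 0) \<le> B * (\<integral>x. norm (f (x + (- s)) - f x) \<partial>lborel)"
      proof
        fix s
        have "A s - A 0 = (\<integral>x. f x * cnj (f (x - s)) - f x * cnj (f (x - 0)) \<partial>lborel)"
          unfolding A_def by (rule Bochner_Integration.integral_diff[OF iA iA, symmetric])
        also have "norm \<dots> \<le> (\<integral>x. B * norm (f (x + (- s)) - f x) \<partial>lborel)"
        proof (rule Bochner_Integration.integral_norm_bound_integral)
          show "integrable lborel (\<lambda>x. f x * cnj (f (x - s)) - f x * cnj (f (x - 0)))"
            by (rule Bochner_Integration.integrable_diff[OF iA iA])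
          show "integrable lborel (\<lambda>x. B * norm (f (x + (- s)) - f x))"
            by (intro integrable_mult_right integrable_norm Bochner_Integration.integrable_diff integrable_lborel_translate f)
          show "norm (f x * cnj (f (x - s)) - f x * cnj (f (x - 0))) \<le> B * norm (f (x + (- s)) - f x)" for x
          proof -
            have "f x * cnj (f (x - s)) - f x * cnj (f (x - 0)) = f x * cnj (f (x + (- s)) - f x)"
              by (simp add: algebra_simps)
            then have "norm (f x * cnj (f (x - s)) - f x * cnj (f (x - 0))) = norm (f x) * norm (f (x + (- s)) - f x)"
              by (simp only: norm_mult complex_mod_cnj)
            then show ?thesis using bnd[of x] by (simp add: mult_right_mono)
          qed
        qed
        finally show "norm (A s - A 0) \<le> B * (\<integral>x. norm (f (x + (- s)) - f x) \<partial>lborel)" by simp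
      qed
    qed
    then show ?thesis using LIM_zero_cancel by blast
  qed
  have Acont: "(\<lambda>n. A (c n *\<^sub>R z)) \<longlonglongrightarrow> A 0" for z
  proof -
    have "(\<lambda>n. c n *\<^sub>R z) \<longlonglongrightarrow> 0" using tendsto_scaleR[OF c0 tendsto_const[of z]] by simp
    moreover have "isCont A 0" using Alim by (simp add: isCont_def)
    ultimately show ?thesis by (rule isCont_tendsto_compose[rotated])
  qed
  have "(\<lambda>n. \<integral>z. gauss z * A (c n *\<^sub>R z) \<partial>lborel) \<longlonglongrightarrow> (\<integral>z. gauss (z::'a) * A 0 \<partial>lborel)"
  proof (rule integral_dominated_convergence[where w="\<lambda>z. B * K * gauss z"])
    show "AE z in lborel. (\<lambda>n. gauss z * A (c n *\<^sub>R z)) \<longlonglongrightarrow> gauss z * A 0"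
      by (intro AE_I2 tendsto_mult tendsto_const Acont)
    show "AE z in lborel. norm (gauss z * A (c n *\<^sub>R z)) \<le> B * K * gauss z" for n
      using Abnd by (intro AE_I2) (simp add: norm_mult mult.commute mult_right_mono)
  qed (use integrable_gauss[where 'a='a] in auto)
  moreover have "(\<integral>z. gauss (z::'a) * A 0 \<partial>lborel) = A 0"
    using integral_gauss[where 'a='a] by simp
  moreover have A0: "A 0 = complex_of_real (\<integral>x. (norm (f x))\<^sup>2 \<partial>lborel)"
    by (simp add: A_def complex_norm_square[symmetric] del: of_real_power)
  moreover have "(\<integral>z. gauss z * A (c n *\<^sub>R z) \<partial>lborel)
     = complex_of_real (\<integral>\<xi>. (norm (ft f \<xi>))\<^sup>2 * gauss (c n *\<^sub>R \<xi>) \<partial>lborel)" for n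
    unfolding A_def by (rule plancherel_gauss[OF f bnd c, symmetric])
  ultimately have "(\<lambda>n. complex_of_real (\<integral>\<xi>. (norm (ft f \<xi>))\<^sup>2 * gauss (c n *\<^sub>R \<xi>) \<partial>lborel))
     \<longlonglongrightarrow> complex_of_real (\<integral>x. (norm (f x))\<^sup>2 \<partial>lborel)"
    by (simp only:)
  then have "(\<lambda>n. (\<integral>\<xi>. (norm (ft f \<xi>))\<^sup>2 * gauss (c n *\<^sub>R \<xi>) \<partial>lborel)) \<longlonglongrightarrow> (\<integral>x. (norm (f x))\<^sup>2 \<partial>lborel)"
    by (simp only: tendsto_of_real_iff)
  then have "(\<lambda>n. ennreal (\<integral>\<xi>. (norm (ft f \<xi>))\<^sup>2 * gauss (c n *\<^sub>R \<xi>) \<partial>lborel)) \<longlonglongrightarrow> ennreal (\<integral>x. (norm (f x))\<^sup>2 \<partial>lborel)"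
    by (rule tendsto_ennrealI)
  moreover have "ennreal (\<integral>\<xi>. (norm (ft f \<xi>))\<^sup>2 * gauss (c n *\<^sub>R \<xi>) \<partial>lborel)
     = (\<integral>\<^sup>+\<xi>. ennreal ((norm (ft f \<xi>))\<^sup>2 * gauss (c n *\<^sub>R \<xi>)) \<partial>lborel)" for n
  proof (rule nn_integral_eq_integral[symmetric])
    have "norm ((norm (ft f \<xi>))\<^sup>2 * gauss (c n *\<^sub>R \<xi>)) \<le> norm (K\<^sup>2 * gauss (c n *\<^sub>R \<xi>))" for \<xi>
      using power_mono[OF K norm_ge_zero, of \<xi> 2] by (simp add: mult_right_mono abs_mult)
    then show "integrable lborel (\<lambda>\<xi>. (norm (ft f \<xi>))\<^sup>2 * gauss (c n *\<^sub>R \<xi>))"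
      by (intro Bochner_Integration.integrable_bound[OF integrable_mult_right[OF integrable_gauss_scaled[OF c[of n]], of "K\<^sup>2"]])
         auto
  qed simp
  moreover have "(\<lambda>n. \<integral>\<^sup>+\<xi>. ennreal ((norm (ft f \<xi>))\<^sup>2 * gauss (c n *\<^sub>R \<xi>)) \<partial>lborel)
     \<longlonglongrightarrow> (\<integral>\<^sup>+\<xi>. ennreal ((norm (ft f \<xi>))\<^sup>2) \<partial>lborel)"
  proof (rule nn_integral_LIMSEQ)
    have "gauss (c n *\<^sub>R \<xi>) \<le> gauss (c (Suc n) *\<^sub>R \<xi>)" for n and \<xi> :: 'a
      unfolding gauss_def using c[of n] c[of "Suc n"] cdec[of n]
      by (auto intro!: mult_left_mono power_mono mult_right_mono)
    then show "incseq (\<lambda>n \<xi>. ennreal ((norm (ft f \<xi>))\<^sup>2 * gauss (c n *\<^sub>R \<xi>)))"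
      by (intro incseq_SucI le_funI ennreal_leI mult_left_mono) auto
    fix \<xi> :: 'a
    have "(\<lambda>n. (norm (ft f \<xi>))\<^sup>2 * gauss (c n *\<^sub>R \<xi>)) \<longlonglongrightarrow> (norm (ft f \<xi>))\<^sup>2 * gauss (0 *\<^sub>R \<xi>)"
      by (intro tendsto_intros continuous_on_tendsto_compose[OF continuous_on_gauss[of UNIV]] c0) auto
    then show "(\<lambda>n. ennreal ((norm (ft f \<xi>))\<^sup>2 * gauss (c n *\<^sub>R \<xi>))) \<longlonglongrightarrow> ennreal ((norm (ft f \<xi>))\<^sup>2)"
      by (intro tendsto_ennrealI) simp
  qed simp
  ultimately have "(\<integral>\<^sup>+\<xi>. ennreal ((norm (ft f \<xi>))\<^sup>2) \<partial>lborel) = ennreal (\<integral>x. (norm (f x))\<^sup>2 \<partial>lborel)"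
    using LIMSEQ_unique by simp
  also have "\<dots> = (\<integral>\<^sup>+x. ennreal ((norm (f x))\<^sup>2) \<partial>lborel)"
    using iA[of 0] by (intro nn_integral_eq_integral[symmetric])
      (auto simp: complex_norm_square[symmetric] complex_of_real_integrable_eq simp del: of_real_power)
  finally show ?thesis .
qed

section \<open>Plancherel for integrable functions with finite L^2 norm\<close>

definition sqn :: "'a measure \<Rightarrow> ('a \<Rightarrow> complex) \<Rightarrow> ennreal" where
  "sqn M f = (\<integral>\<^sup>+x. ennreal ((norm (f x))\<^sup>2) \<partial>M)"

lemma norm_add_sq_le:
  fixes a b :: complex
  assumes "\<eta> > 0"
  shows "(norm (a + b))\<^sup>2 \<le> (1 + \<eta>) * (norm a)\<^sup>2 + (1 + 1 / \<eta>) * (norm b)\<^sup>2"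
proof -
  have "2 * (norm a * norm b) \<le> \<eta> * (norm a)\<^sup>2 + (norm b)\<^sup>2 / \<eta>"
  proof -
    have "0 \<le> (\<eta> * norm a - norm b)\<^sup>2 / \<eta>" using assms by simp
    also have "\<dots> = \<eta> * (norm a)\<^sup>2 + (norm b)\<^sup>2 / \<eta> - 2 * (norm a * norm b)"
      using assms by (simp add: power2_eq_square field_simps)
    finally show ?thesis by simp
  qed
  moreover have "(norm (a + b))\<^sup>2 \<le> (norm a + norm b)\<^sup>2"
    by (intro power_mono norm_triangle_ineq) simp
  ultimately show ?thesis by (simp add: power2_sum algebra_simps)
qed

text \<open>The free \<open>\<eta>\<close> serves two ends: tending to 0, it loses nothing in a
  limit; equal to 1, it gives the crude factor 2.\<close>

lemma sqn_add_le:
  assumes [measurable]: "f \<in> borel_measurable M" "g \<in> borel_measurable M" and "\<eta> > 0"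
  shows "sqn M (\<lambda>x. f x + g x) \<le> ennreal (1 + \<eta>) * sqn M f + ennreal (1 + 1 / \<eta>) * sqn M g"
proof -
  have "sqn M (\<lambda>x. f x + g x) \<le> (\<integral>\<^sup>+x. ennreal (1 + \<eta>) * ennreal ((norm (f x))\<^sup>2)
       + ennreal (1 + 1 / \<eta>) * ennreal ((norm (g x))\<^sup>2) \<partial>M)"
    unfolding sqn_def using \<open>\<eta> > 0\<close> norm_add_sq_le[OF \<open>\<eta> > 0\<close>]
    by (intro nn_integral_mono) (simp flip: ennreal_mult ennreal_plus add: ennreal_leI)
  also have "\<dots> = ennreal (1 + \<eta>) * sqn M f + ennreal (1 + 1 / \<eta>) * sqn M g"
    unfolding sqn_def by (simp add: nn_integral_add nn_integral_cmult)
  finally show ?thesis .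
qed

lemma sqn_mono: "(\<And>x. norm (f x) \<le> norm (g x)) \<Longrightarrow> sqn M f \<le> sqn M g"
  unfolding sqn_def by (intro nn_integral_mono ennreal_leI power_mono) auto

definition trunc_fun :: "nat \<Rightarrow> ('a \<Rightarrow> complex) \<Rightarrow> 'a \<Rightarrow> complex" where
  "trunc_fun n f x = (if norm (f x) \<le> real n then f x else 0)"

lemma trunc_fun_measurable [measurable]:
  assumes [measurable]: "f \<in> borel_measurable M"
  shows "trunc_fun n f \<in> borel_measurable M"
  unfolding trunc_fun_def by measurable

lemma norm_trunc_fun_le: "norm (trunc_fun n f x) \<le> norm (f x)" "norm (trunc_fun n f x) \<le> real n"
  by (auto simp: trunc_fun_def)

lemma eventually_trunc_fun: "eventually (\<lambda>n. trunc_fun n f x = f x) sequentially"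
proof -
  have "eventually (\<lambda>n. norm (f x) \<le> real n) sequentially"
    using eventually_ge_at_top[of "nat \<lceil>norm (f x)\<rceil>"] by eventually_elim linarith
  then show ?thesis by eventually_elim (simp add: trunc_fun_def)
qed

lemma integrable_trunc_fun: "integrable M f \<Longrightarrow> integrable M (trunc_fun n f)"
  by (rule Bochner_Integration.integrable_bound[of M f]) (auto simp: norm_trunc_fun_le)

lemma ft_trunc_tendsto:
  assumes f: "integrable lborel f"
  shows "(\<lambda>n. ft (trunc_fun n f) \<xi>) \<longlonglongrightarrow> ft f \<xi>"
  unfolding ft_def
proof (rule integral_dominated_convergence[where w="\<lambda>x. norm (f x)"])
  have [measurable]: "f \<in> borel_measurable borel" using f by auto
  show "AE x in lborel. (\<lambda>n. trunc_fun n f x * cis (- (2 * pi * (\<xi> \<bullet> x)))) \<longlonglongrightarrow> f x * cis (- (2 * pi * (\<xi> \<bullet> x)))"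
    by (intro AE_I2 tendsto_mult tendsto_const tendsto_eventually eventually_trunc_fun)
  show "(\<lambda>x. f x * cis (- (2 * pi * (\<xi> \<bullet> x)))) \<in> borel_measurable lborel" by measurable
  show "(\<lambda>x. trunc_fun n f x * cis (- (2 * pi * (\<xi> \<bullet> x)))) \<in> borel_measurable lborel" for n
    by measurable
qed (use f in \<open>auto simp: norm_mult norm_trunc_fun_le\<close>)

text \<open>Fatou's lemma along truncations, whose transforms converge pointwise by dominated
  convergence.\<close>

lemma plancherel_le:
  assumes f: "integrable lborel f"
  shows "sqn lborel (ft f) \<le> sqn lborel f"
proof -
  have [measurable]: "f \<in> borel_measurable borel" using f by auto
  have "sqn lborel (ft f) = (\<integral>\<^sup>+\<xi>. liminf (\<lambda>n. ennreal ((norm (ft (trunc_fun n f) \<xi>))\<^sup>2)) \<partial>lborel)"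
    unfolding sqn_def
  proof (intro nn_integral_cong lim_imp_Liminf[symmetric])
    show "(\<lambda>n. ennreal ((norm (ft (trunc_fun n f) \<xi>))\<^sup>2)) \<longlonglongrightarrow> ennreal ((norm (ft f \<xi>))\<^sup>2)" for \<xi>
      by (intro tendsto_ennrealI tendsto_power tendsto_norm ft_trunc_tendsto f)
  qed simp
  also have "\<dots> \<le> liminf (\<lambda>n. sqn lborel (ft (trunc_fun n f)))"
    unfolding sqn_def by (rule nn_integral_liminf) measurable
  also have "\<dots> \<le> liminf (\<lambda>n. sqn lborel f)"
  proof (intro Liminf_mono always_eventually allI)
    fix n
    have "sqn lborel (ft (trunc_fun n f)) = sqn lborel (trunc_fun n f)"
      unfolding sqn_def by (rule plancherel_bounded[OF integrable_trunc_fun[OF f] norm_trunc_fun_le(2)])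
    also have "\<dots> \<le> sqn lborel f"
      by (intro sqn_mono norm_trunc_fun_le)
    finally show "sqn lborel (ft (trunc_fun n f)) \<le> sqn lborel f" .
  qed
  also have "\<dots> = sqn lborel f" by (simp add: Liminf_const)
  finally show ?thesis .
qed

text \<open>For the reverse inequality a truncation is \<open>f\<close> plus a remainder that tends
  to 0 in L^2; by \<open>plancherel_le\<close> the transform of the remainder does so too. First
  \<open>n\<close> goes to infinity, then \<open>\<eta>\<close> to 0.\<close>

theorem plancherel:
  fixes f :: "'a::euclidean_space \<Rightarrow> complex"
  assumes f: "integrable lborel f" and fin: "sqn lborel f < \<infinity>"
  shows "sqn lborel (ft f) = sqn lborel f"
proof (rule antisym[OF plancherel_le[OF f]])
  have [measurable]: "f \<in> borel_measurable borel" using f by auto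
  have lim1: "(\<lambda>n. sqn lborel (trunc_fun n f)) \<longlonglongrightarrow> sqn lborel f"
    unfolding sqn_def
  proof (rule nn_integral_dominated_convergence[where w="\<lambda>x. ennreal ((norm (f x))\<^sup>2)"])
    show "AE x in lborel. (\<lambda>n. ennreal ((norm (trunc_fun n f x))\<^sup>2)) \<longlonglongrightarrow> ennreal ((norm (f x))\<^sup>2)"
      by (intro AE_I2 tendsto_ennrealI tendsto_power tendsto_norm tendsto_eventually eventually_trunc_fun)
  qed (use fin in \<open>auto simp: sqn_def intro!: ennreal_leI power_mono norm_trunc_fun_le\<close>)
  have lim2: "(\<lambda>n. sqn lborel (\<lambda>x. trunc_fun n f x - f x)) \<longlonglongrightarrow> (\<integral>\<^sup>+x. 0 \<partial>(lborel :: 'a measure))"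
    unfolding sqn_def
  proof (rule nn_integral_dominated_convergence[where w="\<lambda>x. ennreal ((norm (f x))\<^sup>2)"])
    show "AE x in lborel. (\<lambda>n. ennreal ((norm (trunc_fun n f x - f x))\<^sup>2)) \<longlonglongrightarrow> 0"
    proof (rule AE_I2)
      fix x
      show "(\<lambda>n. ennreal ((norm (trunc_fun n f x - f x))\<^sup>2)) \<longlonglongrightarrow> 0"
        by (rule tendsto_eventually, rule eventually_mono[OF eventually_trunc_fun[of f x]]) simp
    qed
  qed (use fin in \<open>auto simp: sqn_def trunc_fun_def\<close>)
  have le: "sqn lborel f \<le> ennreal (1 + \<eta>) * sqn lborel (ft f)" if \<eta>: "\<eta> > 0" for \<eta>
  proof -
    have "sqn lborel (trunc_fun n f) \<le> ennreal (1 + \<eta>) * sqn lborel (ft f)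
        + ennreal (1 + 1 / \<eta>) * sqn lborel (\<lambda>x. trunc_fun n f x - f x)" for n
    proof -
      note i = integrable_trunc_fun[OF f, of n]
      have "sqn lborel (trunc_fun n f) = sqn lborel (ft (trunc_fun n f))"
        unfolding sqn_def by (rule plancherel_bounded[OF i norm_trunc_fun_le(2), symmetric])
      also have "\<dots> = sqn lborel (\<lambda>\<xi>. ft f \<xi> + ft (\<lambda>x. trunc_fun n f x - f x) \<xi>)"
        by (simp add: ft_diff[OF i f])
      also have "\<dots> \<le> ennreal (1 + \<eta>) * sqn lborel (ft f)
        + ennreal (1 + 1 / \<eta>) * sqn lborel (ft (\<lambda>x. trunc_fun n f x - f x))"
        by (rule sqn_add_le[OF _ _ \<eta>]) measurable
      also have "\<dots> \<le> ennreal (1 + \<eta>) * sqn lborel (ft f)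
        + ennreal (1 + 1 / \<eta>) * sqn lborel (\<lambda>x. trunc_fun n f x - f x)"
        by (intro add_mono order_refl mult_left_mono plancherel_le Bochner_Integration.integrable_diff i f) auto
      finally show ?thesis .
    qed
    moreover have "(\<lambda>n. ennreal (1 + \<eta>) * sqn lborel (ft f)
        + ennreal (1 + 1 / \<eta>) * sqn lborel (\<lambda>x. trunc_fun n f x - f x)) \<longlonglongrightarrow>
         ennreal (1 + \<eta>) * sqn lborel (ft f) + ennreal (1 + 1 / \<eta>) * 0"
      using lim2 by (intro tendsto_add tendsto_const ennreal_tendsto_cmult) auto
    ultimately have "sqn lborel f \<le> ennreal (1 + \<eta>) * sqn lborel (ft f) + ennreal (1 + 1 / \<eta>) * 0"
      using lim1 by (intro LIMSEQ_le) auto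
    then show ?thesis by simp
  qed
  show "sqn lborel f \<le> sqn lborel (ft f)"
  proof -
    have "sqn lborel (ft f) < \<infinity>" using plancherel_le[OF f] fin by simp
    then obtain a b where ab: "sqn lborel f = ennreal a" "sqn lborel (ft f) = ennreal b" "0 \<le> a" "0 \<le> b"
      using fin by (metis ennreal_enn2real enn2real_nonneg infinity_ennreal_def)
    have "a \<le> (1 + \<eta>) * b" if "\<eta> > 0" for \<eta>
    proof -
      have "ennreal a \<le> ennreal ((1 + \<eta>) * b)"
        using le[OF that] ab that by (simp add: ennreal_mult del: ennreal_plus)
      then show ?thesis using ab that by (subst (asm) ennreal_le_iff) auto
    qed
    moreover have "((\<lambda>\<eta>. (1 + \<eta>) * b) \<longlongrightarrow> (1 + 0) * b) (at_right 0)"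
      by (intro tendsto_intros)
    ultimately have "a \<le> (1 + 0) * b"
      by (intro tendsto_lowerbound) (auto simp: eventually_at_right_less intro!: eventually_mono[OF eventually_at_right_less])
    then show ?thesis using ab by (simp add: ennreal_leI)
  qed
qed

section \<open>The frame identity on a set\<close>

text \<open>The functions live on the whole space and vanish everywhere outside \<open>X\<close>,
  not just almost everywhere: restriction, translation and passage to a larger set are then plain
  operations on functions.\<close>

definition L2on :: "'a::euclidean_space set \<Rightarrow> ('a \<Rightarrow> complex) set" where
  "L2on X = {f. f \<in> borel_measurable borel \<and> (\<forall>x. x \<notin> X \<longrightarrow> f x = 0) \<and> sqn lborel f < \<infinity>}"

lemma L2onD:
  assumes "f \<in> L2on X"
  shows "f \<in> borel_measurable borel" "x \<notin> X \<Longrightarrow> f x = 0" "sqn lborel f < \<infinity>"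
  using assms by (auto simp: L2on_def)

text \<open>The constant \<open>A\<close> is a parameter because the identity must pass from
  \<open>\<Omega>\<close> to other sets with the same constant, so that \<open>\<mu>\<close> can be
  compared with \<open>A\<close> times Lebesgue measure.\<close>

definition frame_on :: "'a::euclidean_space set \<Rightarrow> 'a measure \<Rightarrow> real \<Rightarrow> bool" where
  "frame_on X \<mu> A \<longleftrightarrow> (\<forall>f\<in>L2on X. sqn \<mu> (ft f) = ennreal A * sqn lborel f)"

lemma L2on_mono: "X \<subseteq> Y \<Longrightarrow> L2on X \<subseteq> L2on Y"
  by (auto simp: L2on_def)

lemma frame_on_mono: "frame_on Y \<mu> A \<Longrightarrow> X \<subseteq> Y \<Longrightarrow> frame_on X \<mu> A"
  using L2on_mono unfolding frame_on_def by blast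

text \<open>Cauchy-Schwarz against the indicator of \<open>X\<close>. The second claim is the source
  of the first, crude Bessel bound.\<close>

lemma L2on_integrable:
  fixes X :: "'a::euclidean_space set"
  assumes f: "f \<in> L2on X" and X[measurable]: "X \<in> sets borel" and fin: "emeasure lborel X < \<infinity>"
  shows "integrable lborel f"
    and "ennreal ((\<integral>x. norm (f x) \<partial>lborel)\<^sup>2) \<le> emeasure lborel X * sqn lborel f"
proof -
  note [measurable] = L2onD(1)[OF f]
  have eq: "(\<integral>\<^sup>+x. ennreal (norm (f x)) \<partial>lborel) = (\<integral>\<^sup>+x. indicator X x * ennreal (norm (f x)) \<partial>lborel)"
    using L2onD(2)[OF f] by (intro nn_integral_cong) (auto simp: indicator_def)
  have "(\<integral>\<^sup>+x. indicator X x * ennreal (norm (f x)) \<partial>lborel)\<^sup>2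
     \<le> (\<integral>\<^sup>+x. (indicator X x)\<^sup>2 \<partial>lborel) * (\<integral>\<^sup>+x. (ennreal (norm (f x)))\<^sup>2 \<partial>lborel)"
    by (rule Cauchy_Schwarz_nn_integral) auto
  also have "(\<integral>\<^sup>+x. (indicator X x)\<^sup>2 \<partial>lborel) = (\<integral>\<^sup>+x. indicator X x \<partial>lborel)"
    by (intro nn_integral_cong) (simp add: indicator_def)
  also have "(\<integral>\<^sup>+x. indicator X x \<partial>lborel) = emeasure lborel X" by simp
  also have "(\<integral>\<^sup>+x. (ennreal (norm (f x)))\<^sup>2 \<partial>lborel) = sqn lborel f"
    unfolding sqn_def by (simp add: ennreal_power)
  finally have le: "(\<integral>\<^sup>+x. ennreal (norm (f x)) \<partial>lborel)\<^sup>2 \<le> emeasure lborel X * sqn lborel f"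
    unfolding eq .
  have "emeasure lborel X * sqn lborel f < \<infinity>"
    using fin L2onD(3)[OF f] by (simp add: ennreal_mult_less_top)
  with le have "(\<integral>\<^sup>+x. ennreal (norm (f x)) \<partial>lborel)\<^sup>2 < \<infinity>" by simp
  then have "(\<integral>\<^sup>+x. ennreal (norm (f x)) \<partial>lborel) < \<infinity>"
    by (simp add: power_less_top_ennreal)
  then show i: "integrable lborel f" by (simp add: integrable_iff_bounded)
  then show "ennreal ((\<integral>x. norm (f x) \<partial>lborel)\<^sup>2) \<le> emeasure lborel X * sqn lborel f"
    using le by (subst (asm) nn_integral_eq_integral) (auto simp: ennreal_power)
qed

lemma frame_on_lborel:
  assumes "X \<in> sets borel" "emeasure lborel X < \<infinity>"
  shows "frame_on X lborel 1"
  unfolding frame_on_def using plancherel[OF L2on_integrable(1)[OF _ assms] L2onD(3)] by simp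

lemma sqn_translate:
  assumes [measurable]: "f \<in> borel_measurable borel"
  shows "sqn lborel (\<lambda>x. f (x + s)) = sqn lborel f"
  unfolding sqn_def by (rule nn_integral_lborel_translate[where f="\<lambda>x. ennreal ((norm (f x))\<^sup>2)"]) simp

lemma sqn_ft_translate:
  assumes [measurable]: "f \<in> borel_measurable borel"
  shows "sqn \<mu> (ft (\<lambda>x. f (x - s))) = sqn \<mu> (ft f)"
  by (simp add: sqn_def ft_translate[OF assms] norm_mult)

lemma frame_on_translate:
  assumes "frame_on X \<mu> A"
  shows "frame_on {x. x + s \<in> X} \<mu> A"
  unfolding frame_on_def
proof
  fix f assume f: "f \<in> L2on {x. x + s \<in> X}"
  note [measurable] = L2onD(1)[OF f]
  have eq: "sqn lborel (\<lambda>x. f (x - s)) = sqn lborel f"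
    using sqn_translate[of f "- s"] by simp
  have "(\<lambda>x. f (x - s)) \<in> borel_measurable borel" by measurable
  moreover have "f (x - s) = 0" if "x \<notin> X" for x
    using L2onD(2)[OF f, of "x - s"] that by simp
  ultimately have "(\<lambda>x. f (x - s)) \<in> L2on X"
    using L2onD(3)[OF f] by (simp add: L2on_def eq)
  then show "sqn \<mu> (ft f) = ennreal A * sqn lborel f"
    using assms eq sqn_ft_translate[of f \<mu> s] by (simp add: frame_on_def)
qed

text \<open>Markov's inequality in disguise: if every shift lost more than the fraction
  \<open>2 * \<delta>\<close> of the mass of \<open>h\<close>, the loss integrated over
  \<open>s\<close> in \<open>G\<close> would be at least \<open>2 * \<delta>\<close> times the mass
  times the measure of \<open>G\<close>, whereas Tonelli and the hypothesis at each \<open>y\<close>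
  allow at most half of that.\<close>

lemma good_shift:
  fixes X G \<Omega> :: "'a::euclidean_space set"
  assumes [measurable]: "G \<in> sets borel" "\<Omega> \<in> sets borel"
    and G: "emeasure lborel G < \<infinity>" "emeasure lborel G > 0" and d: "\<delta> > 0"
    and X: "\<And>y. y \<in> X \<Longrightarrow> emeasure lborel {s \<in> G. y + s \<notin> \<Omega>} \<le> ennreal \<delta> * emeasure lborel G"
    and h: "h \<in> L2on X"
  shows "\<exists>s. sqn lborel (\<lambda>y. if y + s \<in> \<Omega> then 0 else h y) \<le> ennreal (2 * \<delta>) * sqn lborel h"
proof (rule ccontr)
  assume neg: "\<not> ?thesis"
  note [measurable] = L2onD(1)[OF h]
  define N where "N = sqn lborel h"
  have Nfin: "N < \<infinity>" using L2onD(3)[OF h] by (simp add: N_def)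
  have big: "ennreal (2 * \<delta>) * N \<le> sqn lborel (\<lambda>y. if y + s \<in> \<Omega> then 0 else h y)" for s
    using neg by (simp add: N_def not_le less_imp_le)
  \<comment> \<open>For \<open>h\<close> of norm 0 every shift is good; positivity is what turns the
    final comparison of \<open>2 * \<delta>\<close> with \<open>\<delta>\<close> into a
    contradiction.\<close>
  have Npos: "N > 0"
  proof (rule ccontr)
    assume "\<not> 0 < N"
    then have "N = 0" by (simp add: not_less)
    moreover have "sqn lborel (\<lambda>y. if y + 0 \<in> \<Omega> then 0 else h y) \<le> N"
      unfolding N_def by (rule sqn_mono) simp
    ultimately have "sqn lborel (\<lambda>y. if y + 0 \<in> \<Omega> then 0 else h y) = 0" by simp
    then show False using neg by (metis le_zero_eq zero_le)
  qed
  let ?k = "\<lambda>s y. indicator G s * (if y + s \<in> \<Omega> then 0 else ennreal ((norm (h y))\<^sup>2))"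
  have km[measurable]: "(\<lambda>(s, y). ?k s y) \<in> borel_measurable (lborel \<Otimes>\<^sub>M lborel)"
    by measurable
  have "ennreal (2 * \<delta>) * N * emeasure lborel G = (\<integral>\<^sup>+s. ennreal (2 * \<delta>) * N * indicator G s \<partial>lborel)"
    by (simp add: nn_integral_cmult)
  also have "\<dots> \<le> (\<integral>\<^sup>+s. (\<integral>\<^sup>+y. ?k s y \<partial>lborel) \<partial>lborel)"
  proof (rule nn_integral_mono)
    fix s :: 'a
    have "(\<integral>\<^sup>+y. ?k s y \<partial>lborel) = indicator G s * sqn lborel (\<lambda>y. if y + s \<in> \<Omega> then 0 else h y)"
      unfolding sqn_def by (subst nn_integral_cmult[symmetric]) (auto intro!: nn_integral_cong)
    then show "ennreal (2 * \<delta>) * N * indicator G s \<le> (\<integral>\<^sup>+y. ?k s y \<partial>lborel)"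
      using big[of s] by (simp add: mult.commute[of _ "indicator G s"] mult_left_mono)
  qed
  also have "\<dots> = (\<integral>\<^sup>+y. (\<integral>\<^sup>+s. ?k s y \<partial>lborel) \<partial>lborel)"
    by (rule lborel_pair.Fubini'[symmetric]) (rule km)
  also have "\<dots> \<le> (\<integral>\<^sup>+y. ennreal \<delta> * emeasure lborel G * ennreal ((norm (h y))\<^sup>2) \<partial>lborel)"
  proof (rule nn_integral_mono)
    fix y
    show "(\<integral>\<^sup>+s. ?k s y \<partial>lborel) \<le> ennreal \<delta> * emeasure lborel G * ennreal ((norm (h y))\<^sup>2)"
    proof (cases "y \<in> X")
      case True
      have m: "{s \<in> G. y + s \<notin> \<Omega>} \<in> sets lborel" by measurable
      have "(\<integral>\<^sup>+s. ?k s y \<partial>lborel) = (\<integral>\<^sup>+s. ennreal ((norm (h y))\<^sup>2) * indicator {s \<in> G. y + s \<notin> \<Omega>} s \<partial>lborel)"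
        by (intro nn_integral_cong) (auto simp: indicator_def)
      also have "\<dots> = ennreal ((norm (h y))\<^sup>2) * emeasure lborel {s \<in> G. y + s \<notin> \<Omega>}"
        using m by (rule nn_integral_cmult_indicator)
      also have "\<dots> \<le> ennreal ((norm (h y))\<^sup>2) * (ennreal \<delta> * emeasure lborel G)"
        by (intro mult_left_mono X True) simp
      finally show ?thesis by (simp add: mult.commute)
    next
      case False
      then show ?thesis using L2onD(2)[OF h] by (simp cong: if_cong)
    qed
  qed
  also have "\<dots> = ennreal \<delta> * emeasure lborel G * N"
    unfolding N_def sqn_def by (rule nn_integral_cmult) measurable
  finally have le: "ennreal (2 * \<delta>) * N * emeasure lborel G \<le> ennreal \<delta> * emeasure lborel G * N" .
  obtain a b where ab: "N = ennreal a" "emeasure lborel G = ennreal b" "0 \<le> a" "0 \<le> b"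
    using Nfin G(1) by (metis ennreal_enn2real enn2real_nonneg infinity_ennreal_def)
  have pos: "a > 0" "b > 0" using ab Npos G(2) by auto
  have "ennreal (2 * \<delta> * a * b) \<le> ennreal (\<delta> * b * a)"
    using le pos d by (simp add: ab ennreal_mult)
  then have "2 * \<delta> * a * b \<le> \<delta> * b * a"
    using pos d by (subst (asm) ennreal_le_iff) auto
  moreover have "\<delta> * a * b > 0" using pos d by simp
  ultimately show False by (simp add: mult_ac)
qed

section \<open>Shifting into \<open>\<Omega>\<close>\<close>

lemma sqn_finite_integrable:
  assumes [measurable]: "f \<in> borel_measurable M" and fin: "sqn M f < \<infinity>"
  shows "integrable M (\<lambda>x. (norm (f x))\<^sup>2)" and "sqn M f = ennreal (\<integral>x. (norm (f x))\<^sup>2 \<partial>M)"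
proof -
  show i: "integrable M (\<lambda>x. (norm (f x))\<^sup>2)"
    using fin by (simp add: integrable_iff_bounded sqn_def)
  show "sqn M f = ennreal (\<integral>x. (norm (f x))\<^sup>2 \<partial>M)"
    unfolding sqn_def by (rule nn_integral_eq_integral[OF i]) simp
qed

lemma sqn_add_finite:
  assumes "f \<in> borel_measurable M" "g \<in> borel_measurable M" "sqn M f < \<infinity>" "sqn M g < \<infinity>"
  shows "sqn M (\<lambda>x. f x + g x) < \<infinity>"
  using sqn_add_le[OF assms(1,2), of 1] assms(3,4)
  by (auto simp: ennreal_mult_less_top elim!: le_less_trans)

lemma sqn_cmult: "sqn M (\<lambda>x. c * f x) = ennreal ((norm c)\<^sup>2) * sqn M f" if [measurable]: "f \<in> borel_measurable M"
  unfolding sqn_def by (subst nn_integral_cmult[symmetric]) (auto simp: norm_mult power_mult_distrib ennreal_mult)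

text \<open>In the real variable \<open>c\<close> a quadratic polynomial with leading coefficient
  \<open>(norm b)\<^sup>2\<close>, hence fixed by its values at 0 and 1.\<close>

lemma norm_add_sq_expand:
  fixes a b :: complex and c :: real
  shows "(norm (a + c * b))\<^sup>2 = (1 - c) * (norm a)\<^sup>2 + c * (norm (a + b))\<^sup>2 + (c\<^sup>2 - c) * (norm b)\<^sup>2"
  unfolding cmod_power2 by (simp add: power2_eq_square algebra_simps)

lemma integral_sq_expand:
  fixes f g :: "'a \<Rightarrow> complex" and c :: real
  assumes m[measurable]: "f \<in> borel_measurable M" "g \<in> borel_measurable M" 
    and fin: "sqn M f < \<infinity>" "sqn M g < \<infinity>"
  shows "(\<integral>x. (norm (f x + c * g x))\<^sup>2 \<partial>M) = (1 - c) * (\<integral>x. (norm (f x))\<^sup>2 \<partial>M)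
     + c * (\<integral>x. (norm (f x + g x))\<^sup>2 \<partial>M) + (c\<^sup>2 - c) * (\<integral>x. (norm (g x))\<^sup>2 \<partial>M)"
proof -
  have i: "integrable M (\<lambda>x. (norm (f x))\<^sup>2)" "integrable M (\<lambda>x. (norm (g x))\<^sup>2)"
    "integrable M (\<lambda>x. (norm (f x + g x))\<^sup>2)"
    using sqn_finite_integrable(1)[OF m(1) fin(1)] sqn_finite_integrable(1)[OF m(2) fin(2)]
      sqn_finite_integrable(1)[OF _ sqn_add_finite[OF m fin]] by auto
  show ?thesis unfolding norm_add_sq_expand using i by simp
qed

text \<open>A single shift \<open>s\<close> moves all but a small part of \<open>h\<close> into \<open>\<Omega>\<close>, where the frame identity is
  available.\<close>

definition shiftable :: "'a::euclidean_space set \<Rightarrow> 'a set \<Rightarrow> bool" where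
  "shiftable X \<Omega> \<longleftrightarrow> (\<forall>h\<in>L2on X. \<exists>s. sqn lborel (\<lambda>y. if y + s \<in> \<Omega> then 0 else h y) \<le> ennreal (1 / 128) * sqn lborel h)"

lemma L2on_restrict:
  assumes h: "h \<in> L2on X" and [measurable]: "Measurable.pred borel P"
  shows "(\<lambda>y. if P y then h y else 0) \<in> L2on {y \<in> X. P y}"
proof -
  note [measurable] = L2onD(1)[OF h]
  have "sqn lborel (\<lambda>y. if P y then h y else 0) \<le> sqn lborel h"
    by (rule sqn_mono) simp
  then show ?thesis using L2onD(2,3)[OF h] by (auto simp: L2on_def elim: le_less_trans)
qed

text \<open>\<open>a\<close> and \<open>e\<close> are complementary restrictions of
  \<open>h\<close>, so their supports are disjoint and the last claim is Pythagoras for every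
  coefficient \<open>c\<close>. The frame identity holds for \<open>a\<close> because its support,
  moved by \<open>s\<close>, lies in \<open>\<Omega>\<close>.\<close>

lemma shift_decompose:
  fixes X :: "'a::euclidean_space set"
  assumes X[measurable]: "X \<in> sets borel" and Xfin: "emeasure lborel X < \<infinity>" and \<Omega>[measurable]: "\<Omega> \<in> sets borel"
    and fr: "frame_on \<Omega> \<mu> A" and sh: "shiftable X \<Omega>" and h: "h \<in> L2on X"
  obtains a e where "a \<in> L2on X" "e \<in> L2on X" "h = (\<lambda>y. a y + e y)"
    "sqn \<mu> (ft a) = ennreal A * sqn lborel a" "sqn lborel a \<le> sqn lborel h"
    "sqn lborel e \<le> ennreal (1 / 128) * sqn lborel h"
    "\<And>c. sqn lborel (\<lambda>y. a y + c * e y) = sqn lborel a + ennreal ((norm c)\<^sup>2) * sqn lborel e"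
proof -
  note hm[measurable] = L2onD(1)[OF h]
  obtain s where s: "sqn lborel (\<lambda>y. if y + s \<in> \<Omega> then 0 else h y) \<le> ennreal (1 / 128) * sqn lborel h"
    using sh h unfolding shiftable_def by blast
  define a where "a y = (if y + s \<in> \<Omega> then h y else 0)" for y
  define e where "e y = (if \<not> y + s \<in> \<Omega> then h y else 0)" for y
  have a1: "a \<in> L2on {y \<in> X. y + s \<in> \<Omega>}" and e1: "e \<in> L2on {y \<in> X. \<not> y + s \<in> \<Omega>}"
    unfolding a_def e_def by (rule L2on_restrict[OF h], measurable)+
  have a2: "a \<in> L2on {y. y + s \<in> \<Omega>}" using a1 L2on_mono[of "{y \<in> X. y + s \<in> \<Omega>}" "{y. y + s \<in> \<Omega>}"] by auto
  note [measurable] = L2onD(1)[OF a1] L2onD(1)[OF e1]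
  show ?thesis
  proof
    show "a \<in> L2on X" using a1 L2on_mono[of "{y \<in> X. y + s \<in> \<Omega>}" X] by auto
    show "e \<in> L2on X" using e1 L2on_mono[of "{y \<in> X. \<not> y + s \<in> \<Omega>}" X] by auto
    show "h = (\<lambda>y. a y + e y)" by (auto simp: a_def e_def)
    show "sqn \<mu> (ft a) = ennreal A * sqn lborel a"
      using frame_on_translate[OF fr, of s] a2 by (simp add: frame_on_def)
    show "sqn lborel a \<le> sqn lborel h" by (rule sqn_mono) (simp add: a_def)
    have "e = (\<lambda>y. if y + s \<in> \<Omega> then 0 else h y)" by (auto simp: e_def)
    then show "sqn lborel e \<le> ennreal (1 / 128) * sqn lborel h" using s by simp
    fix c
    have "sqn lborel (\<lambda>y. a y + c * e y) = (\<integral>\<^sup>+y. ennreal ((norm (a y))\<^sup>2) + ennreal ((norm (c * e y))\<^sup>2) \<partial>lborel)"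
      unfolding sqn_def by (intro nn_integral_cong) (auto simp: a_def e_def)
    also have "\<dots> = sqn lborel a + sqn lborel (\<lambda>y. c * e y)"
      unfolding sqn_def by (rule nn_integral_add) measurable
    finally show "sqn lborel (\<lambda>y. a y + c * e y) = sqn lborel a + ennreal ((norm c)\<^sup>2) * sqn lborel e"
      by (simp add: sqn_cmult)
  qed
qed

text \<open>\<open>\<nu>\<close> is a finite part of \<open>\<mu>\<close>. Finiteness provides some
  bound, written \<open>4 * A + D\<close>; each decomposition at least halves the excess over
  \<open>4 * A\<close>, so in the limit the bound no longer depends on \<open>\<nu>\<close>.\<close>

lemma bessel_finite:
  fixes X :: "'a::euclidean_space set"
  assumes X[measurable]: "X \<in> sets borel" and Xfin: "emeasure lborel X < \<infinity>" and \<Omega>[measurable]: "\<Omega> \<in> sets borel"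
    and \<nu>[measurable_cong]: "sets \<nu> = sets borel" and fin: "emeasure \<nu> UNIV < \<infinity>"
    and le: "\<And>f. f \<in> borel_measurable borel \<Longrightarrow> sqn \<nu> f \<le> sqn \<mu> f"
    and fr: "frame_on \<Omega> \<mu> A" and A: "A > 0" and sh: "shiftable X \<Omega>" and h: "h \<in> L2on X"
  shows "sqn \<nu> (ft h) \<le> ennreal (4 * A) * sqn lborel h"
proof -
  \<comment> \<open>At each frequency the transform is at most the L^1 norm, whose square is at most
    the measure of \<open>X\<close> times the squared L^2 norm; integration over
    \<open>\<nu>\<close> adds the factor \<open>emeasure \<nu> UNIV\<close>.\<close>
  define D where "D = enn2real (emeasure lborel X * emeasure \<nu> UNIV)"
  have Dfin: "emeasure lborel X * emeasure \<nu> UNIV < \<infinity>"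
    using Xfin fin by (simp add: ennreal_mult_less_top)
  have D: "ennreal D = emeasure lborel X * emeasure \<nu> UNIV" "D \<ge> 0"
    using Dfin by (auto simp: D_def)
  have sp: "space \<nu> = UNIV" using sets_eq_imp_space_eq[OF \<nu>] by simp
  have base: "sqn \<nu> (ft f) \<le> ennreal D * sqn lborel f" if f: "f \<in> L2on X" for f
  proof -
    have "sqn \<nu> (ft f) \<le> (\<integral>\<^sup>+\<xi>. emeasure lborel X * sqn lborel f \<partial>\<nu>)"
      unfolding sqn_def[of \<nu>]
    proof (rule nn_integral_mono)
      fix \<xi>
      have "ennreal ((norm (ft f \<xi>))\<^sup>2) \<le> ennreal ((\<integral>x. norm (f x) \<partial>lborel)\<^sup>2)"
        by (intro ennreal_leI power_mono norm_ft_le) simp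
      then show "ennreal ((norm (ft f \<xi>))\<^sup>2) \<le> emeasure lborel X * sqn lborel f"
        using L2on_integrable(2)[OF f X Xfin] by (rule order_trans)
    qed
    then show ?thesis by (simp add: sp D(1) mult_ac)
  qed
  have step: "sqn \<nu> (ft f) \<le> ennreal (4 * A + D / 2 ^ k) * sqn lborel f" if "f \<in> L2on X" for k f
    using that
  proof (induction k arbitrary: f)
    case 0
    have "ennreal D * sqn lborel f \<le> ennreal (4 * A + D) * sqn lborel f"
      using A by (intro mult_right_mono ennreal_leI) auto
    then show ?case using base[OF 0] by simp
  next
    case (Suc k)
    obtain a e where ae: "a \<in> L2on X" "e \<in> L2on X" "f = (\<lambda>y. a y + e y)"
      "sqn \<mu> (ft a) = ennreal A * sqn lborel a" "sqn lborel a \<le> sqn lborel f"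
      "sqn lborel e \<le> ennreal (1 / 128) * sqn lborel f"
      using shift_decompose[OF X Xfin \<Omega> fr sh Suc.prems] by blast
    note [measurable] = L2onD(1)[OF ae(1)] L2onD(1)[OF ae(2)]
    have 1: "sqn \<nu> (ft a) \<le> ennreal A * sqn lborel f"
    proof -
      have "sqn \<nu> (ft a) \<le> ennreal A * sqn lborel a" using le[of "ft a"] ae(4) by simp
      also have "\<dots> \<le> ennreal A * sqn lborel f" by (intro mult_left_mono ae) simp
      finally show ?thesis .
    qed
    have 2: "sqn \<nu> (ft e) \<le> ennreal ((4 * A + D / 2 ^ k) / 128) * sqn lborel f"
    proof -
      have "sqn \<nu> (ft e) \<le> ennreal (4 * A + D / 2 ^ k) * sqn lborel e" by (rule Suc.IH[OF ae(2)])
      also have "\<dots> \<le> ennreal (4 * A + D / 2 ^ k) * (ennreal (1 / 128) * sqn lborel f)"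
        by (intro mult_left_mono ae) simp
      also have "\<dots> = ennreal ((4 * A + D / 2 ^ k) * (1 / 128)) * sqn lborel f"
        using A D(2) by (subst ennreal_mult) (auto simp: mult.assoc)
      finally show ?thesis by simp
    qed
    have "ft f = (\<lambda>\<xi>. ft a \<xi> + ft e \<xi>)"
      unfolding ae(3) by (intro ext ft_add L2on_integrable(1)[OF _ X Xfin] ae)
    moreover have "ft a \<in> borel_measurable \<nu>" "ft e \<in> borel_measurable \<nu>" by measurable
    \<comment> \<open>Here \<open>\<eta> = 1\<close>: the good part contributes \<open>2 * A\<close>
      and the bad part 2/128 of the current bound, and \<open>2 * A + (4 * A + d) / 64\<close> is at
      most \<open>4 * A + d / 2\<close> for \<open>d = D / 2 ^ k\<close>.\<close>
    ultimately have "sqn \<nu> (ft f) \<le> ennreal 2 * sqn \<nu> (ft a) + ennreal 2 * sqn \<nu> (ft e)"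
      using sqn_add_le[of "ft a" \<nu> "ft e" 1] by simp
    also have "\<dots> \<le> ennreal 2 * (ennreal A * sqn lborel f) + ennreal 2 * (ennreal ((4 * A + D / 2 ^ k) / 128) * sqn lborel f)"
      by (intro add_mono mult_left_mono 1 2) auto
    also have "\<dots> = ennreal (2 * A + 2 * ((4 * A + D / 2 ^ k) / 128)) * sqn lborel f"
      using A D(2) by (simp add: ennreal_mult distrib_right mult.assoc del: ennreal_numeral times_divide_eq_right)
    also have "\<dots> \<le> ennreal (4 * A + D / 2 ^ Suc k) * sqn lborel f"
    proof (intro mult_right_mono ennreal_leI)
      have "D / 2 ^ k \<ge> 0" using D(2) by simp
      then show "2 * A + 2 * ((4 * A + D / 2 ^ k) / 128) \<le> 4 * A + D / 2 ^ Suc k"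
        using A by (simp add: field_simps)
    qed simp
    finally show ?case .
  qed
  have "(\<lambda>k. D / 2 ^ k) \<longlonglongrightarrow> 0" 
    using LIMSEQ_divide_realpow_zero[of 2 D] by simp
  then have "(\<lambda>k. 4 * A + D / 2 ^ k) \<longlonglongrightarrow> 4 * A + 0" by (intro tendsto_intros)
  then have "(\<lambda>k. sqn lborel h * ennreal (4 * A + D / 2 ^ k)) \<longlonglongrightarrow> sqn lborel h * ennreal (4 * A + 0)"
    using L2onD(3)[OF h] by (intro ennreal_tendsto_cmult tendsto_ennrealI) auto
  then have "sqn \<nu> (ft h) \<le> sqn lborel h * ennreal (4 * A + 0)"
    by (rule LIMSEQ_le_const) (use step[OF h] in \<open>auto simp: mult.commute\<close>)
  then show ?thesis by (simp add: mult.commute)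
qed

text \<open>Monotone convergence over balls, as the bound for the truncated measures does not depend
  on the radius.\<close>

lemma bessel:
  fixes X :: "'a::euclidean_space set"
  assumes X: "X \<in> sets borel" "emeasure lborel X < \<infinity>" and \<Omega>: "\<Omega> \<in> sets borel"
    and \<mu>[measurable_cong]: "sets \<mu> = sets borel" and fin: "\<And>n. emeasure \<mu> (ball 0 (real n)) < \<infinity>"
    and fr: "frame_on \<Omega> \<mu> A" and A: "A > 0" and sh: "shiftable X \<Omega>" and h: "h \<in> L2on X"
  shows "sqn \<mu> (ft h) \<le> ennreal (4 * A) * sqn lborel h"
proof -
  note [measurable] = L2onD(1)[OF h]
  define \<nu> where "\<nu> n = density \<mu> (indicator (ball 0 (real n)))" for n
  have s: "sqn (\<nu> n) f = (\<integral>\<^sup>+x. indicator (ball 0 (real n)) x * ennreal ((norm (f x))\<^sup>2) \<partial>\<mu>)"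
    if [measurable]: "f \<in> borel_measurable borel" for f n
    unfolding sqn_def \<nu>_def by (subst nn_integral_density) (auto intro!: borel_measurable_indicator simp: \<mu>)
  have le: "sqn (\<nu> n) (ft h) \<le> ennreal (4 * A) * sqn lborel h" for n
  proof (rule bessel_finite[OF X \<Omega> _ _ _ fr A sh h])
    show "sets (\<nu> n) = sets borel" by (simp add: \<nu>_def \<mu>)
    have "emeasure (\<nu> n) UNIV = emeasure \<mu> (ball 0 (real n))"
      unfolding \<nu>_def using sets_eq_imp_space_eq[OF \<mu>] by (subst emeasure_density) (auto intro!: borel_measurable_indicator simp: \<mu>)
    then show "emeasure (\<nu> n) UNIV < \<infinity>" using fin by simp
    show "sqn (\<nu> n) f \<le> sqn \<mu> f" if "f \<in> borel_measurable borel" for f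
      unfolding s[OF that] sqn_def[of \<mu>] by (intro nn_integral_mono) (auto simp: indicator_def)
  qed
  have "(\<lambda>n. sqn (\<nu> n) (ft h)) \<longlonglongrightarrow> sqn \<mu> (ft h)"
    unfolding s[OF ft_measurable[OF L2onD(1)[OF h]]] sqn_def[of \<mu>]
  proof (rule nn_integral_LIMSEQ)
    show "incseq (\<lambda>n x. indicator (ball 0 (real n)) x * ennreal ((norm (ft h x))\<^sup>2))"
      by (intro incseq_SucI le_funI mult_right_mono) (auto simp: indicator_def)
    show "(\<lambda>n. indicator (ball 0 (real n)) x * ennreal ((norm (ft h x))\<^sup>2)) \<longlonglongrightarrow> ennreal ((norm (ft h x))\<^sup>2)" for x :: 'a
    proof (rule tendsto_eventually)
      have "eventually (\<lambda>n. norm x < real n) sequentially"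
        using eventually_gt_at_top[of "nat \<lceil>norm x\<rceil>"] by eventually_elim linarith
      then show "\<forall>\<^sub>F n in sequentially. indicator (ball 0 (real n)) x * ennreal ((norm (ft h x))\<^sup>2) = ennreal ((norm (ft h x))\<^sup>2)"
        by eventually_elim simp
    qed
    have "(\<lambda>x. indicator (ball 0 (real n)) x * ennreal ((norm (ft h x))\<^sup>2)) \<in> borel_measurable borel" for n
      using ft_measurable[OF L2onD(1)[OF h]]
      by (intro borel_measurable_times_ennreal borel_measurable_indicator) auto
    then show "(\<lambda>x. indicator (ball 0 (real n)) x * ennreal ((norm (ft h x))\<^sup>2)) \<in> borel_measurable \<mu>" for n
      using measurable_cong_sets[OF \<mu> refl] by blast
  qed
  then show ?thesis by (rule LIMSEQ_le_const2) (use le in auto)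
qed

text \<open>By \<open>bessel\<close> both quadratic forms are finite, so the defect
  \<open>Q h - A * N h\<close> is meaningful as a real number. Its bound relative to
  \<open>N h\<close> is halved in each step of the induction on \<open>k\<close>, starting from
  \<open>4 * A\<close>.\<close>

lemma frame_on_shiftable:
  fixes X :: "'a::euclidean_space set"
  assumes X: "X \<in> sets borel" "emeasure lborel X < \<infinity>" and \<Omega>: "\<Omega> \<in> sets borel"
    and \<mu>[measurable_cong]: "sets \<mu> = sets borel" and fin: "\<And>n. emeasure \<mu> (ball 0 (real n)) < \<infinity>"
    and fr: "frame_on \<Omega> \<mu> A" and A: "A > 0" and sh: "shiftable X \<Omega>"
  shows "frame_on X \<mu> A"
proof -
  define N where "N h = (\<integral>x. (norm (h x))\<^sup>2 \<partial>lborel)" for h :: "'a \<Rightarrow> complex"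
  define Q where "Q h = (\<integral>x. (norm (ft h x))\<^sup>2 \<partial>\<mu>)" for h
  have N: "sqn lborel h = ennreal (N h)" "N h \<ge> 0" if "h \<in> L2on X" for h
    using sqn_finite_integrable(2)[of h lborel] L2onD(1,3)[OF that] by (auto simp: N_def)
  have ftm: "ft h \<in> borel_measurable \<mu>" if "h \<in> L2on X" for h
    using ft_measurable[OF L2onD(1)[OF that]] measurable_cong_sets[OF \<mu> refl] by blast
  have Qfin: "sqn \<mu> (ft h) < \<infinity>" if h: "h \<in> L2on X" for h
    using bessel[OF X \<Omega> \<mu> fin fr A sh h] L2onD(3)[OF h] 
    by (auto simp: ennreal_mult_less_top elim!: le_less_trans)
  have Q: "sqn \<mu> (ft h) = ennreal (Q h)" "Q h \<ge> 0" if h: "h \<in> L2on X" for h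
    using sqn_finite_integrable(2)[OF ftm[OF h] Qfin[OF h]] by (auto simp: Q_def)
  have QN: "Q h \<le> 4 * A * N h" if h: "h \<in> L2on X" for h
    using bessel[OF X \<Omega> \<mu> fin fr A sh h] A Q[OF h] N[OF h] by (simp flip: ennreal_mult)
  have step: "\<bar>Q h - A * N h\<bar> \<le> (4 * A / 2 ^ k) * N h" if "h \<in> L2on X" for h k
    using that
  proof (induction k arbitrary: h)
    case 0
    \<comment> \<open>\<open>Q h\<close> and \<open>A * N h\<close> both lie between 0 and
      \<open>4 * A * N h\<close>, which bounds their distance.\<close>
    have "A * N h \<le> 4 * A * N h" using A N(2)[OF 0] by simp
    moreover have "0 \<le> A * N h" using A N(2)[OF 0] by simp
    ultimately show ?case using QN[OF 0] Q(2)[OF 0] by simp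
  next
    case (Suc k)
    note h = Suc.prems
    obtain a e where ae: "a \<in> L2on X" "e \<in> L2on X" "h = (\<lambda>y. a y + e y)"
      "sqn \<mu> (ft a) = ennreal A * sqn lborel a" "sqn lborel a \<le> sqn lborel h"
      "sqn lborel e \<le> ennreal (1 / 128) * sqn lborel h"
      "\<And>c. sqn lborel (\<lambda>y. a y + c * e y) = sqn lborel a + ennreal ((norm c)\<^sup>2) * sqn lborel e"
      using shift_decompose[OF X \<Omega> fr sh h] by blast
    note [measurable] = L2onD(1)[OF ae(1)] L2onD(1)[OF ae(2)]
    (* As Q a = A * N a, the value of the defect Q - A * N at a + c e determines c times its value at a + e = h
       up to a multiple of its value at e. Since N e is tiny, c = 8 gains the factor 1/2. *)
    define b where "b y = a y + of_real 8 * e y" for y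
    have bN: "sqn lborel b = sqn lborel a + 64 * sqn lborel e"
      using ae(7)[of "of_real 8"] by (simp add: b_def[abs_def])
    have b: "b \<in> L2on X"
      unfolding L2on_def
    proof (intro CollectI conjI allI impI)
      show "b \<in> borel_measurable borel" unfolding b_def by measurable
      show "b x = 0" if "x \<notin> X" for x using L2onD(2)[OF ae(1) that] L2onD(2)[OF ae(2) that] by (simp add: b_def)
      show "sqn lborel b < \<infinity>" unfolding bN using L2onD(3)[OF ae(1)] L2onD(3)[OF ae(2)]
        by (simp add: ennreal_mult_less_top)
    qed
    have Qa: "Q a = A * N a"
      using ae(4) Q[OF ae(1)] N[OF ae(1)] A by (simp flip: ennreal_mult)
    have Nle: "N a \<le> N h" "N e \<le> N h / 128"
      using ae(5,6) N[OF ae(1)] N[OF ae(2)] N[OF h] by (auto simp flip: ennreal_mult)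
    have i: "integrable lborel f" if "f \<in> L2on X" for f using L2on_integrable(1)[OF that X] .
    have fth: "ft h = (\<lambda>\<xi>. ft a \<xi> + ft e \<xi>)"
      unfolding ae(3) by (intro ext ft_add i ae)
    have ftb: "ft b = (\<lambda>\<xi>. ft a \<xi> + of_real 8 * ft e \<xi>)"
      unfolding b_def[abs_def] using i[OF ae(1)] i[OF ae(2)] by (intro ext) (subst ft_add; simp add: ft_cmult)
    have Qb: "Q b = - 7 * Q a + 8 * Q h + 56 * Q e"
      unfolding Q_def ftb fth
      using integral_sq_expand[OF ftm[OF ae(1)] ftm[OF ae(2)] Qfin[OF ae(1)] Qfin[OF ae(2)], of 8]
      by (simp add: power2_eq_square)
    \<comment> \<open>The same expansion as for \<open>Q b\<close>, needed to form the defect;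
      \<open>Nb'\<close> computes \<open>N b\<close> a second time, from the disjoint supports, in
      order to bound it.\<close>
    have Nb: "N b = - 7 * N a + 8 * N h + 56 * N e"
      unfolding N_def b_def ae(3)
      using integral_sq_expand[of a lborel e 8] L2onD(3)[OF ae(1)] L2onD(3)[OF ae(2)]
      by (simp add: power2_eq_square)
    have Nb': "N b = N a + 64 * N e"
    proof -
      have "ennreal (N b) = ennreal (N a + 64 * N e)"
        using bN N[OF b] N[OF ae(1)] N[OF ae(2)] by (simp add: ennreal_mult)
      then show ?thesis using N[OF b] N[OF ae(1)] N[OF ae(2)] by (subst (asm) ennreal_inj) auto
    qed
    define m where "m = 4 * A / 2 ^ k"
    have m: "m \<ge> 0" using A by (simp add: m_def)
    have Db: "\<bar>Q b - A * N b\<bar> \<le> m * N b" and De: "\<bar>Q e - A * N e\<bar> \<le> m * N e"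
      using Suc.IH[OF b] Suc.IH[OF ae(2)] by (simp_all add: m_def)
    have "8 * (Q h - A * N h) = (Q b - A * N b) - 56 * (Q e - A * N e)"
    proof -
      have "A * N b = - 7 * (A * N a) + 8 * (A * N h) + 56 * (A * N e)"
        by (simp add: Nb algebra_simps)
      then show ?thesis using Qb Qa by (simp add: right_diff_distrib)
    qed
    then have "8 * \<bar>Q h - A * N h\<bar> \<le> m * N b + 56 * (m * N e)"
    proof -
      have "8 * \<bar>x\<bar> \<le> p + 56 * q" if "8 * x = y - 56 * z" "\<bar>y\<bar> \<le> p" "\<bar>z\<bar> \<le> q" for x y z p q :: real
        using that by linarith
      then show ?thesis using Db De \<open>8 * (Q h - A * N h) = _\<close> by blast
    qed
    \<comment> \<open>64 comes from \<open>N b\<close> and 56 from the term at \<open>e\<close>. As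
      \<open>N e\<close> is at most \<open>N h / 128\<close>, the bracket is even at most
      \<open>2 * N h\<close>.\<close>
    also have "\<dots> = m * (N a + 120 * N e)" by (simp add: Nb' algebra_simps)
    also have "\<dots> \<le> m * (4 * N h)"
      using Nle m N[OF h] by (intro mult_left_mono) auto
    finally have "\<bar>Q h - A * N h\<bar> \<le> m / 2 * N h" by simp
    then show ?case by (simp add: m_def)
  qed
  have "Q h = A * N h" if h: "h \<in> L2on X" for h
  proof -
    have "(\<lambda>k. 4 * A / 2 ^ k) \<longlonglongrightarrow> 0" 
      using LIMSEQ_divide_realpow_zero[of 2 "4 * A"] by simp
    then have "(\<lambda>k. (4 * A / 2 ^ k) * N h) \<longlonglongrightarrow> 0 * N h" by (intro tendsto_intros)
    then have "\<bar>Q h - A * N h\<bar> \<le> 0 * N h"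
      by (rule LIMSEQ_le_const) (use step[OF h] in auto)
    then show ?thesis by simp
  qed
  then show ?thesis
    unfolding frame_on_def using Q N A by (simp add: ennreal_mult)
qed

section \<open>From small balls to bounded sets\<close>

text \<open>A square contains products of at most two of the summands, so three summands reduce to
  pairs.\<close>

lemma norm_add3_sq:
  fixes a b c :: complex
  shows "(norm (a + b + c))\<^sup>2 = (norm (a + b))\<^sup>2 + (norm (b + c))\<^sup>2 + (norm (a + c))\<^sup>2
    - (norm a)\<^sup>2 - (norm b)\<^sup>2 - (norm c)\<^sup>2"
  unfolding cmod_power2 by (simp add: power2_eq_square algebra_simps)

lemma integral_sq_add3:
  fixes a b c :: "'a \<Rightarrow> complex"
  assumes m: "a \<in> borel_measurable M" "b \<in> borel_measurable M" "c \<in> borel_measurable M" 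
    and fin: "sqn M a < \<infinity>" "sqn M b < \<infinity>" "sqn M c < \<infinity>"
  shows "(\<integral>x. (norm (a x + b x + c x))\<^sup>2 \<partial>M) = (\<integral>x. (norm (a x + b x))\<^sup>2 \<partial>M) + (\<integral>x. (norm (b x + c x))\<^sup>2 \<partial>M)
    + (\<integral>x. (norm (a x + c x))\<^sup>2 \<partial>M) - (\<integral>x. (norm (a x))\<^sup>2 \<partial>M) - (\<integral>x. (norm (b x))\<^sup>2 \<partial>M) - (\<integral>x. (norm (c x))\<^sup>2 \<partial>M)"
proof -
  note i1 = sqn_finite_integrable(1)[OF m(1) fin(1)] sqn_finite_integrable(1)[OF m(2) fin(2)]
    sqn_finite_integrable(1)[OF m(3) fin(3)]
  note i2 = sqn_finite_integrable(1)[OF borel_measurable_add[OF m(1,2)] sqn_add_finite[OF m(1,2) fin(1,2)]]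
    sqn_finite_integrable(1)[OF borel_measurable_add[OF m(2,3)] sqn_add_finite[OF m(2,3) fin(2,3)]]
    sqn_finite_integrable(1)[OF borel_measurable_add[OF m(1,3)] sqn_add_finite[OF m(1,3) fin(1,3)]]
  show ?thesis unfolding norm_add3_sq using i1 i2 by simp
qed

lemma frame_on_Un3:
  fixes X Y Z :: "'a::euclidean_space set"
  assumes [measurable]: "X \<in> sets borel" "Y \<in> sets borel" "Z \<in> sets borel"
    and fin: "emeasure lborel X < \<infinity>" "emeasure lborel Y < \<infinity>" "emeasure lborel Z < \<infinity>"
    and \<mu>: "sets \<mu> = sets borel" and A: "A > 0"
    and XY: "frame_on (X \<union> Y) \<mu> A" and YZ: "frame_on (Y \<union> Z) \<mu> A" and XZ: "frame_on (X \<union> Z) \<mu> A"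
  shows "frame_on (X \<union> Y \<union> Z) \<mu> A"
  unfolding frame_on_def
proof
  fix h assume h: "h \<in> L2on (X \<union> Y \<union> Z)"
  note hm[measurable] = L2onD(1)[OF h]
  \<comment> \<open>Disjoint pieces although \<open>X\<close>, \<open>Y\<close>, \<open>Z\<close>
    may overlap: a sum of two pieces is then again a restriction of \<open>h\<close>, supported in
    the union of two of the sets.\<close>
  define a where "a x = (if x \<in> X then h x else 0)" for x
  define b where "b x = (if x \<in> Y - X then h x else 0)" for x
  define c where "c x = (if x \<in> Z - X - Y then h x else 0)" for x
  have r: "(\<lambda>x. if P x then h x else 0) \<in> L2on W" if "Measurable.pred borel P" "{x. P x} \<subseteq> W" for P W
    using L2on_restrict[OF h that(1)] L2on_mono[of "{y \<in> X \<union> Y \<union> Z. P y}" W] that(2) by auto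
  have a: "a \<in> L2on X" and b: "b \<in> L2on Y" and c: "c \<in> L2on Z"
    unfolding a_def b_def c_def by (rule r; measurable; auto)+
  have ab: "(\<lambda>x. a x + b x) \<in> L2on (X \<union> Y)"
  proof -
    have "(\<lambda>x. a x + b x) = (\<lambda>x. if x \<in> X \<union> Y then h x else 0)" by (auto simp: a_def b_def)
    then show ?thesis by (simp only:) (rule r; measurable; auto)
  qed
  have bc: "(\<lambda>x. b x + c x) \<in> L2on (Y \<union> Z)"
  proof -
    have "(\<lambda>x. b x + c x) = (\<lambda>x. if x \<in> (Y \<union> Z) - X then h x else 0)" by (auto simp: b_def c_def)
    then show ?thesis by (simp only:) (rule r; measurable; auto)
  qed
  have ac: "(\<lambda>x. a x + c x) \<in> L2on (X \<union> Z)"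
  proof -
    have "(\<lambda>x. a x + c x) = (\<lambda>x. if x \<in> X \<union> (Z - X - Y) then h x else 0)" by (auto simp: a_def c_def)
    then show ?thesis by (simp only:) (rule r; measurable; auto)
  qed
  have habc: "h = (\<lambda>x. a x + b x + c x)"
    using L2onD(2)[OF h] by (auto simp: a_def b_def c_def)
  note am = L2onD(1)[OF a] L2onD(1)[OF b] L2onD(1)[OF c]
  have ftm: "ft f \<in> borel_measurable \<mu>" if "f \<in> borel_measurable borel" for f :: "'a \<Rightarrow> complex"
    using ft_measurable[OF that] measurable_cong_sets[OF \<mu> refl] by blast
  have i: "integrable lborel a" "integrable lborel b" "integrable lborel c"
    using L2on_integrable(1)[OF a] L2on_integrable(1)[OF b] L2on_integrable(1)[OF c] fin by auto
  define N where "N f = (\<integral>x. (norm (f x))\<^sup>2 \<partial>lborel)" for f :: "'a \<Rightarrow> complex"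
  define Q where "Q f = (\<integral>x. (norm (ft f x))\<^sup>2 \<partial>\<mu>)" for f
  have fr: "sqn \<mu> (ft f) < \<infinity> \<and> Q f = A * N f" if "f \<in> L2on W" "frame_on W \<mu> A" for f W
  proof -
    have eq: "sqn \<mu> (ft f) = ennreal A * sqn lborel f" using that by (simp add: frame_on_def)
    then have f: "sqn \<mu> (ft f) < \<infinity>" using L2onD(3)[OF that(1)] by (simp add: ennreal_mult_less_top)
    have "sqn \<mu> (ft f) = ennreal (Q f)" "sqn lborel f = ennreal (N f)"
      unfolding Q_def N_def using sqn_finite_integrable(2)[OF ftm[OF L2onD(1)[OF that(1)]] f]
        sqn_finite_integrable(2)[of f lborel] L2onD(1,3)[OF that(1)] by auto
    moreover have "Q f \<ge> 0" "N f \<ge> 0" by (auto simp: Q_def N_def)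
    ultimately show ?thesis using eq f A by (simp flip: ennreal_mult)
  qed
  note fa = fr[OF a frame_on_mono[OF XY]] and fb = fr[OF b frame_on_mono[OF XY]] and fc = fr[OF c frame_on_mono[OF YZ]]
  note fab = fr[OF ab XY] and fbc = fr[OF bc YZ] and fac = fr[OF ac XZ]
  have ftab: "ft (\<lambda>x. a x + b x) = (\<lambda>\<xi>. ft a \<xi> + ft b \<xi>)" "ft (\<lambda>x. b x + c x) = (\<lambda>\<xi>. ft b \<xi> + ft c \<xi>)"
    "ft (\<lambda>x. a x + c x) = (\<lambda>\<xi>. ft a \<xi> + ft c \<xi>)" and fth: "ft h = (\<lambda>\<xi>. ft a \<xi> + ft b \<xi> + ft c \<xi>)"
    unfolding habc using i by (auto intro!: ext simp: ft_add)
  have Qh: "Q h = Q (\<lambda>x. a x + b x) + Q (\<lambda>x. b x + c x) + Q (\<lambda>x. a x + c x) - Q a - Q b - Q c"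
    unfolding Q_def ftab fth using fa fb fc by (intro integral_sq_add3 ftm am) auto
  have Nh: "N h = N (\<lambda>x. a x + b x) + N (\<lambda>x. b x + c x) + N (\<lambda>x. a x + c x) - N a - N b - N c"
    unfolding N_def by (subst habc, intro integral_sq_add3) (use am L2onD(3)[OF a] L2onD(3)[OF b] L2onD(3)[OF c] in auto)
  have "Q h = A * N h"
    unfolding Qh Nh using fa fb fc fab fbc fac by (simp add: algebra_simps)
  moreover have "sqn \<mu> (ft h) < \<infinity>"
    unfolding fth using fa fb fc by (intro sqn_add_finite borel_measurable_add ftm am) auto
  then have "sqn \<mu> (ft h) = ennreal (Q h)"
    unfolding Q_def by (intro sqn_finite_integrable(2) ftm hm)
  moreover have "sqn lborel h = ennreal (N h)"
    unfolding N_def using L2onD(1,3)[OF h] by (intro sqn_finite_integrable(2)) auto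
  moreover have "N h \<ge> 0" by (simp add: N_def)
  ultimately show "sqn \<mu> (ft h) = ennreal A * sqn lborel h"
    using A by (simp add: ennreal_mult)
qed

lemma frame_on_UN:
  fixes B :: "'i \<Rightarrow> 'a::euclidean_space set"
  assumes "finite I" and B: "\<And>i. i \<in> I \<Longrightarrow> B i \<in> sets borel" "\<And>i. i \<in> I \<Longrightarrow> emeasure lborel (B i) < \<infinity>"
    and \<mu>: "sets \<mu> = sets borel" and A: "A > 0"
    and pair: "\<And>i j. i \<in> I \<Longrightarrow> j \<in> I \<Longrightarrow> frame_on (B i \<union> B j) \<mu> A"
  shows "frame_on (\<Union>i\<in>I. B i) \<mu> A"
proof -
  have fin: "emeasure lborel (\<Union>i\<in>J. B i) < \<infinity>" if "J \<subseteq> I" for J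
  proof -
    have J: "finite J" using that \<open>finite I\<close> finite_subset by blast
    have "emeasure lborel (\<Union>i\<in>J. B i) \<le> (\<Sum>i\<in>J. emeasure lborel (B i))"
      using J that B(1) by (intro emeasure_subadditive_finite) auto
    also have "\<dots> < \<infinity>" using J that B(2) by auto
    finally show ?thesis .
  qed
  \<comment> \<open>The additional set \<open>B j\<close> makes the induction close: to insert
    \<open>k\<close>, the three pairwise unions among the union over \<open>J\<close>,
    \<open>B k\<close> and \<open>B j\<close> are needed, two of which are instances of the
    induction hypothesis.\<close>
  have main: "frame_on ((\<Union>i\<in>J. B i) \<union> B j) \<mu> A" if "finite J" "J \<subseteq> I" "j \<in> I" for J j
    using that
  proof (induction J arbitrary: j rule: finite_induct)
    case empty
    then show ?case using pair[of j j] by simp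
  next
    case (insert k J)
    have "frame_on ((\<Union>i\<in>J. B i) \<union> B k \<union> B j) \<mu> A"
    proof (rule frame_on_Un3)
      show "(\<Union>i\<in>J. B i) \<in> sets borel" using insert B(1) by (intro sets.finite_UN) auto
    qed (use insert B fin[of J] \<mu> A pair in auto)
    moreover have "(\<Union>i\<in>J. B i) \<union> B k \<union> B j = (\<Union>i\<in>insert k J. B i) \<union> B j" by blast
    ultimately show ?case by simp
  qed
  show ?thesis
  proof (cases "I = {}")
    case True
    have "sqn \<mu> (ft h) = ennreal A * sqn lborel h" if "h \<in> L2on {}" for h
    proof -
      have "h = (\<lambda>_. 0)" using L2onD(2)[OF that] by auto
      then show ?thesis by (simp add: sqn_def ft_def)
    qed
    then show ?thesis using True by (simp add: frame_on_def)
  next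
    case False
    then obtain j where "j \<in> I" by blast
    then have "frame_on ((\<Union>i\<in>I. B i) \<union> B j) \<mu> A"
      by (intro main[OF \<open>finite I\<close> subset_refl])
    then show ?thesis by (rule frame_on_mono) blast
  qed
qed

text \<open>Among the \<open>s\<close> that move both \<open>p\<close> and \<open>q\<close> into
  \<open>\<Omega>\<close>, those that move a nearby \<open>y\<close> outside have measure at most
  the L^1 distance of two translates of the indicator. This is small compared with the overlap,
  which is positive and continuous in \<open>q - p\<close>, hence bounded below on a compact
  ball.\<close>

lemma uniformly_shiftable:
  fixes \<Omega> :: "'a::euclidean_space set"
  assumes \<Omega>[measurable]: "\<Omega> \<in> sets borel" and fin: "emeasure lborel \<Omega> < \<infinity>"
    and pos: "\<And>t. emeasure lborel {x \<in> \<Omega>. x + t \<in> \<Omega>} > 0"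
  shows "\<exists>r>0. \<forall>p q. dist p q \<le> R \<longrightarrow> shiftable (ball p r \<union> ball q r) \<Omega>"
proof -
  \<comment> \<open>How far the indicator of \<open>\<Omega>\<close> moves in L^1 under a shift; it
    serves as a modulus of continuity for the overlap \<open>\<phi>\<close>.\<close>
  define \<kappa> where "\<kappa> v = (\<integral>x. \<bar>indicat_real \<Omega> (x + v) - indicator \<Omega> x\<bar> \<partial>lborel)" for v
  define \<phi> where "\<phi> t = measure lborel {x \<in> \<Omega>. x + t \<in> \<Omega>}" for t
  have iO: "integrable lborel (indicat_real \<Omega>)" using fin by (intro integrable_real_indicator) auto
  note iOt = integrable_lborel_translate[OF iO]
  have iP: "integrable lborel (\<lambda>x. indicat_real \<Omega> x * indicator \<Omega> (x + t))" for t
    by (rule Bochner_Integration.integrable_bound[OF iO]) (auto simp: indicator_def)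
  have k0: "\<kappa> \<midarrow>0\<rightarrow> 0"
    using L1_translation_continuous[OF iO] by (simp add: \<kappa>_def[abs_def])
  have kdiff: "(\<integral>x. \<bar>indicat_real \<Omega> (x + s) - indicator \<Omega> (x + t)\<bar> \<partial>lborel) = \<kappa> (s - t)" for s t
  proof -
    have "(\<integral>x. \<bar>indicat_real \<Omega> (x + s) - indicator \<Omega> (x + t)\<bar> \<partial>lborel)
      = (\<integral>x. \<bar>indicat_real \<Omega> (x + t + (s - t)) - indicator \<Omega> (x + t)\<bar> \<partial>lborel)"
      by (simp add: algebra_simps)
    also have "\<dots> = \<kappa> (s - t)"
      unfolding \<kappa>_def by (rule integral_lborel_translate[where f="\<lambda>x. \<bar>indicat_real \<Omega> (x + (s - t)) - indicator \<Omega> x\<bar>"]) measurable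
    finally show ?thesis .
  qed
  have phi_int: "\<phi> t = (\<integral>x. indicator \<Omega> x * indicator \<Omega> (x + t) \<partial>lborel)" for t
  proof -
    have "(\<integral>x. indicator \<Omega> x * indicator \<Omega> (x + t) \<partial>lborel) = (\<integral>x. indicat_real {x \<in> \<Omega>. x + t \<in> \<Omega>} x \<partial>lborel)"
      by (intro Bochner_Integration.integral_cong) (auto simp: indicator_def)
    also have "\<dots> = \<phi> t" by (simp add: \<phi>_def)
    finally show ?thesis by simp
  qed
  have emP: "emeasure lborel {x \<in> \<Omega>. x + t \<in> \<Omega>} = ennreal (\<phi> t)" for t
  proof -
    have "emeasure lborel {x \<in> \<Omega>. x + t \<in> \<Omega>} \<le> emeasure lborel \<Omega>" by (rule emeasure_mono) auto
    then show ?thesis using fin unfolding \<phi>_def by (intro emeasure_eq_ennreal_measure) auto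
  qed
  have phi_pos: "\<phi> t > 0" for t using pos[of t] emP[of t] by simp
  have phi_lip: "\<bar>\<phi> s - \<phi> t\<bar> \<le> \<kappa> (s - t)" for s t
  proof -
    have "\<phi> s - \<phi> t = (\<integral>x. indicator \<Omega> x * indicator \<Omega> (x + s) - indicator \<Omega> x * indicator \<Omega> (x + t) \<partial>lborel)"
      unfolding phi_int using iP[of s] iP[of t] by simp
    also have "\<bar>\<dots>\<bar> \<le> (\<integral>x. \<bar>indicat_real \<Omega> (x + s) - indicator \<Omega> (x + t)\<bar> \<partial>lborel)"
      unfolding real_norm_def[symmetric]
      by (rule Bochner_Integration.integral_norm_bound_integral)
         (use iP[of s] iP[of t] iOt[of s] iOt[of t] in \<open>auto simp: indicator_def\<close>)
    finally show ?thesis by (simp add: kdiff)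
  qed
  have cont: "continuous_on (cball 0 R) \<phi>"
  proof (intro continuous_at_imp_continuous_on ballI)
    fix t
    have "((\<lambda>s. \<phi> (t + s) - \<phi> t) \<longlongrightarrow> 0) (at 0)"
      by (rule Lim_null_comparison[OF always_eventually k0]) (use phi_lip[of "t + _" t] in auto)
    then have "((\<lambda>s. \<phi> (t + s)) \<longlongrightarrow> \<phi> t) (at 0)" by (rule LIM_zero_cancel)
    then show "isCont \<phi> t" by (simp add: isCont_iff)
  qed
  obtain m where m: "m > 0" "\<And>t. norm t \<le> R \<Longrightarrow> m \<le> \<phi> t"
  proof (cases "cball (0::'a) R = {}")
    case True
    then have "R < 0" by simp
    then have "\<not> norm t \<le> R" for t :: 'a using norm_ge_zero[of t] by linarith
    then show ?thesis using that[of 1] by simp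
  next
    case False
    obtain t0 where "t0 \<in> cball 0 R" "\<And>t. t \<in> cball 0 R \<Longrightarrow> \<phi> t0 \<le> \<phi> t"
      using continuous_attains_inf[OF compact_cball False cont] by blast
    then show ?thesis using that[of "\<phi> t0"] phi_pos by (simp add: mem_cball)
  qed
  \<comment> \<open>1/256 is half of the 1/128 in \<open>shiftable\<close>, because
    \<open>good_shift\<close> loses a factor 2.\<close>
  obtain r where r: "r > 0" "\<And>v. v \<noteq> 0 \<Longrightarrow> norm v < r \<Longrightarrow> \<kappa> v < m / 256"
  proof -
    obtain s where s: "s > 0" "\<And>v. v \<noteq> 0 \<Longrightarrow> norm v < s \<Longrightarrow> \<bar>\<kappa> v\<bar> < m / 256"
      using LIM_D[OF k0, of "m / 256"] m(1) by auto
    then show ?thesis using that[OF s(1)] abs_ge_self le_less_trans by blast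
  qed
  have k: "\<kappa> v \<le> m / 256" if "norm v < r" for v
    using r(2)[of v] that m(1) by (cases "v = 0") (auto simp: \<kappa>_def less_imp_le)
  have "shiftable (ball p r \<union> ball q r) \<Omega>" if pq: "dist p q \<le> R" for p q
  proof -
    define G where "G = {s. p + s \<in> \<Omega> \<and> q + s \<in> \<Omega>}"
    have [measurable]: "G \<in> sets borel" unfolding G_def by measurable
    have "G = {s. s + p \<in> {x \<in> \<Omega>. x + (q - p) \<in> \<Omega>}}"
      by (auto simp: G_def add.commute algebra_simps)
    then have "emeasure lborel G = emeasure lborel {x \<in> \<Omega>. x + (q - p) \<in> \<Omega>}"
      by (simp only:) (rule emeasure_lborel_translate, measurable)
    then have G: "emeasure lborel G = ennreal (\<phi> (q - p))" using emP by simp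
    have mG: "m \<le> \<phi> (q - p)" using pq by (intro m) (simp add: dist_norm norm_minus_commute)
    have near: "emeasure lborel {s \<in> G. y + s \<notin> \<Omega>} \<le> ennreal (1 / 256) * emeasure lborel G"
      if z: "z = p \<or> z = q" and y: "dist z y < r" for z y
    proof -
      have "emeasure lborel {s \<in> G. y + s \<notin> \<Omega>} = (\<integral>\<^sup>+s. indicator {s \<in> G. y + s \<notin> \<Omega>} s \<partial>lborel)"
        by (subst nn_integral_indicator) auto
      \<comment> \<open>For \<open>s\<close> in \<open>G\<close> the point \<open>z + s\<close> lies
        in \<open>\<Omega>\<close>; if \<open>y + s\<close> does not, the two indicators differ by
        1.\<close>
      also have "\<dots> \<le> (\<integral>\<^sup>+s. ennreal \<bar>indicat_real \<Omega> (s + z) - indicator \<Omega> (s + y)\<bar> \<partial>lborel)"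
        using z by (intro nn_integral_mono) (auto simp: indicator_def G_def add.commute)
      also have "\<dots> = ennreal (\<integral>s. \<bar>indicat_real \<Omega> (s + z) - indicator \<Omega> (s + y)\<bar> \<partial>lborel)"
        using iOt[of z] iOt[of y] by (intro nn_integral_eq_integral integrable_abs Bochner_Integration.integrable_diff) auto
      also have "\<dots> = ennreal (\<kappa> (z - y))" by (simp add: kdiff)
      also have "\<dots> \<le> ennreal (m / 256)" using y by (intro ennreal_leI k) (simp add: dist_norm)
      also have "\<dots> \<le> ennreal (1 / 256 * \<phi> (q - p))" using mG by (intro ennreal_leI) simp
      also have "\<dots> = ennreal (1 / 256) * emeasure lborel G" unfolding G by (rule ennreal_mult) (use phi_pos[of "q - p"] in auto)
      finally show ?thesis .
    qed
    show ?thesis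
      unfolding shiftable_def
    proof
      fix h assume h: "h \<in> L2on (ball p r \<union> ball q r)"
      have "\<exists>s. sqn lborel (\<lambda>y. if y + s \<in> \<Omega> then 0 else h y) \<le> ennreal (2 * (1 / 256)) * sqn lborel h"
        by (rule good_shift[OF _ \<Omega> _ _ _ _ h, of G]) (use G phi_pos[of "q - p"] near in auto)
      then show "\<exists>s. sqn lborel (\<lambda>y. if y + s \<in> \<Omega> then 0 else h y) \<le> ennreal (1 / 128) * sqn lborel h"
        by simp
    qed
  qed
  then show ?thesis using r(1) by blast
qed

text \<open>Finitely many balls of one radius \<open>r\<close> cover the compact ball around 0.
  Their centres are at distance at most \<open>2 * R\<close>, so \<open>r\<close> serves every pair
  of them, and pairs suffice by \<open>frame_on_UN\<close>.\<close>

lemma frame_on_bounded: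
  fixes \<Omega> :: "'a::euclidean_space set"
  assumes \<Omega>: "\<Omega> \<in> sets borel" "emeasure lborel \<Omega> < \<infinity>"
    and pos: "\<And>t. emeasure lborel {x \<in> \<Omega>. x + t \<in> \<Omega>} > 0"
    and \<mu>: "sets \<mu> = sets borel" and fin: "\<And>n. emeasure \<mu> (ball 0 (real n)) < \<infinity>"
    and fr: "frame_on \<Omega> \<mu> A" and A: "A > 0" and X: "bounded X"
  shows "frame_on X \<mu> A"
proof -
  obtain R where R: "X \<subseteq> cball 0 R" using X by (auto simp: bounded_iff subset_iff)
  obtain r where r: "r > 0" "\<And>p q. dist p q \<le> 2 * R \<Longrightarrow> shiftable (ball p r \<union> ball q r) \<Omega>"
    using uniformly_shiftable[OF \<Omega> pos, of "2 * R"] by blast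
  obtain C where C: "C \<subseteq> cball (0::'a) R" "finite C" "cball 0 R \<subseteq> (\<Union>c\<in>C. ball c r)"
  proof (rule compactE_image[OF compact_cball[of "0::'a" R], of "cball 0 R" "\<lambda>c. ball c r"])
    show "cball 0 R \<subseteq> (\<Union>c\<in>cball (0::'a) R. ball c r)"
      by (intro subsetI UN_I) (use r(1) in auto)
  qed auto
  have b: "emeasure lborel (ball c r \<union> ball d r) < \<infinity>" for c d :: 'a
    using emeasure_subadditive[of "ball c r" lborel "ball d r"] emeasure_lborel_ball_finite[of c r] emeasure_lborel_ball_finite[of d r]
    by (auto simp: elim!: le_less_trans)
  have "frame_on (\<Union>c\<in>C. ball c r) \<mu> A"
  proof (rule frame_on_UN[OF C(2) _ _ \<mu> A])
    fix c d assume cd: "c \<in> C" "d \<in> C"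
    then have "norm c \<le> R" "norm d \<le> R" using C(1) by auto
    then have "dist c d \<le> 2 * R" using norm_triangle_ineq4[of c d] by (simp add: dist_norm)
    from r(2)[OF this] show "frame_on (ball c r \<union> ball d r) \<mu> A"
      by (intro frame_on_shiftable[OF _ b \<Omega>(1) \<mu> fin fr A]) auto
  qed (use emeasure_lborel_ball_finite in auto)
  then show ?thesis by (rule frame_on_mono) (use R C(3) in blast)
qed

section \<open>The frame identity determines the measure\<close>

lemma norm_cis_diff_1_le: "norm (cis t - 1) \<le> \<bar>t\<bar>"
proof -
  have "norm (cis t - 1) = 2 * \<bar>sin (t / 2)\<bar>"
  proof -
    have "(norm (cis t - 1))\<^sup>2 = (2 * \<bar>sin (t / 2)\<bar>)\<^sup>2"
    proof -
      have "(norm (cis t - 1))\<^sup>2 = (cos t - 1)\<^sup>2 + (sin t)\<^sup>2" by (simp add: cmod_power2)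
      also have "\<dots> = 2 - 2 * cos t" using sin_cos_squared_add[of t] by (simp add: power2_diff)
      also have "cos t = 1 - 2 * (sin (t / 2))\<^sup>2" using cos_double_sin[of "t / 2"] by simp
      finally show ?thesis by (simp add: power_mult_distrib)
    qed
    then show ?thesis by (rule power2_eq_imp_eq) auto
  qed
  also have "\<dots> \<le> 2 * \<bar>t / 2\<bar>" using abs_sin_x_le_abs_x[of "t / 2"] by simp
  finally show ?thesis by simp
qed

lemma norm_1_add_unit_sq:
  assumes "norm c = 1" "norm w = 1"
  shows "(norm (1 + c * w))\<^sup>2 = 2 + 2 * Re (c * w)"
proof -
  have "(norm (c * w))\<^sup>2 = 1" using assms by (simp add: norm_mult)
  then have "(Re (c * w))\<^sup>2 + (Im (c * w))\<^sup>2 = 1" unfolding cmod_power2 .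
  then show ?thesis unfolding cmod_power2[of "1 + c * w"] by (simp add: power2_sum)
qed

text \<open>On the ball the phase deviates from 1 by less than 1, so the transform differs from the
  volume of the ball by less than that volume. This permits division by the transform on a
  prescribed bounded set of frequencies.\<close>

lemma ft_indicator_ball_nonzero:
  fixes \<xi> :: "'a::euclidean_space"
  assumes r: "r > 0" and \<xi>: "2 * pi * (norm \<xi> * r) < 1"
  shows "ft (indicator (ball 0 r)) \<xi> \<noteq> 0"
proof
  assume zero: "ft (indicator (ball 0 r)) \<xi> = 0"
  let ?B = "ball (0::'a) r"
  have fin: "emeasure lborel ?B < \<infinity>" by (rule emeasure_lborel_ball_finite)
  have mpos: "measure lborel ?B > 0"
    using content_ball_pos[OF r, of "0::'a"] by simp
  have iB: "integrable lborel (indicat_real ?B)" using fin by (intro integrable_real_indicator) auto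
  have iBc: "integrable lborel (indicator ?B :: 'a \<Rightarrow> complex)"
    using fin by (intro Bochner_Integration.integrable_bound[OF iB] borel_measurable_indicator) (auto simp: indicator_def)
  have "ft (indicator ?B) \<xi> - (\<integral>x. indicator ?B x \<partial>lborel) = (\<integral>x. indicator ?B x * cis (- (2 * pi * (\<xi> \<bullet> x))) - indicator ?B x \<partial>lborel)"
    unfolding ft_def using integrable_ft[OF iBc, of \<xi>] iBc by simp
  also have "norm \<dots> \<le> (\<integral>x. indicator ?B x * (2 * pi * (norm \<xi> * r)) \<partial>lborel)"
  proof (rule Bochner_Integration.integral_norm_bound_integral)
    show "integrable lborel (\<lambda>x. indicator ?B x * cis (- (2 * pi * (\<xi> \<bullet> x))) - indicator ?B x)"
      using integrable_ft[OF iBc, of \<xi>] iBc by simp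
    show "norm (indicator ?B x * cis (- (2 * pi * (\<xi> \<bullet> x))) - indicator ?B x) \<le> indicator ?B x * (2 * pi * (norm \<xi> * r))" for x
    proof (cases "x \<in> ?B")
      case True
      have "norm (cis (- (2 * pi * (\<xi> \<bullet> x))) - 1) \<le> 2 * pi * \<bar>\<xi> \<bullet> x\<bar>"
        using norm_cis_diff_1_le[of "- (2 * pi * (\<xi> \<bullet> x))"] by (simp add: abs_mult)
      also have "\<bar>\<xi> \<bullet> x\<bar> \<le> norm \<xi> * norm x" by (rule Cauchy_Schwarz_ineq2)
      also have "\<dots> \<le> norm \<xi> * r" using True by (intro mult_left_mono) auto
      finally show ?thesis using True by simp
    qed simp
  qed (use iB in auto)
  also have "\<dots> = measure lborel ?B * (2 * pi * (norm \<xi> * r))" by simp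
  also have "\<dots> < measure lborel ?B * 1" using \<xi> mpos by (intro mult_strict_left_mono)
  finally have lt: "norm (ft (indicator ?B) \<xi> - (\<integral>x. indicator ?B x \<partial>lborel)) < measure lborel ?B" by simp
  have "(\<integral>x. indicator ?B x \<partial>lborel) = (\<integral>x. complex_of_real (indicat_real ?B x) \<partial>lborel)"
    by (intro Bochner_Integration.integral_cong) (simp_all add: indicator_def)
  also have "\<dots> = complex_of_real (\<integral>x. indicat_real ?B x \<partial>lborel)"
    by (rule integral_complex_of_real)
  finally have "(\<integral>x. indicator ?B x \<partial>lborel) = complex_of_real (measure lborel ?B)" by simp
  with lt zero mpos show False by simp
qed

text \<open>The transform of a single \<open>g\<close> may have zeros, so the measures are compared
  on bounded sets \<open>E\<close> first, with \<open>g\<close> adapted to \<open>E\<close>: the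
  finite measures weighted by \<open>|ft g|^2\<close> agree, and the weight is divided out on
  \<open>E\<close>.\<close>

lemma frame_on_balls_unique:
  fixes \<mu> \<nu> :: "'a::euclidean_space measure"
  assumes \<mu>: "sets \<mu> = sets borel" and \<nu>: "sets \<nu> = sets borel"
    and fr\<mu>: "\<And>R. frame_on (ball 0 R) \<mu> A" and fr\<nu>: "\<And>R. frame_on (ball 0 R) \<nu> A"
  shows "\<mu> = \<nu>"
proof -
  have local: "emeasure \<mu> E = emeasure \<nu> E"
    if E: "E \<in> sets borel" "E \<subseteq> ball 0 (real n)" for E n
  proof -
    \<comment> \<open>Makes \<open>2 * pi * Suc n * r\<close> equal to \<open>pi / 4\<close>, which
      is below 1; \<open>Suc\<close> keeps \<open>r\<close> positive for
      \<open>n = 0\<close>.\<close>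
    define r where "r = 1 / (8 * real (Suc n))"
    define g :: "'a \<Rightarrow> complex" where "g = indicator (ball 0 r)"
    define w where "w t x = cis (- (2 * pi * (x \<bullet> t)))" for t x :: 'a
    have r: "r > 0" by (simp add: r_def)
    have nz: "ft g \<xi> \<noteq> 0" if "\<xi> \<in> E" for \<xi>
      unfolding g_def
    proof (rule ft_indicator_ball_nonzero[OF r])
      have "norm \<xi> \<le> real (Suc n)" using that E(2) by auto
      then have "2 * pi * (norm \<xi> * r) \<le> 2 * pi * (real (Suc n) * r)"
        using r by (intro mult_left_mono mult_right_mono) auto
      also have "\<dots> = pi / 4" by (simp add: r_def del: of_nat_Suc)
      also have "\<dots> < 1" using pi_less_4 by simp
      finally show "2 * pi * (norm \<xi> * r) < 1" .
    qed
    have gm[measurable]: "g \<in> borel_measurable borel" unfolding g_def by (intro borel_measurable_indicator) simp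
    have sg: "sqn lborel g < \<infinity>"
    proof -
      have "sqn lborel g = (\<integral>\<^sup>+x. indicator (ball 0 r) x \<partial>(lborel :: 'a measure))"
        unfolding sqn_def g_def by (intro nn_integral_cong) (simp add: indicator_def)
      then show ?thesis using emeasure_lborel_ball_finite[of "0::'a" r] by simp
    qed
    have g: "g \<in> L2on (ball 0 r)" using sg gm unfolding L2on_def by (auto simp: g_def indicator_def)
    have ig: "integrable lborel g"
      by (rule L2on_integrable(1)[OF g]) (auto simp: emeasure_lborel_ball_finite[unfolded infinity_ennreal_def])
    \<comment> \<open>For unimodular \<open>c\<close> the second summand multiplies
      \<open>|ft g|^2\<close> by \<open>2 + 2 * Re (c * w t x)\<close>, which makes the phase
      \<open>w t\<close> visible in a squared norm.\<close>
    define h where "h c t x = g x + c * g (x - t)" for c and t x :: 'a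
    have hm[measurable]: "h c t \<in> borel_measurable borel" for c t unfolding h_def by measurable
    have h: "h c t \<in> L2on (ball 0 (r + norm t))" for c t
    proof -
      have "sqn lborel (h c t) < \<infinity>" unfolding h_def
      proof (rule sqn_add_finite)
        show "sqn lborel (\<lambda>x. c * g (x - t)) < \<infinity>"
          using sg sqn_translate[OF gm, of "- t"] by (subst sqn_cmult) (auto simp: ennreal_mult_less_top)
      qed (use sg in auto)
      moreover have "h c t x = 0" if "x \<notin> ball 0 (r + norm t)" for x
      proof -
        have "r + norm t \<le> norm x" using that by simp
        then have "r \<le> norm x" "r \<le> norm (x - t)"
          using norm_triangle_sub[of x t] norm_ge_zero[of t] by linarith+
        then show ?thesis by (simp add: h_def g_def)
      qed
      ultimately show ?thesis by (simp add: L2on_def)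
    qed
    have fth: "ft (h c t) x = ft g x * (1 + c * w t x)" for c t x
    proof -
      have "ft (h c t) x = ft g x + ft (\<lambda>x. c * g (x - t)) x"
        unfolding h_def using ig integrable_lborel_translate[OF ig, of "- t"] by (intro ft_add) auto
      then show ?thesis by (simp add: ft_cmult ft_translate[OF gm] w_def algebra_simps)
    qed
    define K where "K M = density M (\<lambda>x. ennreal ((norm (ft g x))\<^sup>2))" for M
    \<comment> \<open>The value \<open>ennreal A * sqn lborel (h c t)\<close> is the same for both
      measures. Since \<open>ennreal\<close> sends all negative reals to 0, the sign is recorded as
      well, so that \<open>ennreal\<close> can be cancelled later.\<close>
    have char: "finite_measure (K M) \<and> (\<forall>t. integrable M (\<lambda>x. (norm (ft g x))\<^sup>2) \<and>
        (\<integral>x. w t x \<partial>K M) = (\<integral>x. (norm (ft g x))\<^sup>2 *\<^sub>R w t x \<partial>M) \<and>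
        (\<forall>c. norm c = 1 \<longrightarrow> ennreal (2 * (\<integral>x. (norm (ft g x))\<^sup>2 \<partial>M) + 2 * Re (c * (\<integral>x. (norm (ft g x))\<^sup>2 *\<^sub>R w t x \<partial>M)))
           = ennreal A * sqn lborel (h c t) \<and>
           0 \<le> 2 * (\<integral>x. (norm (ft g x))\<^sup>2 \<partial>M) + 2 * Re (c * (\<integral>x. (norm (ft g x))\<^sup>2 *\<^sub>R w t x \<partial>M)))) \<and>
        ennreal (\<integral>x. (norm (ft g x))\<^sup>2 \<partial>M) = ennreal A * sqn lborel g"
      if M[measurable_cong]: "sets M = sets borel" and fr: "\<And>R. frame_on (ball 0 R) M A" for M
    proof -
      have sp: "space M = UNIV" using sets_eq_imp_space_eq[OF M] by simp
      have ftm[measurable]: "ft g \<in> borel_measurable M" 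
        using ft_measurable[OF gm] measurable_cong_sets[OF M refl] by blast
      have wm[measurable]: "w t \<in> borel_measurable M" for t
        unfolding w_def by measurable
      have eqg: "sqn M (ft g) = ennreal A * sqn lborel g" using fr g by (auto simp: frame_on_def)
      then have fin: "sqn M (ft g) < \<infinity>" using sg by (simp add: ennreal_mult_less_top)
      have i: "integrable M (\<lambda>x. (norm (ft g x))\<^sup>2)" and s: "sqn M (ft g) = ennreal (\<integral>x. (norm (ft g x))\<^sup>2 \<partial>M)"
        using sqn_finite_integrable[OF ftm fin] by auto
      have iw: "integrable M (\<lambda>x. (norm (ft g x))\<^sup>2 *\<^sub>R w t x)" for t
        by (rule Bochner_Integration.integrable_bound[OF i]) (auto simp: w_def)
      have "emeasure (K M) UNIV = sqn M (ft g)"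
        unfolding K_def sqn_def using sp M by (subst emeasure_density) (auto intro!: nn_integral_cong)
      then have "finite_measure (K M)" using fin sp by (intro finite_measureI) (auto simp: K_def)
      moreover have "(\<integral>x. w t x \<partial>K M) = (\<integral>x. (norm (ft g x))\<^sup>2 *\<^sub>R w t x \<partial>M)" for t
        unfolding K_def by (rule integral_density) auto
      moreover have "ennreal (2 * (\<integral>x. (norm (ft g x))\<^sup>2 \<partial>M) + 2 * Re (c * (\<integral>x. (norm (ft g x))\<^sup>2 *\<^sub>R w t x \<partial>M)))
           = ennreal A * sqn lborel (h c t) \<and>
           0 \<le> 2 * (\<integral>x. (norm (ft g x))\<^sup>2 \<partial>M) + 2 * Re (c * (\<integral>x. (norm (ft g x))\<^sup>2 *\<^sub>R w t x \<partial>M))"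
        if c: "norm c = 1" for c t
      proof -
        have ftm': "ft (h c t) \<in> borel_measurable M" 
          using ft_measurable[OF hm] measurable_cong_sets[OF M refl] by blast
        have eqh: "sqn M (ft (h c t)) = ennreal A * sqn lborel (h c t)" using fr h by (auto simp: frame_on_def)
        then have finh: "sqn M (ft (h c t)) < \<infinity>" using L2onD(3)[OF h] by (simp add: ennreal_mult_less_top)
        have "(\<integral>x. (norm (ft (h c t) x))\<^sup>2 \<partial>M) = (\<integral>x. 2 * (norm (ft g x))\<^sup>2 + 2 * Re (c * ((norm (ft g x))\<^sup>2 *\<^sub>R w t x)) \<partial>M)"
        proof (rule Bochner_Integration.integral_cong[OF refl])
          fix x
          have "(norm (1 + c * w t x))\<^sup>2 = 2 + 2 * Re (c * w t x)"
            by (rule norm_1_add_unit_sq[OF c]) (simp add: w_def)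
          moreover have "Re (c * ((norm (ft g x))\<^sup>2 *\<^sub>R w t x)) = (norm (ft g x))\<^sup>2 * Re (c * w t x)"
            by (simp add: algebra_simps)
          ultimately show "(norm (ft (h c t) x))\<^sup>2 = 2 * (norm (ft g x))\<^sup>2 + 2 * Re (c * ((norm (ft g x))\<^sup>2 *\<^sub>R w t x))"
            by (simp only: fth norm_mult power_mult_distrib) (simp only: distrib_left mult_ac)
        qed
        also have "\<dots> = 2 * (\<integral>x. (norm (ft g x))\<^sup>2 \<partial>M) + 2 * Re (c * (\<integral>x. (norm (ft g x))\<^sup>2 *\<^sub>R w t x \<partial>M))"
        proof -
          have ic: "integrable M (\<lambda>x. c * ((norm (ft g x))\<^sup>2 *\<^sub>R w t x))" using iw[of t] by (rule integrable_mult_right)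
          have "(\<integral>x. Re (c * ((norm (ft g x))\<^sup>2 *\<^sub>R w t x)) \<partial>M) = Re (\<integral>x. c * ((norm (ft g x))\<^sup>2 *\<^sub>R w t x) \<partial>M)"
            by (rule integral_Re[OF ic])
          also have "\<dots> = Re (c * (\<integral>x. (norm (ft g x))\<^sup>2 *\<^sub>R w t x \<partial>M))"
            by (simp only: integral_mult_right_zero)
          finally have "(\<integral>x. Re (c * ((norm (ft g x))\<^sup>2 *\<^sub>R w t x)) \<partial>M) = Re (c * (\<integral>x. (norm (ft g x))\<^sup>2 *\<^sub>R w t x \<partial>M))" .
          moreover have "integrable M (\<lambda>x. Re (c * ((norm (ft g x))\<^sup>2 *\<^sub>R w t x)))"
            using ic by (rule integrable_Re)
          ultimately show ?thesis using i by (simp only: Bochner_Integration.integral_add integrable_mult_right integral_mult_right_zero)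
        qed
        finally have int: "(\<integral>x. (norm (ft (h c t) x))\<^sup>2 \<partial>M) = \<dots>" .
        moreover have "0 \<le> (\<integral>x. (norm (ft (h c t) x))\<^sup>2 \<partial>M)" by simp
        ultimately show ?thesis
          using sqn_finite_integrable(2)[OF ftm' finh] eqh by simp
      qed
      ultimately show ?thesis using i s eqg by auto
    qed
    note cM = char[OF \<mu> fr\<mu>] and cN = char[OF \<nu> fr\<nu>]
    have I: "(\<integral>x. (norm (ft g x))\<^sup>2 \<partial>\<mu>) = (\<integral>x. (norm (ft g x))\<^sup>2 \<partial>\<nu>)"
    proof -
      have "ennreal (\<integral>x. (norm (ft g x))\<^sup>2 \<partial>\<mu>) = ennreal (\<integral>x. (norm (ft g x))\<^sup>2 \<partial>\<nu>)"
        using cM cN by simp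
      then show ?thesis by (subst (asm) ennreal_inj) auto
    qed
    have W: "(\<integral>x. w t x \<partial>K \<mu>) = (\<integral>x. w t x \<partial>K \<nu>)" for t
    proof -
      have R: "Re (c * (\<integral>x. (norm (ft g x))\<^sup>2 *\<^sub>R w t x \<partial>\<mu>)) = Re (c * (\<integral>x. (norm (ft g x))\<^sup>2 *\<^sub>R w t x \<partial>\<nu>))" if c: "norm c = 1" for c
      proof -
        have "ennreal (2 * (\<integral>x. (norm (ft g x))\<^sup>2 \<partial>\<mu>) + 2 * Re (c * (\<integral>x. (norm (ft g x))\<^sup>2 *\<^sub>R w t x \<partial>\<mu>)))
          = ennreal (2 * (\<integral>x. (norm (ft g x))\<^sup>2 \<partial>\<nu>) + 2 * Re (c * (\<integral>x. (norm (ft g x))\<^sup>2 *\<^sub>R w t x \<partial>\<nu>)))"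
          using cM cN c by presburger
        moreover have "0 \<le> 2 * (\<integral>x. (norm (ft g x))\<^sup>2 \<partial>\<mu>) + 2 * Re (c * (\<integral>x. (norm (ft g x))\<^sup>2 *\<^sub>R w t x \<partial>\<mu>))"
          using cM c by blast
        moreover have "0 \<le> 2 * (\<integral>x. (norm (ft g x))\<^sup>2 \<partial>\<nu>) + 2 * Re (c * (\<integral>x. (norm (ft g x))\<^sup>2 *\<^sub>R w t x \<partial>\<nu>))"
          using cN c by blast
        ultimately show ?thesis using I by (simp only: ennreal_inj)
      qed
      \<comment> \<open>\<open>c = 1\<close> gives the real part, \<open>c = \<i>\<close> the
        imaginary part up to sign.\<close>
      have "(\<integral>x. (norm (ft g x))\<^sup>2 *\<^sub>R w t x \<partial>\<mu>) = (\<integral>x. (norm (ft g x))\<^sup>2 *\<^sub>R w t x \<partial>\<nu>)"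
        using R[of 1] R[of \<i>] by (simp add: complex_eq_iff)
      then show ?thesis using cM cN by simp
    qed
    have "K \<mu> = K \<nu>"
    proof (rule finite_measure_eqI_char)
      show "(\<integral>x. cis (2 * pi * (t \<bullet> x)) \<partial>K \<mu>) = (\<integral>x. cis (2 * pi * (t \<bullet> x)) \<partial>K \<nu>)" for t
        using W[of "- t"] by (simp add: w_def inner_commute)
    qed (use cM cN \<mu> \<nu> in \<open>auto simp: K_def\<close>)
    \<comment> \<open>The weight has no zeros on \<open>E\<close> and can be divided out.\<close>
    moreover have "emeasure M E = (\<integral>\<^sup>+x. indicator E x * ennreal (1 / (norm (ft g x))\<^sup>2) \<partial>K M)"
      if M[measurable_cong]: "sets M = sets borel" for M
    proof -
      have [measurable]: "ft g \<in> borel_measurable M" 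
        using ft_measurable[OF gm] measurable_cong_sets[OF M refl] by blast
      have [measurable]: "E \<in> sets M" using E M by simp
      have "(\<integral>\<^sup>+x. indicator E x * ennreal (1 / (norm (ft g x))\<^sup>2) \<partial>K M)
        = (\<integral>\<^sup>+x. ennreal ((norm (ft g x))\<^sup>2) * (indicator E x * ennreal (1 / (norm (ft g x))\<^sup>2)) \<partial>M)"
        unfolding K_def by (rule nn_integral_density) measurable
      also have "\<dots> = (\<integral>\<^sup>+x. indicator E x \<partial>M)"
        using nz by (intro nn_integral_cong) (auto simp: indicator_def ennreal_mult[symmetric])
      finally show ?thesis by simp
    qed
    ultimately show ?thesis using \<mu> \<nu> by metis
  qed
  show ?thesis
  proof (rule measure_eqI)
    show "sets \<mu> = sets \<nu>" using \<mu> \<nu> by simp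
    fix E assume "E \<in> sets \<mu>"
    then have E: "E \<in> sets borel" using \<mu> by simp
    \<comment> \<open>\<open>local\<close> covers only bounded sets, so \<open>E\<close> is
      exhausted by its intersections with balls.\<close>
    have lim: "(\<lambda>n. emeasure M (E \<inter> ball 0 (real n))) \<longlonglongrightarrow> emeasure M E" if "sets M = sets borel" for M
    proof -
      have "(\<Union>n. E \<inter> ball 0 (real n)) = E"
      proof -
        have "\<exists>n. norm x < real n" for x :: 'a by (rule reals_Archimedean2)
        then show ?thesis by auto
      qed
      moreover have "(\<lambda>n. emeasure M (E \<inter> ball 0 (real n))) \<longlonglongrightarrow> emeasure M (\<Union>n. E \<inter> ball 0 (real n))"
      proof (rule Lim_emeasure_incseq)
        show "range (\<lambda>n. E \<inter> ball 0 (real n)) \<subseteq> sets M"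
          unfolding that using E by (intro image_subsetI sets.Int) simp_all
        show "incseq (\<lambda>n. E \<inter> ball 0 (real n))"
        proof (rule incseq_SucI)
          show "E \<inter> ball 0 (real n) \<subseteq> E \<inter> ball 0 (real (Suc n))" for n
            by (intro Int_mono order_refl subset_ball) simp
        qed
      qed
      ultimately show ?thesis by simp
    qed
    have "emeasure \<mu> (E \<inter> ball 0 (real n)) = emeasure \<nu> (E \<inter> ball 0 (real n))" for n
      using E by (intro local[of _ n]) auto
    then show "emeasure \<mu> E = emeasure \<nu> E"
      using LIMSEQ_unique[OF lim[OF \<mu>]] lim[OF \<nu>] by simp
  qed
qed

lemma frame_on_scale_lborel:
  assumes "X \<in> sets borel" "emeasure lborel X < \<infinity>"
  shows "frame_on X (scale_measure (ennreal A) lborel) A"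
  unfolding frame_on_def
proof
  fix f assume f: "f \<in> L2on X"
  have [measurable]: "ft f \<in> borel_measurable borel" using L2onD(1)[OF f] by measurable
  have "sqn (scale_measure (ennreal A) lborel) (ft f) = ennreal A * sqn lborel (ft f)"
    unfolding sqn_def by (rule nn_integral_scale_measure) measurable
  then show "sqn (scale_measure (ennreal A) lborel) (ft f) = ennreal A * sqn lborel f"
    using frame_on_lborel[OF assms] f by (simp add: frame_on_def)
qed

section \<open>Passage to \<open>L\<^sup>2(\<Omega>)\<close> and the converse direction\<close>

text \<open>Approximation from inside: a function that vanishes off the Borel part then vanishes off
  \<open>S\<close> as well.\<close>

lemma sets_lebesgue_inner_borel:
  fixes S :: "'a::euclidean_space set"
  assumes "S \<in> sets lebesgue"
  obtains S' N where "S' \<subseteq> S" "S' \<in> sets borel" "N \<in> null_sets lborel" "S - S' \<subseteq> N"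
proof -
  obtain T N N' where "S = T \<union> N" "N \<subseteq> N'" "N' \<in> null_sets lborel" "T \<in> sets lborel"
    using sets_completionE[OF assms] .
  then show ?thesis using that[of T N'] by auto
qed

lemma borel_representative:
  fixes f :: "'a::euclidean_space \<Rightarrow> complex"
  assumes "f \<in> borel_measurable lebesgue"
  obtains g where "g \<in> borel_measurable borel" "AE x in lborel. f x = g x"
proof -
  have "(\<lambda>x. Re (f x)) \<in> borel_measurable lebesgue" "(\<lambda>x. Im (f x)) \<in> borel_measurable lebesgue"
    using assms by measurable
  from this[THEN completion_ex_borel_measurable_real]
  obtain u v where uv: "u \<in> borel_measurable lborel" "AE x in lborel. Re (f x) = u x"
    "v \<in> borel_measurable lborel" "AE x in lborel. Im (f x) = v x"
    by blast
  have [measurable]: "u \<in> borel_measurable borel" "v \<in> borel_measurable borel" using uv by auto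
  show ?thesis
  proof
    show "(\<lambda>x. of_real (u x) + \<i> * of_real (v x)) \<in> borel_measurable borel" by measurable
    show "AE x in lborel. f x = of_real (u x) + \<i> * of_real (v x)"
      using uv(2,4) by eventually_elim (simp add: complex_eq_iff)
  qed
qed

lemma exp_phase_eq_cis: "exp (- (2 * complex_of_real pi * \<i> * complex_of_real r)) = cis (- (2 * pi * r))"
  by (simp add: cis_conv_exp mult_ac)

context
  fixes \<Omega> \<Omega>' N :: "(real^'d) set"
  assumes \<Omega>: "\<Omega> \<in> sets lebesgue" and sub: "\<Omega>' \<subseteq> \<Omega>" and \<Omega>': "\<Omega>' \<in> sets borel"
    and N: "N \<in> null_sets lborel" and diff: "\<Omega> - \<Omega>' \<subseteq> N"
begin

lemma nn_integral_lebesgue_on_eq_sqn: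
  assumes g: "AE x in lborel. indicator \<Omega> x *\<^sub>R f x = g x"
  shows "(\<integral>\<^sup>+x. ennreal ((norm (f x))\<^sup>2) \<partial>lebesgue_on \<Omega>) = sqn lborel g"
proof -
  have "(\<integral>\<^sup>+x. ennreal ((norm (f x))\<^sup>2) \<partial>lebesgue_on \<Omega>) = (\<integral>\<^sup>+x. ennreal ((norm (f x))\<^sup>2) * indicator \<Omega> x \<partial>lborel)"
    using \<Omega> by (subst nn_integral_restrict_space) (auto simp: nn_integral_completion)
  also have "\<dots> = sqn lborel g"
    unfolding sqn_def
  proof (rule nn_integral_cong_AE)
    show "AE x in lborel. ennreal ((norm (f x))\<^sup>2) * indicator \<Omega> x = ennreal ((norm (g x))\<^sup>2)"
      using g
    proof eventually_elim
      fix x assume "indicator \<Omega> x *\<^sub>R f x = g x"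
      then show "ennreal ((norm (f x))\<^sup>2) * indicator \<Omega> x = ennreal ((norm (g x))\<^sup>2)"
        by (cases "x \<in> \<Omega>") auto
    qed
  qed
  finally show ?thesis .
qed

lemma fourier_on_eq_ft:
  assumes g[measurable]: "g \<in> borel_measurable borel" and f: "f \<in> borel_measurable (lebesgue_on \<Omega>)"
    and fg: "AE x in lborel. indicator \<Omega> x *\<^sub>R f x = g x"
  shows "fourier_on \<Omega> f \<xi> = ft g \<xi>"
proof -
  have fm[measurable]: "(\<lambda>x. indicator \<Omega> x *\<^sub>R f x) \<in> borel_measurable lebesgue"
    using f \<Omega> by (subst (asm) borel_measurable_restrict_space_iff) auto
  have cm: "(\<lambda>x. cis (- (2 * pi * (\<xi> \<bullet> x)))) \<in> borel_measurable lborel"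
    and gm: "(\<lambda>x. g x * cis (- (2 * pi * (\<xi> \<bullet> x)))) \<in> borel_measurable lborel" by measurable
  have "fourier_on \<Omega> f \<xi> = (\<integral>x. indicator \<Omega> x *\<^sub>R (f x * cis (- (2 * pi * (\<xi> \<bullet> x)))) \<partial>lebesgue)"
    unfolding fourier_on_def exp_phase_eq_cis using \<Omega> by (subst integral_restrict_space) auto
  also have "\<dots> = (\<integral>x. g x * cis (- (2 * pi * (\<xi> \<bullet> x))) \<partial>lebesgue)"
  proof (rule integral_cong_AE)
    show "(\<lambda>x. g x * cis (- (2 * pi * (\<xi> \<bullet> x)))) \<in> borel_measurable lebesgue"
      using gm by (rule measurable_completion)
    have "(\<lambda>x. (indicator \<Omega> x *\<^sub>R f x) * cis (- (2 * pi * (\<xi> \<bullet> x)))) \<in> borel_measurable lebesgue"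
      using fm measurable_completion[OF cm] by (rule borel_measurable_times)
    then show "(\<lambda>x. indicator \<Omega> x *\<^sub>R (f x * cis (- (2 * pi * (\<xi> \<bullet> x))))) \<in> borel_measurable lebesgue"
      by (simp only: mult_scaleR_left)
    show "AE x in lebesgue. indicator \<Omega> x *\<^sub>R (f x * cis (- (2 * pi * (\<xi> \<bullet> x)))) = g x * cis (- (2 * pi * (\<xi> \<bullet> x)))"
      using AE_completion[OF fg] by eventually_elim (simp flip: mult_scaleR_left)
  qed
  also have "\<dots> = ft g \<xi>"
    unfolding ft_def by (rule integral_completion[OF gm])
  finally show ?thesis .
qed

lemma L2on_subset_L2_space:
  assumes f: "f \<in> L2on \<Omega>'"
  shows "f \<in> L2_space \<Omega>" and "AE x in lborel. indicator \<Omega> x *\<^sub>R f x = f x"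
    and "f \<in> borel_measurable (lebesgue_on \<Omega>)"
proof -
  note [measurable] = L2onD(1)[OF f]
  have z: "indicator \<Omega> x *\<^sub>R f x = f x" for x
    using L2onD(2)[OF f] sub by (auto simp: indicator_def)
  then show ae: "AE x in lborel. indicator \<Omega> x *\<^sub>R f x = f x" by simp
  have "f \<in> borel_measurable lborel" by measurable
  then show m: "f \<in> borel_measurable (lebesgue_on \<Omega>)"
    by (intro measurable_restrict_space1 measurable_completion)
  have "(\<integral>\<^sup>+x. ennreal ((norm (f x))\<^sup>2) \<partial>lebesgue_on \<Omega>) < \<infinity>"
    using nn_integral_lebesgue_on_eq_sqn[OF ae] L2onD(3)[OF f] by simp
  then show "f \<in> L2_space \<Omega>"
    unfolding L2_space_def using m by (auto simp: integrable_iff_bounded)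
qed

lemma L2_space_representative:
  assumes f: "f \<in> L2_space \<Omega>"
  obtains g where "g \<in> L2on \<Omega>'" "AE x in lborel. indicator \<Omega> x *\<^sub>R f x = g x"
proof -
  have fm: "f \<in> borel_measurable (lebesgue_on \<Omega>)" and fi: "integrable (lebesgue_on \<Omega>) (\<lambda>x. (norm (f x))\<^sup>2)"
    using f by (auto simp: L2_space_def)
  have "(\<lambda>x. indicator \<Omega> x *\<^sub>R f x) \<in> borel_measurable lebesgue"
    using fm \<Omega> by (subst (asm) borel_measurable_restrict_space_iff) auto
  then obtain g0 where g0: "g0 \<in> borel_measurable borel" "AE x in lborel. indicator \<Omega> x *\<^sub>R f x = g0 x"
    by (rule borel_representative)
  note [measurable] = g0(1) \<Omega>'
  define g where "g x = (if x \<in> \<Omega>' then g0 x else 0)" for x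
  have ae: "AE x in lborel. indicator \<Omega> x *\<^sub>R f x = g x"
    using g0(2) AE_not_in[OF N]
  proof eventually_elim
    fix x assume "indicator \<Omega> x *\<^sub>R f x = g0 x" "x \<notin> N"
    then show "indicator \<Omega> x *\<^sub>R f x = g x"
      using diff sub by (cases "x \<in> \<Omega>") (auto simp: g_def)
  qed
  have "g \<in> L2on \<Omega>'"
    unfolding L2on_def
  proof (intro CollectI conjI allI impI)
    show "g \<in> borel_measurable borel" unfolding g_def by measurable
    show "sqn lborel g < \<infinity>"
      using fi nn_integral_lebesgue_on_eq_sqn[OF ae] by (auto simp: integrable_iff_bounded)
  qed (simp add: g_def)
  then show ?thesis using that ae by blast
qed

text \<open>Both sides of the identity depend on \<open>f\<close> only up to null sets, and each
  \<open>f\<close> in \<open>L2_space \<Omega>\<close>, extended by 0, agrees almost everywhere with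
  a Borel function vanishing outside \<open>\<Omega>'\<close>. This removes the completed measure
  from the problem.\<close>

lemma tight_frame_measure_iff_frame_on:
  "tight_frame_measure \<Omega> \<mu> \<longleftrightarrow> sets \<mu> = sets borel \<and> locally_finite_measure \<mu> \<and> (\<exists>A>0. frame_on \<Omega>' \<mu> A)"
proof -
  have "(\<forall>f\<in>L2_space \<Omega>. (\<integral>\<^sup>+ \<xi>. ennreal ((norm (fourier_on \<Omega> f \<xi>))\<^sup>2) \<partial>\<mu>)
          = ennreal A * (\<integral>\<^sup>+ x. ennreal ((norm (f x))\<^sup>2) \<partial>lebesgue_on \<Omega>)) \<longleftrightarrow> frame_on \<Omega>' \<mu> A" (is "?L \<longleftrightarrow> _") for A
  proof
    assume L: ?L
    show "frame_on \<Omega>' \<mu> A"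
      unfolding frame_on_def
    proof
      fix f assume f: "f \<in> L2on \<Omega>'"
      note f' = L2on_subset_L2_space[OF f]
      have "fourier_on \<Omega> f = ft f"
        using fourier_on_eq_ft[OF L2onD(1)[OF f] f'(3) f'(2)] by blast
      then show "sqn \<mu> (ft f) = ennreal A * sqn lborel f"
        using L f'(1) nn_integral_lebesgue_on_eq_sqn[OF f'(2)] by (auto simp: sqn_def[of \<mu>])
    qed
  next
    assume fr: "frame_on \<Omega>' \<mu> A"
    show ?L
    proof
      fix f assume f: "f \<in> L2_space \<Omega>"
      obtain g where g: "g \<in> L2on \<Omega>'" "AE x in lborel. indicator \<Omega> x *\<^sub>R f x = g x"
        using L2_space_representative[OF f] .
      have "fourier_on \<Omega> f = ft g"
        using fourier_on_eq_ft[OF L2onD(1)[OF g(1)] _ g(2)] f by (auto simp: L2_space_def)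
      then show "(\<integral>\<^sup>+ \<xi>. ennreal ((norm (fourier_on \<Omega> f \<xi>))\<^sup>2) \<partial>\<mu>)
          = ennreal A * (\<integral>\<^sup>+ x. ennreal ((norm (f x))\<^sup>2) \<partial>lebesgue_on \<Omega>)"
        using fr g(1) nn_integral_lebesgue_on_eq_sqn[OF g(2)] by (simp add: frame_on_def sqn_def[of \<mu>])
    qed
  qed
  then show ?thesis by (simp add: tight_frame_measure_def)
qed

text \<open>The two sets can differ only inside \<open>N\<close> and its translate by
  \<open>x\<close>. As \<open>\<Omega> + x\<close> consists of the \<open>y\<close> with
  \<open>y - x\<close> in \<open>\<Omega>\<close>, the shift on the right is by
  \<open>- x\<close>.\<close>

lemma emeasure_overlap:
  "emeasure lebesgue (\<Omega> \<inter> (\<lambda>y. y + x) ` \<Omega>) = emeasure lborel {y \<in> \<Omega>'. y + - x \<in> \<Omega>'}"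
proof -
  have im: "(\<lambda>y. y + x) ` \<Omega> = {y. y - x \<in> \<Omega>}"
    by (auto simp: image_iff) (metis diff_add_cancel)
  have B: "{y \<in> \<Omega>'. y + - x \<in> \<Omega>'} \<in> sets lborel" using \<Omega>' by measurable
  have "(\<lambda>y. y + x) ` \<Omega> \<in> sets lebesgue"
    using lebesgue_sets_translation[OF \<Omega>, of x] by (simp add: add.commute)
  then have A: "\<Omega> \<inter> (\<lambda>y. y + x) ` \<Omega> \<in> sets lebesgue" using \<Omega> by blast
  have "emeasure lebesgue (\<Omega> \<inter> (\<lambda>y. y + x) ` \<Omega>) = emeasure lebesgue {y \<in> \<Omega>'. y + - x \<in> \<Omega>'}"
  proof (rule emeasure_eq_AE)
    show "AE y in lebesgue. y \<in> \<Omega> \<inter> (\<lambda>y. y + x) ` \<Omega> \<longleftrightarrow> y \<in> {y \<in> \<Omega>'. y + - x \<in> \<Omega>'}"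
      using AE_completion[OF AE_not_in[OF N]] AE_completion[OF AE_not_in[OF null_sets_translation[OF N, of x]]]
      by eventually_elim (use diff sub in \<open>auto simp: im\<close>)
  qed (use A B in auto)
  also have "\<dots> = emeasure lborel {y \<in> \<Omega>'. y + - x \<in> \<Omega>'}"
    using B by simp
  finally show ?thesis .
qed

end

section \<open>Local finiteness, and a second tight measure for a null overlap\<close>

lemma locally_finite_ball:
  assumes \<mu>: "sets \<mu> = sets borel" and "locally_finite_measure \<mu>"
  shows "emeasure \<mu> (ball 0 r) < \<infinity>"
proof -
  obtain U where U: "\<And>x. open (U x)" "\<And>x. x \<in> U x" "\<And>x. emeasure \<mu> (U x) < \<infinity>"
    using assms(2) unfolding locally_finite_measure_def by metis
  obtain C where C: "finite C" "cball 0 r \<subseteq> (\<Union>x\<in>C. U x)"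
    by (rule compactE_image[OF compact_cball, of "cball 0 r" U 0 r]) (use U in auto)
  have m: "U x \<in> sets \<mu>" for x using U(1) \<mu> by simp
  have "emeasure \<mu> (ball 0 r) \<le> emeasure \<mu> (\<Union>x\<in>C. U x)"
    using C(2) m C(1) by (intro emeasure_mono sets.finite_UN) (auto simp: subset_iff)
  also have "\<dots> \<le> (\<Sum>x\<in>C. emeasure \<mu> (U x))"
    using C(1) m by (intro emeasure_subadditive_finite) auto
  also have "\<dots> < \<infinity>" using C(1) U(3) by auto
  finally show ?thesis .
qed

lemma locally_finite_scale_lborel: "locally_finite_measure (scale_measure (ennreal c) (lborel :: (real^'d) measure))"
  unfolding locally_finite_measure_def
proof
  fix x :: "real^'d"
  show "\<exists>U. open U \<and> x \<in> U \<and> emeasure (scale_measure (ennreal c) lborel) U < \<infinity>"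
    using emeasure_lborel_ball_finite[of x 1]
    by (intro exI[of _ "ball x 1"]) (auto simp: ennreal_mult_less_top)
qed

text \<open>The density equals \<open>4 * (cos (pi * (\<xi> \<bullet> x)))\<^sup>2\<close>: bounded,
  continuous, and with zeros when \<open>x \<noteq> 0\<close>.\<close>

definition modulated_lborel :: "'a::euclidean_space \<Rightarrow> 'a measure" where
  "modulated_lborel x = density lborel (\<lambda>\<xi>. ennreal ((norm (1 + cis (- (2 * pi * (\<xi> \<bullet> x)))))\<^sup>2))"

text \<open>The weight is absorbed into the function: the weighted transform of \<open>f\<close> is
  the transform of \<open>h\<close>, the sum of \<open>f\<close> and its translate by
  \<open>x\<close>. Off a null set at most one summand is nonzero, so the squared norms add, and two
  equal norms give the constant 2.\<close>

lemma frame_on_modulated_lborel: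
  fixes \<Omega> :: "'a::euclidean_space set"
  assumes \<Omega>: "\<Omega> \<in> sets borel" "emeasure lborel \<Omega> < \<infinity>"
    and null: "emeasure lborel {y \<in> \<Omega>. y + - x \<in> \<Omega>} = 0"
  shows "frame_on \<Omega> (modulated_lborel x) 2"
  unfolding frame_on_def
proof
  fix f assume f: "f \<in> L2on \<Omega>"
  note [measurable] = L2onD(1)[OF f] \<Omega>(1)
  define h where "h y = f y + f (y - x)" for y
  have i: "integrable lborel f" by (rule L2on_integrable(1)[OF f \<Omega>])
  note it = integrable_lborel_translate[OF i, of "- x"]
  have st: "sqn lborel (\<lambda>y. f (y - x)) = sqn lborel f"
    using sqn_translate[OF L2onD(1)[OF f], of "- x"] by simp
  have ih: "integrable lborel h" unfolding h_def using i it by simp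
  have sh: "sqn lborel h < \<infinity>"
    unfolding h_def using L2onD(3)[OF f] st by (intro sqn_add_finite) auto
  have fth: "ft h \<xi> = ft f \<xi> * (1 + cis (- (2 * pi * (\<xi> \<bullet> x))))" for \<xi>
    unfolding h_def using i it by (subst ft_add) (auto simp: ft_translate algebra_simps)
  have "sqn (modulated_lborel x) (ft f) = sqn lborel (ft h)"
    unfolding sqn_def modulated_lborel_def fth
    by (subst nn_integral_density) (auto simp: norm_mult power_mult_distrib ennreal_mult mult.commute)
  also have "\<dots> = sqn lborel h" by (rule plancherel[OF ih sh])
  also have "\<dots> = (\<integral>\<^sup>+y. ennreal ((norm (f y))\<^sup>2) + ennreal ((norm (f (y - x)))\<^sup>2) \<partial>lborel)"
    unfolding sqn_def
  proof (rule nn_integral_cong_AE)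
    have "{y \<in> \<Omega>. y + - x \<in> \<Omega>} \<in> null_sets lborel" using null by (intro null_setsI) auto
    then show "AE y in lborel. ennreal ((norm (h y))\<^sup>2) = ennreal ((norm (f y))\<^sup>2) + ennreal ((norm (f (y - x)))\<^sup>2)"
    proof (rule AE_mp[OF AE_not_in], intro AE_I2 impI)
      fix y assume "y \<notin> {y \<in> \<Omega>. y + - x \<in> \<Omega>}"
      then have "f y = 0 \<or> f (y - x) = 0" using L2onD(2)[OF f] by auto
      then show "ennreal ((norm (h y))\<^sup>2) = ennreal ((norm (f y))\<^sup>2) + ennreal ((norm (f (y - x)))\<^sup>2)"
        by (auto simp: h_def)
    qed
  qed
  also have "\<dots> = sqn lborel f + sqn lborel (\<lambda>y. f (y - x))"
    unfolding sqn_def by (rule nn_integral_add) auto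
  also have "\<dots> = ennreal 2 * sqn lborel f" by (simp add: st mult_2)
  finally show "sqn (modulated_lborel x) (ft f) = ennreal 2 * sqn lborel f" .
qed

lemma modulated_lborel_locally_finite: "locally_finite_measure (modulated_lborel (x :: real^'d))"
  unfolding locally_finite_measure_def
proof
  fix z :: "real^'d"
  have "norm (1 + cis t) \<le> 2" for t using norm_triangle_ineq[of 1 "cis t"] by simp
  then have b: "(norm (1 + cis t))\<^sup>2 \<le> 4" for t using power_mono[of "norm (1 + cis t)" 2 2] by simp
  have "emeasure (modulated_lborel x) (ball z 1) \<le> (\<integral>\<^sup>+\<xi>. ennreal 4 * indicator (ball z 1) \<xi> \<partial>lborel)"
    unfolding modulated_lborel_def using b
    by (subst emeasure_density) (auto intro!: nn_integral_mono mult_right_mono ennreal_leI simp del: ennreal_numeral)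
  also have "\<dots> = ennreal 4 * emeasure lborel (ball z 1)" by (rule nn_integral_cmult_indicator) simp
  also have "\<dots> < \<infinity>" using emeasure_lborel_ball_finite[of z 1] by (simp add: ennreal_mult_less_top)
  finally show "\<exists>U. open U \<and> z \<in> U \<and> emeasure (modulated_lborel x) U < \<infinity>"
    by (intro exI[of _ "ball z 1"]) auto
qed

text \<open>Equal measures have densities that agree almost everywhere, here even everywhere: by
  continuity the exceptional set is open, and an open null set is empty. But this density has a
  zero, while \<open>c > 0\<close>.\<close>

lemma modulated_lborel_not_scale:
  fixes x :: "'a::euclidean_space"
  assumes x: "x \<noteq> 0" and c: "c > 0"
  shows "modulated_lborel x \<noteq> scale_measure (ennreal c) lborel"
proof
  assume eq: "modulated_lborel x = scale_measure (ennreal c) lborel"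
  let ?k = "\<lambda>\<xi>. (norm (1 + cis (- (2 * pi * (\<xi> \<bullet> x)))))\<^sup>2"
  have "density lborel (\<lambda>\<xi>. ennreal (?k \<xi>)) = density lborel (\<lambda>_. ennreal c)"
    unfolding modulated_lborel_def[symmetric] eq
    by (rule measure_eqI) (auto simp: emeasure_density_const)
  then have "AE \<xi> in lborel. ennreal (?k \<xi>) = ennreal c"
    by (rule sigma_finite_measure.density_unique[OF sigma_finite_lborel, rotated 2]) measurable
  then have ae: "AE \<xi> in lborel. ?k \<xi> = c"
    by eventually_elim (use c in auto)
  have "open {\<xi>. ?k \<xi> \<noteq> c}"
    by (intro open_Collect_neq continuous_intros)
  moreover have "negligible {\<xi>. ?k \<xi> \<noteq> c}"
  proof -
    have "{\<xi> \<in> space lborel. \<not> ?k \<xi> = c} \<in> null_sets lborel"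
      using ae by (subst AE_iff_null[symmetric]) (simp_all, measurable)
    then show ?thesis by (simp add: negligible_iff_null_sets null_sets_completionI)
  qed
  ultimately have "{\<xi>. ?k \<xi> \<noteq> c} = {}"
    using open_not_negligible by blast
  then have all: "?k \<xi> = c" for \<xi> by blast
  \<comment> \<open>At this point the inner product with \<open>x\<close> is 1/2, so the phase
    factor is -1.\<close>
  have "?k ((1 / (2 * (x \<bullet> x))) *\<^sub>R x) = 0"
    using x by (simp add: complex_eq_iff)
  then show False using all[of "(1 / (2 * (x \<bullet> x))) *\<^sub>R x"] c by simp
qed

section \<open>Uniqueness of the tight frame measure versus positive overlaps\<close>

theorem theorem4p5:
  fixes \<Omega> :: "(real^'d) set"
  assumes "\<Omega> \<in> sets lebesgue" and "emeasure lebesgue \<Omega> < \<infinity>"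
  shows "(\<forall>\<mu> :: (real^'d) measure.
            tight_frame_measure \<Omega> \<mu> \<longleftrightarrow> (\<exists>c>0::real. \<mu> = scale_measure (ennreal c) lborel))
     \<longleftrightarrow> (\<forall>x :: real^'d. x \<noteq> 0 \<longrightarrow> emeasure lebesgue (\<Omega> \<inter> (\<lambda>y. y + x) ` \<Omega>) > 0)"
proof -
  \<comment> \<open>\<open>\<Omega>'\<close> differs from \<open>\<Omega>\<close> by a null set
    only, so tightness and the measures of the overlaps can be computed with it.\<close>
  obtain \<Omega>' N where \<Omega>': "\<Omega>' \<subseteq> \<Omega>" "\<Omega>' \<in> sets borel" "N \<in> null_sets lborel" "\<Omega> - \<Omega>' \<subseteq> N"
    using sets_lebesgue_inner_borel[OF assms(1)] .
  note tight = tight_frame_measure_iff_frame_on[OF assms(1) \<Omega>'] and over = emeasure_overlap[OF assms(1) \<Omega>']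
  have fin: "emeasure lborel \<Omega>' < \<infinity>"
  proof -
    have "emeasure lborel \<Omega>' = emeasure lebesgue \<Omega>'" using \<Omega>'(2) by simp
    also have "\<dots> \<le> emeasure lebesgue \<Omega>" using \<Omega>'(1) assms(1) by (rule emeasure_mono)
    finally show ?thesis using assms(2) by simp
  qed
  show ?thesis
  proof
    assume i: "\<forall>\<mu> :: (real^'d) measure.
            tight_frame_measure \<Omega> \<mu> \<longleftrightarrow> (\<exists>c>0::real. \<mu> = scale_measure (ennreal c) lborel)"
    show "\<forall>x :: real^'d. x \<noteq> 0 \<longrightarrow> emeasure lebesgue (\<Omega> \<inter> (\<lambda>y. y + x) ` \<Omega>) > 0"
    proof (intro allI impI, rule ccontr)
      fix x :: "real^'d" assume x: "x \<noteq> 0" and "\<not> emeasure lebesgue (\<Omega> \<inter> (\<lambda>y. y + x) ` \<Omega>) > 0"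
      then have "frame_on \<Omega>' (modulated_lborel x) 2"
        by (intro frame_on_modulated_lborel[OF \<Omega>'(2) fin]) (simp add: over)
      moreover have "sets (modulated_lborel x) = sets borel" by (simp add: modulated_lborel_def)
      ultimately have "tight_frame_measure \<Omega> (modulated_lborel x)"
        unfolding tight using modulated_lborel_locally_finite by (auto intro!: exI[of _ "2::real"])
      then show False using i modulated_lborel_not_scale[OF x] by blast
    qed
  next
    assume ii: "\<forall>x :: real^'d. x \<noteq> 0 \<longrightarrow> emeasure lebesgue (\<Omega> \<inter> (\<lambda>y. y + x) ` \<Omega>) > 0"
    have pos: "emeasure lborel {y \<in> \<Omega>'. y + t \<in> \<Omega>'} > 0" for t
    proof (cases "t = 0")
      case False
      then show ?thesis using ii[rule_format, of "- t"] over[of "- t"] by simp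
    next
      \<comment> \<open>The hypothesis says nothing at 0. There the overlap is all of
        \<open>\<Omega>'\<close>, which contains the overlap for any nonzero vector
        \<open>b\<close>.\<close>
      case True
      obtain b :: "real^'d" where "b \<in> Basis" using nonempty_Basis by blast
      then have "b \<noteq> 0" by auto
      have "0 < emeasure lborel {y \<in> \<Omega>'. y + - b \<in> \<Omega>'}" using ii[rule_format, OF \<open>b \<noteq> 0\<close>] unfolding over .
      also have "\<dots> \<le> emeasure lborel {y \<in> \<Omega>'. y + t \<in> \<Omega>'}"
        using True \<Omega>'(2) by (intro emeasure_mono) auto
      finally show ?thesis .
    qed
    show "\<forall>\<mu> :: (real^'d) measure.
            tight_frame_measure \<Omega> \<mu> \<longleftrightarrow> (\<exists>c>0::real. \<mu> = scale_measure (ennreal c) lborel)"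
    proof (intro allI iffI)
      fix \<mu> :: "(real^'d) measure" assume "tight_frame_measure \<Omega> \<mu>"
      then obtain A where \<mu>: "sets \<mu> = sets borel" "locally_finite_measure \<mu>" and A: "A > 0" "frame_on \<Omega>' \<mu> A"
        unfolding tight by blast
      \<comment> \<open>Both measures satisfy the frame identity with the same constant
        \<open>A\<close> on every ball around 0.\<close>
      have "\<mu> = scale_measure (ennreal A) lborel"
      proof (rule frame_on_balls_unique[OF \<mu>(1)])
        show "frame_on (ball 0 R) \<mu> A" for R
          by (rule frame_on_bounded[OF \<Omega>'(2) fin pos \<mu>(1) locally_finite_ball[OF \<mu>] A(2,1) bounded_ball])
        show "frame_on (ball 0 R) (scale_measure (ennreal A) lborel) A" for R
          by (rule frame_on_scale_lborel) (auto simp: emeasure_lborel_ball_finite[unfolded infinity_ennreal_def])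
      qed simp
      then show "\<exists>c>0. \<mu> = scale_measure (ennreal c) lborel" using A(1) by blast
    next
      fix \<mu> :: "(real^'d) measure" assume "\<exists>c>0::real. \<mu> = scale_measure (ennreal c) lborel"
      then obtain c where c: "c > 0" "\<mu> = scale_measure (ennreal c) lborel" by blast
      then show "tight_frame_measure \<Omega> \<mu>"
        unfolding tight using frame_on_scale_lborel[OF \<Omega>'(2) fin, of c] locally_finite_scale_lborel[of c] by auto
    qed
  qed
qed

end
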